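(* Let $A\in L^2_{\rm loc}(\mathbb{R}^+)$ be the coefficient of a Krein system with spectral measure $\sigma$, and let $r>0$. If $z_1$ is a zero of $P(r,\cdot)$, then there is no other zero of $P(r,\cdot)$ in $$\Omega_1=\left\{\lambda\in\mathbb{C}^+:\ |\lambda-\bar z_1|<\operatorname{Dist}(\lambda,\operatorname{supp}(d\sigma))\right\}.$$
   Context: $\mathbb{C}^+$ is the open upper half-plane. Krein system: for complex-valued $A\in L^2_{\rm loc}(\mathbb{R}^+)$ (i.e. $A\in L^2[0,R]$ for all $R>0$) and $\lambda\in\mathbb{C}$, $P(r,\lambda),P_*(r,\lambda)$ solve $P'=i\lambda P-\overline{A(r)}P_*$, $P_*'=-A(r)P$, $P(0,\lambda)=P_*(0,\lambda)=1$. Spectral measure: an accelerant is a function $H\in L^2_{\rm loc}(\mathbb{R})$ with $H(-x)=\overline{H(x)}$ such that for every $r>0$ the operator $(\mathcal{H}_rf)(x)=\int_0^rH(x-t)f(t)dt$ on $L^2[0,r]$ satisfies $I+\mathcal{H}_r>0$; its resolvent kernel $\Gamma_r$ satisfies $\Gamma_r(t,s)+\int_0^rH(t-u)\Gamma_r(u,s)du=H(t-s)$. Each $A\in L^2_{\rm loc}(\mathbb{R}^+)$ has a unique accelerant $H$ with $\overline{A(r)}=H(r)-\int_0^rH(r-u)\Gamma_r(u,0)du$ for a.e. $r$. The spectral measure $\sigma$ is the unique positive Borel measure on $\mathbb{R}$ with $\int\frac{d\sigma(\lambda)}{1+\lambda^2}<\infty$ such that for some $\beta\in\mathbb{R}$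 and all $x\in\mathbb{R}$ $$\frac{|x|}{2}+\int_0^x(x-s)H(s)ds=i\beta x+\int_{-\infty}^\infty\left(1+\frac{i\lambda x}{1+\lambda^2}-e^{i\lambda x}\right)\frac{d\sigma(\lambda)}{\lambda^2}$$ (integrand extended by continuity to $\lambda=0$). Equivalently, $\sigma$ is the weak-$*$ limit of $\frac{d\lambda}{2\pi|P_*(r,\lambda)|^2}$ as $r\to\infty$. *)

theory Defs
  imports "HOL-Analysis.Analysis"
begin

definition L2_on :: "real set \<Rightarrow> (real \<Rightarrow> complex) \<Rightarrow> bool" where
  "L2_on S f \<longleftrightarrow> f \<in> borel_measurable (lebesgue_on S) \<and>
     integrable (lebesgue_on S) (\<lambda>x. (cmod (f x))\<^sup>2)"

text \<open>Coefficients live on the half-line; their values at negative arguments are irrelevant.\<close>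

definition L2_loc_halfline :: "(real \<Rightarrow> complex) \<Rightarrow> bool" where
  "L2_loc_halfline A \<longleftrightarrow> (\<forall>R>0. L2_on {0..R} A)"

definition L2_loc_line :: "(real \<Rightarrow> complex) \<Rightarrow> bool" where
  "L2_loc_line H \<longleftrightarrow> (\<forall>R>0. L2_on {-R..R} H)"

text \<open>As \<open>A\<close> is only locally square integrable, the Krein system is understood in the
  Caratheodory sense: the solutions are locally absolutely continuous in \<open>r\<close> and satisfy the
  equations almost everywhere, which for continuous functions is the integrated form below.\<close>

definition krein_solution ::
  "(real \<Rightarrow> complex) \<Rightarrow> (real \<Rightarrow> complex \<Rightarrow> complex) \<Rightarrow> (real \<Rightarrow> complex \<Rightarrow> complex) \<Rightarrow> bool" where
  "krein_solution A P Ps \<longleftrightarrow>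
     (\<forall>z. continuous_on {0..} (\<lambda>r. P r z) \<and> continuous_on {0..} (\<lambda>r. Ps r z) \<and>
       (\<forall>r\<ge>0. P r z = 1 + (LINT t|lebesgue_on {0..r}. \<i> * z * P t z - cnj (A t) * Ps t z) \<and>
              Ps r z = 1 + (LINT t|lebesgue_on {0..r}. - A t * P t z)))"

definition conv_op :: "(real \<Rightarrow> complex) \<Rightarrow> real \<Rightarrow> (real \<Rightarrow> complex) \<Rightarrow> real \<Rightarrow> complex" where
  "conv_op H r f x = (LINT t|lebesgue_on {0..r}. H (x - t) * f t)"

text \<open>The last clause is strict positivity of \<open>I + conv_op H r\<close> on \<open>L\<^sup>2[0,r]\<close>. The quadratic form is
  real by the symmetry of \<open>H\<close>, so taking its real part loses nothing. Since the operator
  \<open>conv_op H r\<close> is compact, strict positivity is the same as uniform positivity.\<close>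

definition accelerant :: "(real \<Rightarrow> complex) \<Rightarrow> bool" where
  "accelerant H \<longleftrightarrow> L2_loc_line H \<and> (AE x in lebesgue. H (- x) = cnj (H x)) \<and>
     (\<forall>r>0. \<forall>f. L2_on {0..r} f \<longrightarrow> \<not> (AE x in lebesgue_on {0..r}. f x = 0) \<longrightarrow>
        0 < Re (LINT x|lebesgue_on {0..r}. (f x + conv_op H r f x) * cnj (f x)))"

text \<open>For each \<open>s\<close> this determines the column \<open>\<lambda>t. G t s\<close> as an element of \<open>L\<^sup>2[0,r]\<close>, because
  \<open>I + conv_op H r\<close> is invertible; in particular the column \<open>s = 0\<close> is meaningful.\<close>

definition resolvent_kernel :: "(real \<Rightarrow> complex) \<Rightarrow> real \<Rightarrow> (real \<Rightarrow> real \<Rightarrow> complex) \<Rightarrow> bool" where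
  "resolvent_kernel H r G \<longleftrightarrow>
     (\<forall>s\<in>{0..r}. L2_on {0..r} (\<lambda>t. G t s) \<and>
        (AE t in lebesgue_on {0..r}. G t s + conv_op H r (\<lambda>u. G u s) t = H (t - s)))"

definition accelerant_of :: "(real \<Rightarrow> complex) \<Rightarrow> (real \<Rightarrow> complex) \<Rightarrow> bool" where
  "accelerant_of A H \<longleftrightarrow> accelerant H \<and>
     (\<exists>\<Gamma>. (\<forall>r>0. resolvent_kernel H r (\<Gamma> r)) \<and>
        (AE r in lebesgue_on {0..}.
           cnj (A r) = H r - (LINT u|lebesgue_on {0..r}. H (r - u) * \<Gamma> r u 0)))"

text \<open>The value at \<open>l = 0\<close> is the continuous extension in \<open>l\<close>.\<close>

definition spectral_integrand :: "real \<Rightarrow> real \<Rightarrow> complex" where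
  "spectral_integrand x l =
     (if l = 0 then of_real (x\<^sup>2 / 2)
      else (1 + \<i> * of_real (l * x / (1 + l\<^sup>2)) - exp (\<i> * of_real (l * x))) / of_real (l\<^sup>2))"

text \<open>The integral from \<open>0\<close> to \<open>x\<close> is oriented, as \<open>x\<close> may be negative.\<close>

definition spectral_measure :: "(real \<Rightarrow> complex) \<Rightarrow> real measure \<Rightarrow> bool" where
  "spectral_measure A \<sigma> \<longleftrightarrow> sets \<sigma> = sets borel \<and> integrable \<sigma> (\<lambda>l. 1 / (1 + l\<^sup>2)) \<and>
     (\<exists>H. accelerant_of A H \<and>
       (\<exists>\<beta>::real. \<forall>x::real.
          of_real (\<bar>x\<bar> / 2) + (LINT s=ereal 0..ereal x|lebesgue. (of_real (x - s) * H s)) =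
          \<i> * of_real (\<beta> * x) + (LINT l|\<sigma>. spectral_integrand x l)))"

definition measure_support :: "real measure \<Rightarrow> real set" where
  "measure_support \<sigma> = {x. \<forall>U. open U \<longrightarrow> x \<in> U \<longrightarrow> emeasure \<sigma> U > 0}"

text \<open>\<open>infdist\<close> to the empty set is \<open>0\<close> by convention, but a spectral measure is never the zero
  measure, so its support is nonempty.\<close>

definition Omega1 :: "real measure \<Rightarrow> complex \<Rightarrow> complex set" where
  "Omega1 \<sigma> z1 = {z. Im z > 0 \<and>
     cmod (z - cnj z1) < infdist z (complex_of_real ` measure_support \<sigma>)}"

end

theory Submission
  imports Defs "HOL-Complex_Analysis.Great_Picard"
begin

text \<open>
  Let \<open>f\<^sub>r\<close> be the first column of the resolvent kernel on \<open>[0,r]\<close>. Integrating the Krein-Bellman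
  equation for \<open>f\<^sub>r\<close> shows that
  \<open>P(r,z) = exp (i z r) - \<integral> f\<^sub>r(r - s) exp (i z s) ds\<close>. Taking second differences of the
  representation that defines \<open>\<sigma>\<close> yields
  \<open>k(0) + \<integral> H k = \<integral> ft k d\<sigma>\<close> for continuous compactly supported \<open>k\<close> whose transform
  \<open>ft k\<close> decays quadratically. Hence the \<open>L\<^sup>2(\<sigma>)\<close> norm of a transform is given by the positive form
  \<open>I + conv H\<close>, and the resolvent equation makes \<open>P(r,\<cdot>)\<close> orthogonal in \<open>L\<^sup>2(\<sigma>)\<close> to the
  transforms of continuous functions supported in \<open>[0,r]\<close>, vanishing at its endpoints, with
  quadratic decay.

  If \<open>z\<^sub>1 \<noteq> z\<^sub>2\<close> are both zeros, put \<open>D = P / (l - z\<^sub>1)\<close> and \<open>U = D / (l - z\<^sub>2)\<close>, which are again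
  transforms of functions supported in \<open>[0,r]\<close>. Orthogonality of \<open>U\<close> and \<open>P\<close> reads
  \<open>\<integral> \<bar>D\<bar>\<^sup>2 (l - cnj z\<^sub>1) / (l - z\<^sub>2) d\<sigma> = 0\<close>. If \<open>z\<^sub>2\<close> lies in \<open>\<Omega>\<^sub>1\<close>, the factor
  \<open>(l - cnj z\<^sub>1) / (l - z\<^sub>2) = 1 + (z\<^sub>2 - cnj z\<^sub>1) / (l - z\<^sub>2)\<close> has real part bounded below by a
  positive constant on the support of \<open>\<sigma>\<close>, so \<open>\<integral> \<bar>D\<bar>\<^sup>2 d\<sigma> \<le> 0\<close>, contradicting positivity.
\<close>

section \<open>Square integrable functions and convolution\<close>

text \<open>The spectral measure is only known to integrate \<open>1 / (1 + l^2)\<close>, while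
  \<open>P r\<close> is merely bounded on the real line: it is the transform of a point mass at
  \<open>r\<close> minus an L2 density. It need not be square integrable against
  \<open>\<sigma>\<close>, so orthogonality cannot be tested against arbitrary functions. Each
  division by a zero gains one power of decay. After one division the inverse transform still jumps
  at \<open>r\<close>, and \<open>|D|^2\<close> is integrable; after two it is continuous and
  vanishes at both ends, and \<open>U * cnj P\<close> is integrable. Two distinct zeros thus give
  exactly the decay that the argument needs.

  The second obstacle is regularity. \<open>H\<close> is only locally L2, and the resolvent columns
  are determined only almost everywhere, separately for each \<open>r\<close>. Neither their
  diagonal values, which \<open>A\<close> encodes, nor joint measurability is immediate. Both come
  from the smoothing effect of convolution: \<open>conv h (f \<rho>) t\<close> is jointly
  continuous, and the resolvent equation then supplies a jointly Borel representative. Derivatives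
  in \<open>r\<close> are replaced by integral equations, Fubini's theorem and a Gronwall
  argument.\<close>

definition L2 :: "(real \<Rightarrow> complex) \<Rightarrow> bool" where
  "L2 f \<longleftrightarrow> f \<in> borel_measurable borel \<and> integrable lborel (\<lambda>x. (cmod (f x))\<^sup>2)"

text \<open>Carrying the square of the norm avoids roots; the price is a factor 2 in
  \<open>nrm2_add_le\<close>, where the norm would obey the triangle inequality.\<close>

definition nrm2 :: "(real \<Rightarrow> complex) \<Rightarrow> real" where
  "nrm2 f = (LINT x|lborel. (cmod (f x))\<^sup>2)"

definition conv :: "(real \<Rightarrow> complex) \<Rightarrow> (real \<Rightarrow> complex) \<Rightarrow> real \<Rightarrow> complex" where
  "conv h f x = (LINT t|lborel. h (x - t) * f t)"

definition cutoff :: "real \<Rightarrow> real \<Rightarrow> (real \<Rightarrow> complex) \<Rightarrow> real \<Rightarrow> complex" where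
  "cutoff a b f x = (if x \<in> {a..b} then f x else 0)"

lemma borel_measurable_cnj' [measurable (raw)]:
  "f \<in> borel_measurable M \<Longrightarrow> (\<lambda>x. cnj (f x)) \<in> borel_measurable M"
  by (rule borel_measurable_continuous_on[OF continuous_on_cnj[OF continuous_on_id]])

lemma borel_measurable_cutoff [measurable (raw)]:
  "f \<in> borel_measurable borel \<Longrightarrow> cutoff a b f \<in> borel_measurable borel"
proof -
  assume [measurable]: "f \<in> borel_measurable borel"
  have "(\<lambda>x. if x \<in> {a..b} then f x else 0) \<in> borel_measurable borel"
    by (intro measurable_If_set) auto
  then show ?thesis by (simp add: cutoff_def[abs_def])
qed

lemma cutoff_bounds_measurable [measurable (raw)]:
  assumes [measurable]: "F \<in> borel_measurable M" "F' \<in> borel_measurable M" "F'' \<in> borel_measurable M"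
    "u \<in> borel_measurable borel"
  shows "(\<lambda>x. cutoff (F x) (F' x) u (F'' x)) \<in> borel_measurable M"
proof -
  have "(\<lambda>x. if F x \<le> F'' x \<and> F'' x \<le> F' x then u (F'' x) else 0) \<in> borel_measurable M" by measurable
  then show ?thesis by (simp add: cutoff_def)
qed

lemma L2_measurable [measurable_dest]: "L2 f \<Longrightarrow> f \<in> borel_measurable borel"
  by (simp add: L2_def)

lemma L2_integrable: "L2 f \<Longrightarrow> integrable lborel (\<lambda>x. (cmod (f x))\<^sup>2)"
  by (simp add: L2_def)

lemma nrm2_nonneg [simp]: "0 \<le> nrm2 f"
  by (simp add: nrm2_def)

lemma L2_boundedI:
  assumes "f \<in> borel_measurable borel" "integrable lborel g" "\<And>x. (cmod (f x))\<^sup>2 \<le> g x"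
  shows "L2 f"
  unfolding L2_def
proof
  note [measurable] = assms(1)
  show "integrable lborel (\<lambda>x. (cmod (f x))\<^sup>2)"
  proof (rule Bochner_Integration.integrable_bound[OF assms(2)])
    show "AE x in lborel. norm ((cmod (f x))\<^sup>2) \<le> norm (g x)"
      using assms(3) by (auto intro: order_trans[OF _ abs_ge_self])
  qed measurable
qed (fact assms(1))

lemma L2_mono:
  assumes "f \<in> borel_measurable borel" "L2 g" "\<And>x. cmod (f x) \<le> C * cmod (g x)"
  shows "L2 f"
proof (rule L2_boundedI[OF assms(1)])
  show "integrable lborel (\<lambda>x. C\<^sup>2 * (cmod (g x))\<^sup>2)"
    using L2_integrable[OF assms(2)] by simp
  show "(cmod (f x))\<^sup>2 \<le> C\<^sup>2 * (cmod (g x))\<^sup>2" for x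
    using power_mono[OF assms(3), of x 2] by (simp add: power_mult_distrib)
qed

lemma power2_sum_le: "(a + b)\<^sup>2 \<le> 2 * a\<^sup>2 + 2 * (b::real)\<^sup>2"
  using zero_le_power2[of "a - b"] unfolding power2_diff power2_sum by linarith

lemma cmod_add_sq_le: "(cmod (a + b))\<^sup>2 \<le> 2 * (cmod a)\<^sup>2 + 2 * (cmod b)\<^sup>2"
  using power_mono[OF norm_triangle_ineq[of a b] norm_ge_zero, of 2] power2_sum_le[of "cmod a" "cmod b"]
  by linarith

lemma L2_add: assumes "L2 f" "L2 g" shows "L2 (\<lambda>x. f x + g x)"
proof (rule L2_boundedI)
  note [measurable] = assms[THEN L2_measurable]
  show "(\<lambda>x. f x + g x) \<in> borel_measurable borel" by measurable
  show "integrable lborel (\<lambda>x. 2 * (cmod (f x))\<^sup>2 + 2 * (cmod (g x))\<^sup>2)"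
    using assms[THEN L2_integrable] by simp
  show "(cmod (f x + g x))\<^sup>2 \<le> 2 * (cmod (f x))\<^sup>2 + 2 * (cmod (g x))\<^sup>2" for x
    by (rule cmod_add_sq_le)
qed

lemma L2_cmult: assumes "L2 f" shows "L2 (\<lambda>x. c * f x)"
proof (rule L2_mono[OF _ assms, of _ "cmod c"])
  note [measurable] = assms[THEN L2_measurable]
  show "(\<lambda>x. c * f x) \<in> borel_measurable borel" by measurable
qed (simp add: norm_mult)

lemma L2_minus: assumes "L2 f" shows "L2 (\<lambda>x. - f x)"
  using L2_cmult[OF assms, of "-1"] by simp

lemma L2_diff: assumes "L2 f" "L2 g" shows "L2 (\<lambda>x. f x - g x)"
  using L2_add[OF assms(1) L2_minus[OF assms(2)]] by simp

lemma L2_cnj: assumes "L2 f" shows "L2 (\<lambda>x. cnj (f x))"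
proof (rule L2_mono[OF _ assms, of _ 1])
  note [measurable] = assms[THEN L2_measurable]
  show "(\<lambda>x. cnj (f x)) \<in> borel_measurable borel" by measurable
qed simp

lemma L2_zero: "L2 (\<lambda>x. 0)"
  by (simp add: L2_def)

lemma L2_cutoff: assumes "L2 f" shows "L2 (cutoff a b f)"
proof (rule L2_mono[OF _ assms, of _ 1])
  note [measurable] = assms[THEN L2_measurable]
  show "cutoff a b f \<in> borel_measurable borel" by measurable
qed (simp add: cutoff_def)

lemma L2_cutoff_bounded:
  assumes "f \<in> borel_measurable borel" "\<And>x. x \<in> {a..b} \<Longrightarrow> cmod (f x) \<le> B"
  shows "L2 (cutoff a b f)"
proof (rule L2_boundedI)
  note [measurable] = assms(1)
  show "cutoff a b f \<in> borel_measurable borel" by measurable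
  show "integrable lborel (\<lambda>x. B\<^sup>2 * indicat_real {a..b} x)"
    by (intro integrable_mult_right integrable_real_indicator) (auto simp: emeasure_lborel_Icc_eq)
  show "(cmod (cutoff a b f x))\<^sup>2 \<le> B\<^sup>2 * indicat_real {a..b} x" for x
    using assms(2)[of x] by (auto simp: cutoff_def intro: power_mono)
qed

lemma L2_cutoff_continuous:
  assumes "continuous_on UNIV g" shows "L2 (cutoff a b g)"
proof -
  have "compact (g ` {a..b})" by (intro compact_continuous_image continuous_on_subset[OF assms]) auto
  then obtain m where "\<And>x. x \<in> {a..b} \<Longrightarrow> cmod (g x) \<le> m"
    by (metis bounded_iff compact_imp_bounded imageI)
  then show ?thesis by (intro L2_cutoff_bounded[OF borel_measurable_continuous_onI[OF assms]])
qed

lemma L2_mult_continuous: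
  assumes "continuous_on UNIV \<phi>" "L2 (cutoff a b g)"
  shows "L2 (cutoff a b (\<lambda>x. \<phi> x * g x))"
proof -
  note [measurable] = borel_measurable_continuous_onI[OF assms(1)] L2_measurable[OF assms(2)]
  have "compact (\<phi> ` {a..b})" by (intro compact_continuous_image continuous_on_subset[OF assms(1)]) auto
  then obtain m where m: "\<And>x. x \<in> {a..b} \<Longrightarrow> cmod (\<phi> x) \<le> m"
    by (metis bounded_iff compact_imp_bounded imageI)
  have eq: "cutoff a b (\<lambda>x. \<phi> x * g x) = (\<lambda>x. \<phi> x * cutoff a b g x)" by (auto simp: cutoff_def)
  show ?thesis
  proof (rule L2_mono[OF _ assms(2)])
    show "cutoff a b (\<lambda>x. \<phi> x * g x) \<in> borel_measurable borel" unfolding eq by measurable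
    show "cmod (cutoff a b (\<lambda>x. \<phi> x * g x) x) \<le> m * cmod (cutoff a b g x)" for x
      using m[of x] by (auto simp: cutoff_def norm_mult mult_right_mono)
  qed
qed

lemma L2_reflect: assumes "L2 f" shows "L2 (\<lambda>t. f (x - t))"
proof -
  note [measurable] = assms[THEN L2_measurable]
  have "integrable lborel (\<lambda>t. (cmod (f (x + (-1) * t)))\<^sup>2)"
    by (rule lborel_integrable_real_affine[OF L2_integrable[OF assms]]) simp
  then show ?thesis by (simp add: L2_def)
qed

lemma L2_translate: assumes "L2 f" shows "L2 (\<lambda>t. f (t + x))"
  using L2_reflect[OF L2_reflect[OF assms, of 0], of "-x"] by (simp add: add.commute)

lemma nrm2_reflect: "nrm2 (\<lambda>t. f (x - t)) = nrm2 f"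
  unfolding nrm2_def by (subst (2) lborel_integral_real_affine[of "-1" _ x]) auto

lemma nrm2_cmult: "nrm2 (\<lambda>x. c * f x) = (cmod c)\<^sup>2 * nrm2 f"
  by (simp add: nrm2_def norm_mult power_mult_distrib)

lemma nrm2_add_le:
  assumes "L2 f" "L2 g" shows "nrm2 (\<lambda>x. f x + g x) \<le> 2 * nrm2 f + 2 * nrm2 g"
proof -
  have "nrm2 (\<lambda>x. f x + g x) \<le> (LINT x|lborel. 2 * (cmod (f x))\<^sup>2 + 2 * (cmod (g x))\<^sup>2)"
    unfolding nrm2_def
    by (rule integral_mono)
      (use assms in \<open>auto intro!: cmod_add_sq_le L2_integrable L2_add integrable_add integrable_mult_right\<close>)
  also have "\<dots> = 2 * nrm2 f + 2 * nrm2 g"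
    using assms by (simp add: nrm2_def L2_integrable)
  finally show ?thesis .
qed

lemma nrm2_minus_commute: "nrm2 (\<lambda>x. f x - g x) = nrm2 (\<lambda>x. g x - f x)"
  by (simp add: nrm2_def norm_minus_commute)

lemma nrm2_diff_le:
  assumes "L2 f" "L2 g" shows "nrm2 (\<lambda>x. f x - g x) \<le> 2 * nrm2 f + 2 * nrm2 g"
  using nrm2_add_le[OF assms(1) L2_minus[OF assms(2)]] by (simp add: nrm2_def)

lemma nrm2_cong_AE:
  assumes "AE x in lborel. f x = g x" "f \<in> borel_measurable borel" "g \<in> borel_measurable borel"
  shows "nrm2 f = nrm2 g"
proof -
  note [measurable] = assms(2,3)
  show ?thesis unfolding nrm2_def by (rule integral_cong_AE) (use assms(1) in auto)
qed

lemma nrm2_mono_AE: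
  assumes "AE x in lborel. cmod (f x) \<le> cmod (g x)" "L2 f" "L2 g"
  shows "nrm2 f \<le> nrm2 g"
  unfolding nrm2_def
  by (rule integral_mono_AE) (use assms in \<open>auto intro: L2_integrable power_mono\<close>)

lemma nrm2_eq_0: assumes "L2 f" "nrm2 f = 0" shows "AE x in lborel. f x = 0"
  using integral_nonneg_eq_0_iff_AE[OF L2_integrable[OF assms(1)]] assms(2) by (simp add: nrm2_def)

lemma nrm2_zero_AE: assumes "AE x in lborel. f x = 0" "L2 f" shows "nrm2 f = 0"
  using integral_nonneg_eq_0_iff_AE[OF L2_integrable[OF assms(2)]] assms by (simp add: nrm2_def)

lemma L2_mult_integrable:
  assumes "L2 f" "L2 g" shows "integrable lborel (\<lambda>x. f x * g x)"
proof (rule Bochner_Integration.integrable_bound)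
  note [measurable] = assms[THEN L2_measurable]
  show "integrable lborel (\<lambda>x. (cmod (f x))\<^sup>2 + (cmod (g x))\<^sup>2)"
    using assms[THEN L2_integrable] by simp
  show "(\<lambda>x. f x * g x) \<in> borel_measurable lborel" by measurable
  have "cmod (f x) * cmod (g x) \<le> (cmod (f x))\<^sup>2 + (cmod (g x))\<^sup>2" for x
    using sum_squares_bound[of "cmod (f x)" "cmod (g x)"]
      mult_nonneg_nonneg[OF norm_ge_zero norm_ge_zero, of "f x" "g x"] by linarith
  then show "AE x in lborel. norm (f x * g x) \<le> norm ((cmod (f x))\<^sup>2 + (cmod (g x))\<^sup>2)"
    by (simp add: norm_mult)
qed

text \<open>The integral of \<open>(s * cmod f - cmod g)^2\<close> is a nonnegative quadratic
  polynomial in \<open>s\<close>. Having absolute values inside the integral also serves the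
  integrability conditions of Fubini's theorem.\<close>

lemma Cauchy_Schwarz_abs:
  assumes "L2 f" "L2 g"
  shows "(LINT x|lborel. cmod (f x) * cmod (g x))\<^sup>2 \<le> nrm2 f * nrm2 g"
proof -
  define I where "I = (LINT x|lborel. cmod (f x) * cmod (g x))"
  have i: "integrable lborel (\<lambda>x. cmod (f x) * cmod (g x))"
    using integrable_norm[OF L2_mult_integrable[OF assms]] by (simp add: norm_mult)
  have q: "0 \<le> s\<^sup>2 * nrm2 f - 2 * s * I + nrm2 g" for s
  proof -
    have "0 \<le> (LINT x|lborel. (s * cmod (f x) - cmod (g x))\<^sup>2)" by simp
    also have "\<dots> = (LINT x|lborel. s\<^sup>2 * (cmod (f x))\<^sup>2 - 2 * s * (cmod (f x) * cmod (g x)) + (cmod (g x))\<^sup>2)"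
      by (simp add: power2_diff power_mult_distrib algebra_simps)
    also have "\<dots> = s\<^sup>2 * nrm2 f - 2 * s * I + nrm2 g"
      using i assms by (simp add: nrm2_def I_def L2_integrable)
    finally show ?thesis .
  qed
  show ?thesis
  proof (cases "nrm2 f = 0")
    case True
    have "I = 0"
    proof (rule ccontr)
      assume "I \<noteq> 0"
      \<comment> \<open>For \<open>nrm2 f = 0\<close> the polynomial is affine in \<open>s\<close>,
        and at this point it takes the value -1.\<close>
      with q[of "(nrm2 g + 1) / (2 * I)"] True show False by simp
    qed
    then show ?thesis using True by (simp add: I_def)
  next
    case False
    then have p: "nrm2 f > 0" using nrm2_nonneg[of f] by linarith
    have "0 \<le> nrm2 g - I\<^sup>2 / nrm2 f"
      using q[of "I / nrm2 f"] p by (simp add: field_simps power2_eq_square)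
    then show ?thesis using p by (simp add: I_def field_simps)
  qed
qed

lemma Cauchy_Schwarz_L2:
  assumes "L2 f" "L2 g"
  shows "(cmod (LINT x|lborel. f x * g x))\<^sup>2 \<le> nrm2 f * nrm2 g"
proof -
  have "cmod (LINT x|lborel. f x * g x) \<le> (LINT x|lborel. cmod (f x) * cmod (g x))"
    using integral_norm_bound[of lborel "\<lambda>x. f x * g x"] by (simp add: norm_mult)
  then show ?thesis
    using Cauchy_Schwarz_abs[OF assms]
    by (rule order_trans[OF power_mono[OF _ norm_ge_zero]])
qed

lemma conv_integrable: "L2 h \<Longrightarrow> L2 f \<Longrightarrow> integrable lborel (\<lambda>t. h (x - t) * f t)"
  by (intro L2_mult_integrable L2_reflect)

lemma conv_bound: assumes "L2 h" "L2 f" shows "(cmod (conv h f x))\<^sup>2 \<le> nrm2 h * nrm2 f"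
  using Cauchy_Schwarz_L2[OF L2_reflect[OF assms(1), of x] assms(2)] by (simp add: conv_def nrm2_reflect)

lemma conv_diff_right:
  assumes "L2 h" "L2 f" "L2 g" shows "conv h (\<lambda>t. f t - g t) x = conv h f x - conv h g x"
  using assms by (simp add: conv_def right_diff_distrib conv_integrable)

lemma conv_cong_AE:
  assumes "AE t in lborel. f t = g t" "L2 h" "L2 f" "L2 g" shows "conv h f x = conv h g x"
proof -
  note [measurable] = assms(2-)[THEN L2_measurable]
  show ?thesis unfolding conv_def by (rule integral_cong_AE) (use assms(1) in auto)
qed

section \<open>Density of continuous functions and continuity of translations\<close>

lemma cutoff_eq_zero: "x \<notin> {a..b} \<Longrightarrow> cutoff a b f x = 0"
  unfolding cutoff_def by (rule if_not_P)

definition clamp :: "real \<Rightarrow> complex \<Rightarrow> complex" where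
  "clamp m z = of_real (m / max m (cmod z)) * z"

lemma clamp_id: "m > 0 \<Longrightarrow> cmod z \<le> m \<Longrightarrow> clamp m z = z"
  by (auto simp: clamp_def max_def)

lemma norm_clamp_le: assumes "m > 0" shows "cmod (clamp m z) \<le> cmod z" "cmod (clamp m z) \<le> m"
proof -
  have q: "0 < max m (cmod z)" using assms by simp
  have n: "cmod (clamp m z) = m / max m (cmod z) * cmod z"
    using assms q by (simp add: clamp_def norm_mult norm_divide)
  have "m / max m (cmod z) \<le> 1" using q by simp
  then show "cmod (clamp m z) \<le> cmod z"
    unfolding n using mult_right_mono[of "m / max m (cmod z)" 1 "cmod z"] by simp
  have "cmod z / max m (cmod z) \<le> 1" using q by simp
  then show "cmod (clamp m z) \<le> m"
    unfolding n using mult_left_mono[of "cmod z / max m (cmod z)" 1 m] assms by simp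
qed

lemma continuous_on_clamp: assumes "m > 0" shows "continuous_on UNIV (clamp m)"
proof -
  have "max m (cmod z) \<noteq> 0" for z using less_le_trans[OF assms, of "max m (cmod z)"] by linarith
  then show ?thesis unfolding clamp_def[abs_def]
    by (intro continuous_intros) (use assms in \<open>auto simp: max_def split: if_splits\<close>)
qed

lemma clamp_measurable: "m > 0 \<Longrightarrow> f \<in> borel_measurable M \<Longrightarrow> (\<lambda>x. clamp m (f x)) \<in> borel_measurable M"
  by (rule borel_measurable_continuous_on[OF continuous_on_clamp])

lemma nrm2_dominated_convergence:
  assumes m: "f \<in> borel_measurable borel" "\<And>n. s n \<in> borel_measurable borel"
    and w: "integrable lborel w" "\<And>n x. (cmod (s n x - f x))\<^sup>2 \<le> w x"
    and lim: "AE x in lborel. (\<lambda>n. s n x) \<longlonglongrightarrow> f x"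
  shows "(\<lambda>n. nrm2 (\<lambda>x. s n x - f x)) \<longlonglongrightarrow> 0"
proof -
  note [measurable] = m
  have "(\<lambda>n. LINT x|lborel. (cmod (s n x - f x))\<^sup>2) \<longlonglongrightarrow> (LINT x|(lborel::real measure). 0)"
  proof (rule integral_dominated_convergence[OF _ _ w(1)])
    show "AE x in lborel. (\<lambda>n. (cmod (s n x - f x))\<^sup>2) \<longlonglongrightarrow> 0"
      using lim
    proof eventually_elim
      case (elim x)
      then have "(\<lambda>n. cmod (s n x - f x)) \<longlonglongrightarrow> 0"
        using LIM_zero tendsto_norm_zero by blast
      then show ?case using tendsto_power[of _ 0 _ 2] by simp
    qed
    show "AE x in lborel. norm ((cmod (s n x - f x))\<^sup>2) \<le> w x" for n
      using w(2) by simp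
  qed measurable
  then show ?thesis by (simp add: nrm2_def)
qed

text \<open>Continuous functions are dense because a measurable function is almost everywhere a limit of
  continuous ones (\<open>measurable_on_iff_borel_measurable\<close>); clamping makes the convergence dominated.\<close>

lemma L2_approx_continuous:
  assumes h: "L2 h" and supp: "\<And>x. x \<notin> {a..b} \<Longrightarrow> h x = 0" and "e > 0"
  obtains \<psi> m where "continuous_on UNIV \<psi>" "\<And>x. cmod (\<psi> x) \<le> m" "nrm2 (\<lambda>x. cutoff a b \<psi> x - h x) < e"
proof -
  note [measurable] = h[THEN L2_measurable]
  define k where "k m = cutoff a b (\<lambda>x. clamp (real (Suc m)) (h x))" for m
  have km [measurable]: "k m \<in> borel_measurable borel" for m
    unfolding k_def by (intro borel_measurable_cutoff clamp_measurable) auto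
  have kle: "cmod (k m x) \<le> cmod (h x)" for m x
    unfolding k_def cutoff_def using norm_clamp_le(1)[of "real (Suc m)" "h x"] by auto
  have L2k: "L2 (k m)" for m
    by (rule L2_mono[OF km h, of _ 1]) (use kle in simp)
  have "(\<lambda>m. nrm2 (\<lambda>x. k m x - h x)) \<longlonglongrightarrow> 0"
  proof (rule nrm2_dominated_convergence)
    show "integrable lborel (\<lambda>x. 4 * (cmod (h x))\<^sup>2)" using L2_integrable[OF h] by simp
    show "(cmod (k m x - h x))\<^sup>2 \<le> 4 * (cmod (h x))\<^sup>2" for m x
    proof -
      have "cmod (k m x - h x) \<le> 2 * cmod (h x)"
        using kle[of m x] norm_triangle_ineq4[of "k m x" "h x"] by linarith
      from power_mono[OF this norm_ge_zero, of 2] show ?thesis by (simp add: power_mult_distrib)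
    qed
    show "AE x in lborel. (\<lambda>m. k m x) \<longlonglongrightarrow> h x"
    proof (rule AE_I2)
      fix x
      obtain M :: nat where M: "cmod (h x) \<le> real M" using real_arch_simple by blast
      have "k m x = h x" if "m \<ge> M" for m
      proof (cases "x \<in> {a..b}")
        case True
        have "cmod (h x) \<le> real (Suc m)" using M that by linarith
        then show ?thesis using True unfolding k_def cutoff_def by (simp add: clamp_id)
      next
        case False then show ?thesis using supp unfolding k_def by (simp add: cutoff_eq_zero)
      qed
      then have "eventually (\<lambda>m. k m x = h x) sequentially"
        using eventually_sequentially by blast
      then show "(\<lambda>m. k m x) \<longlonglongrightarrow> h x" by (rule tendsto_eventually)
    qed
  qed measurable
  from order_tendstoD(2)[OF this, of "e/4"] \<open>e > 0\<close>
  obtain m where m: "nrm2 (\<lambda>x. k m x - h x) < e / 4"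
    by (auto simp: eventually_sequentially)
  have "h \<in> borel_measurable lebesgue" by (rule measurable_completion) measurable
  then have "h measurable_on UNIV"
    using measurable_on_iff_borel_measurable[of UNIV h] by (simp add: lebesgue_on_UNIV_eq)
  then obtain N g where N: "negligible N" and g: "\<And>n. continuous_on UNIV (g n)"
    and lim: "\<And>x. x \<notin> N \<Longrightarrow> (\<lambda>n. g n x) \<longlonglongrightarrow> h x"
    unfolding measurable_on_def by auto
  \<comment> \<open>The approximants of \<open>h\<close> are clamped at the level already used for
    \<open>h\<close>, so they converge almost everywhere to \<open>k m\<close> and stay dominated by
    a constant on \<open>{a..b}\<close>.\<close>
  define \<psi> where "\<psi> n x = clamp (real (Suc m)) (g n x)" for n x
  have cont: "continuous_on UNIV (\<psi> n)" for n
    unfolding \<psi>_def using continuous_on_compose2[OF continuous_on_clamp[of "real (Suc m)"] g[of n]] by simp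
  have \<psi>le: "cmod (\<psi> n x) \<le> real (Suc m)" for n x
    unfolding \<psi>_def by (rule norm_clamp_le) simp
  have [measurable]: "\<psi> n \<in> borel_measurable borel" for n
    using cont by (rule borel_measurable_continuous_onI)
  have "(\<lambda>n. nrm2 (\<lambda>x. cutoff a b (\<psi> n) x - k m x)) \<longlonglongrightarrow> 0"
  proof (rule nrm2_dominated_convergence)
    show "integrable lborel (\<lambda>x. (2 * real (Suc m))\<^sup>2 * indicat_real {a..b} x)"
      by (intro integrable_mult_right integrable_real_indicator) (auto simp: emeasure_lborel_Icc_eq)
    show "(cmod (cutoff a b (\<psi> n) x - k m x))\<^sup>2 \<le> (2 * real (Suc m))\<^sup>2 * indicat_real {a..b} x" for n x
    proof (cases "x \<in> {a..b}")
      case True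
      have "cmod (k m x) \<le> real (Suc m)"
        using True norm_clamp_le(2)[of "real (Suc m)" "h x"] by (simp add: k_def cutoff_def)
      then have "cmod (cutoff a b (\<psi> n) x - k m x) \<le> 2 * real (Suc m)"
        using \<psi>le[of n x] True norm_triangle_ineq4[of "\<psi> n x" "k m x"] by (simp add: cutoff_def)
      from power_mono[OF this norm_ge_zero, of 2] show ?thesis using True by simp
    next
      case False then show ?thesis by (simp add: cutoff_eq_zero k_def)
    qed
    have "N \<in> null_sets lebesgue" using N by (simp add: negligible_iff_null_sets)
    then have "AE x in lebesgue. x \<notin> N" by (rule AE_not_in)
    then have "AE x in lborel. x \<notin> N" by (simp add: AE_completion_iff)
    then show "AE x in lborel. (\<lambda>n. cutoff a b (\<psi> n) x) \<longlonglongrightarrow> k m x"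
    proof eventually_elim
      case (elim x)
      have "isCont (clamp (real (Suc m))) (h x)"
        using continuous_on_clamp[of "real (Suc m)"] by (simp add: continuous_on_eq_continuous_at)
      from isCont_tendsto_compose[OF this lim[OF elim]]
      show ?case unfolding cutoff_def k_def \<psi>_def by auto
    qed
  qed measurable
  from order_tendstoD(2)[OF this, of "e/4"] \<open>e > 0\<close>
  obtain n where n: "nrm2 (\<lambda>x. cutoff a b (\<psi> n) x - k m x) < e / 4"
    by (auto simp: eventually_sequentially)
  have L2\<psi>: "L2 (cutoff a b (\<psi> n))" by (rule L2_cutoff_bounded) (use \<psi>le in auto)
  have "nrm2 (\<lambda>x. cutoff a b (\<psi> n) x - h x) = nrm2 (\<lambda>x. (cutoff a b (\<psi> n) x - k m x) + (k m x - h x))"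
    by simp
  also have "\<dots> \<le> 2 * nrm2 (\<lambda>x. cutoff a b (\<psi> n) x - k m x) + 2 * nrm2 (\<lambda>x. k m x - h x)"
    by (intro nrm2_add_le L2_diff L2\<psi> L2k h)
  also have "\<dots> < e" using m n by simp
  finally show ?thesis using that[OF cont[of n] \<psi>le] by blast
qed

text \<open>Continuity of translation passes to \<open>h\<close> from the dense class. For a
  continuous function cut off to an interval, the translates converge pointwise except at the two
  end points, so dominated convergence applies.\<close>

lemma L2_translation_continuous:
  assumes h: "L2 h" and supp: "\<And>x. x \<notin> {a..b} \<Longrightarrow> h x = 0" and "e > 0"
  obtains d where "d > 0" "\<And>y. \<bar>y\<bar> < d \<Longrightarrow> nrm2 (\<lambda>x. h (x + y) - h x) < e"
proof -
  \<comment> \<open>The final estimate with squared norms costs 4 + 4 + 2 times this quantity, which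
    stays below \<open>e\<close>.\<close>
  have "e / 16 > 0" using \<open>e > 0\<close> by simp
  from L2_approx_continuous[OF h supp this]
  obtain \<psi> m where \<psi>: "continuous_on UNIV \<psi>" "\<And>x. cmod (\<psi> x) \<le> m"
    and app: "nrm2 (\<lambda>x. cutoff a b \<psi> x - h x) < e / 16" by metis
  define \<phi> where "\<phi> = cutoff a b \<psi>"
  have [measurable]: "\<psi> \<in> borel_measurable borel" using \<psi>(1) by (rule borel_measurable_continuous_onI)
  have \<phi>m [measurable]: "\<phi> \<in> borel_measurable borel" unfolding \<phi>_def by measurable
  have L\<phi>: "L2 \<phi>" unfolding \<phi>_def by (rule L2_cutoff_bounded) (use \<psi> in auto)
  have m0: "0 \<le> m" using \<psi>(2)[of 0] norm_ge_zero order_trans by blast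
  have \<phi>le: "cmod (\<phi> x) \<le> m" for x using \<psi>(2)[of x] m0 by (simp add: \<phi>_def cutoff_def)
  have seq: "(\<lambda>n. nrm2 (\<lambda>x. \<phi> (x + y n) - \<phi> x)) \<longlonglongrightarrow> 0" if y: "y \<longlonglongrightarrow> 0" "\<And>n. \<bar>y n\<bar> < 1" for y
  proof (rule nrm2_dominated_convergence)
    show "integrable lborel (\<lambda>x. (2 * m)\<^sup>2 * indicat_real {a - 1..b + 1} x)"
      by (intro integrable_mult_right integrable_real_indicator) (auto simp: emeasure_lborel_Icc_eq)
    show "(cmod (\<phi> (x + y n) - \<phi> x))\<^sup>2 \<le> (2 * m)\<^sup>2 * indicat_real {a - 1..b + 1} x" for n x
    proof (cases "x \<in> {a - 1..b + 1}")
      case True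
      have "cmod (\<phi> (x + y n) - \<phi> x) \<le> 2 * m"
        using \<phi>le[of "x + y n"] \<phi>le[of x] norm_triangle_ineq4[of "\<phi> (x + y n)" "\<phi> x"] by linarith
      from power_mono[OF this norm_ge_zero, of 2] show ?thesis using True by simp
    next
      case False
      then have "x + y n \<notin> {a..b}" "x \<notin> {a..b}" using y(2)[of n] by auto
      then show ?thesis by (simp add: \<phi>_def cutoff_eq_zero)
    qed
    have "AE x in lborel. x \<noteq> a" "AE x in lborel. x \<noteq> b" by (auto intro: AE_lborel_singleton)
    then show "AE x in lborel. (\<lambda>n. \<phi> (x + y n)) \<longlonglongrightarrow> \<phi> x"
    proof eventually_elim
      case (elim x)
      have l: "(\<lambda>n. x + y n) \<longlonglongrightarrow> x" using tendsto_add[OF tendsto_const y(1)] by simp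
      consider "x < a" | "x > b" | "x \<in> {a<..<b}" using elim by fastforce
      then show ?case
      proof cases
        case 1
        have "eventually (\<lambda>n. x + y n < a) sequentially" by (rule order_tendstoD(2)[OF l 1])
        then have "eventually (\<lambda>n. \<phi> (x + y n) = \<phi> x) sequentially"
          by eventually_elim (use 1 in \<open>simp add: \<phi>_def cutoff_def\<close>)
        then show ?thesis by (rule tendsto_eventually)
      next
        case 2
        have "eventually (\<lambda>n. x + y n > b) sequentially" by (rule order_tendstoD(1)[OF l 2])
        then have "eventually (\<lambda>n. \<phi> (x + y n) = \<phi> x) sequentially"
          by eventually_elim (use 2 in \<open>simp add: \<phi>_def cutoff_def\<close>)
        then show ?thesis by (rule tendsto_eventually)
      next
        case 3
        have "isCont \<psi> x" using \<psi>(1) by (simp add: continuous_on_eq_continuous_at)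
        from isCont_tendsto_compose[OF this l] have t: "(\<lambda>n. \<psi> (x + y n)) \<longlonglongrightarrow> \<phi> x"
          using 3 by (simp add: \<phi>_def cutoff_def)
        have "eventually (\<lambda>n. x + y n > a) sequentially" "eventually (\<lambda>n. x + y n < b) sequentially"
          using order_tendstoD[OF l] 3 by auto
        then have "eventually (\<lambda>n. \<psi> (x + y n) = \<phi> (x + y n)) sequentially"
          by eventually_elim (simp add: \<phi>_def cutoff_def)
        from Lim_transform_eventually[OF t this] show ?thesis .
      qed
    qed
  qed measurable
  have "\<exists>d>0. \<forall>y. \<bar>y\<bar> < d \<longrightarrow> nrm2 (\<lambda>x. \<phi> (x + y) - \<phi> x) < e / 16"
  proof (rule ccontr)
    assume c: "\<not> ?thesis"
    have "\<exists>y. \<bar>y\<bar> < inverse (real (Suc n)) \<and> e / 16 \<le> nrm2 (\<lambda>x. \<phi> (x + y) - \<phi> x)" for n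
    proof -
      have "inverse (real (Suc n)) > 0" by simp
      with c show ?thesis by (meson not_le)
    qed
    then obtain y where y: "\<And>n. \<bar>y n\<bar> < inverse (real (Suc n))"
      "\<And>n. e / 16 \<le> nrm2 (\<lambda>x. \<phi> (x + y n) - \<phi> x)" by metis
    have y0: "y \<longlonglongrightarrow> 0"
      by (rule Lim_null_comparison[OF _ LIMSEQ_inverse_real_of_nat])
        (use y(1) in \<open>auto intro!: always_eventually less_imp_le\<close>)
    have "\<bar>y n\<bar> < 1" for n
      using y(1)[of n] le_imp_inverse_le[of 1 "real (Suc n)"] by simp
    from LIMSEQ_le_const[OF seq[OF y0 this]] y(2) \<open>e > 0\<close> show False by fastforce
  qed
  then obtain d where d: "d > 0" "\<And>y. \<bar>y\<bar> < d \<Longrightarrow> nrm2 (\<lambda>x. \<phi> (x + y) - \<phi> x) < e / 16" by blast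
  have "nrm2 (\<lambda>x. h (x + y) - h x) < e" if "\<bar>y\<bar> < d" for y
  proof -
    have L: "L2 (\<lambda>x. \<phi> x - h x)" "L2 (\<lambda>x. \<phi> (x + y) - h (x + y))" "L2 (\<lambda>x. \<phi> (x + y) - \<phi> x)"
      using L\<phi> h by (auto intro!: L2_diff L2_translate)
    have tr: "nrm2 (\<lambda>x. \<phi> (x + y) - h (x + y)) = nrm2 (\<lambda>x. \<phi> x - h x)"
      unfolding nrm2_def by (subst (2) lborel_integral_real_affine[of 1 _ y]) (auto simp: add.commute)
    have "nrm2 (\<lambda>x. h (x + y) - h x)
        = nrm2 (\<lambda>x. ((\<phi> (x + y) - \<phi> x) + (\<phi> x - h x)) - (\<phi> (x + y) - h (x + y)))"
      by simp
    also have "\<dots> \<le> 2 * nrm2 (\<lambda>x. (\<phi> (x + y) - \<phi> x) + (\<phi> x - h x)) + 2 * nrm2 (\<lambda>x. \<phi> x - h x)"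
      using nrm2_diff_le[OF L2_add[OF L(3,1)] L(2)] unfolding tr .
    also have "\<dots> \<le> 2 * (2 * nrm2 (\<lambda>x. \<phi> (x + y) - \<phi> x) + 2 * nrm2 (\<lambda>x. \<phi> x - h x)) + 2 * nrm2 (\<lambda>x. \<phi> x - h x)"
      using nrm2_add_le[OF L(3,1)] by simp
    also have "\<dots> < e" using d(2)[OF that] app \<open>e > 0\<close> by (simp add: \<phi>_def)
    finally show ?thesis .
  qed
  with d(1) that show ?thesis by blast
qed

text \<open>The modulus of continuity of a convolution depends on the second factor only through its
  norm; this provides both continuity and equicontinuity.\<close>

lemma conv_equicontinuous:
  assumes h: "L2 h" and supp: "\<And>x. x \<notin> {a..b} \<Longrightarrow> h x = 0" and "e > 0" "M \<ge> 0"
  obtains d where "d > 0"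
    "\<And>f x y. L2 f \<Longrightarrow> nrm2 f \<le> M \<Longrightarrow> \<bar>x - y\<bar> < d \<Longrightarrow> cmod (conv h f x - conv h f y) < e"
proof -
  \<comment> \<open>\<open>M + 1\<close> keeps the quotient meaningful when \<open>M\<close> is
    zero.\<close>
  have "e\<^sup>2 / (M + 1) > 0" using assms(3,4) by simp
  from L2_translation_continuous[OF h supp this] obtain d where d: "d > 0"
    "\<And>y. \<bar>y\<bar> < d \<Longrightarrow> nrm2 (\<lambda>x. h (x + y) - h x) < e\<^sup>2 / (M + 1)" by metis
  have "cmod (conv h f x - conv h f y) < e" if f: "L2 f" "nrm2 f \<le> M" and xy: "\<bar>x - y\<bar> < d" for f x y
  proof -
    let ?k = "\<lambda>t. h (t + (x - y)) - h t"
    have Lk: "L2 ?k" by (intro L2_diff L2_translate h)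
    have "conv h f x - conv h f y = (LINT t|lborel. (h (x - t) - h (y - t)) * f t)"
      unfolding conv_def left_diff_distrib
      by (rule Bochner_Integration.integral_diff[symmetric]) (intro conv_integrable h f)+
    also have "\<dots> = conv ?k f y" by (simp add: conv_def)
    finally have "(cmod (conv h f x - conv h f y))\<^sup>2 \<le> nrm2 ?k * nrm2 f"
      using conv_bound[OF Lk f(1), of y] by simp
    also have "\<dots> \<le> nrm2 ?k * (M + 1)"
      by (rule mult_left_mono) (use f(2) in auto)
    also have "\<dots> < e\<^sup>2" using d(2)[OF xy] assms(4) by (simp add: pos_less_divide_eq)
    finally show ?thesis using assms(3) by (simp add: power2_less_imp_less)
  qed
  with d(1) that show ?thesis by blast
qed

lemma continuous_on_conv:
  assumes h: "L2 h" and supp: "\<And>x. x \<notin> {a..b} \<Longrightarrow> h x = 0" and f: "L2 f"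
  shows "continuous_on UNIV (conv h f)"
  unfolding continuous_on_iff
proof (intro ballI allI impI)
  fix x e :: real assume "e > 0"
  from conv_equicontinuous[OF h supp this nrm2_nonneg[of f]] obtain d where "d > 0"
    "\<And>g x y. L2 g \<Longrightarrow> nrm2 g \<le> nrm2 f \<Longrightarrow> \<bar>x - y\<bar> < d \<Longrightarrow> cmod (conv h g x - conv h g y) < e" by metis
  then show "\<exists>d>0. \<forall>x'\<in>UNIV. dist x' x < d \<longrightarrow> dist (conv h f x') (conv h f x) < e"
    using f by (auto simp: dist_norm)
qed

lemma conv_measurable [measurable (raw)]:
  assumes "h \<in> borel_measurable borel" "f \<in> borel_measurable borel"
  shows "conv h f \<in> borel_measurable borel"
  unfolding conv_def[abs_def] using assms by measurable

section \<open>Invertibility of the identity plus a convolution\<close>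

lemma nrm2_cutoff_le:
  assumes "u \<in> borel_measurable borel" "\<And>x. x \<in> {a..b} \<Longrightarrow> cmod (u x) \<le> B" "a \<le> b"
  shows "nrm2 (cutoff a b u) \<le> B\<^sup>2 * (b - a)"
proof -
  have "nrm2 (cutoff a b u) \<le> (LINT x|lborel. B\<^sup>2 * indicat_real {a..b} x)"
    unfolding nrm2_def
  proof (rule integral_mono)
    show "integrable lborel (\<lambda>x. (cmod (cutoff a b u x))\<^sup>2)"
      using L2_integrable[OF L2_cutoff_bounded[OF assms(1,2)]] .
    show "integrable lborel (\<lambda>x. B\<^sup>2 * indicat_real {a..b} x)"
      by (intro integrable_mult_right integrable_real_indicator) (auto simp: emeasure_lborel_Icc_eq)
    show "(cmod (cutoff a b u x))\<^sup>2 \<le> B\<^sup>2 * indicat_real {a..b} x" for x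
      using assms(2)[of x] by (auto simp: cutoff_def intro: power_mono)
  qed
  also have "\<dots> = B\<^sup>2 * (b - a)" using assms(3) by simp
  finally show ?thesis .
qed

lemma conv_cmult: "conv h (\<lambda>t. c * f t) x = c * conv h f x"
  by (simp add: conv_def mult.left_commute)

text \<open>Convolution is a compact operator: for a normalized sequence of almost solutions of
  \<open>f + conv h f = 0\<close>, Arzela-Ascoli yields a limit, which would be a nonzero solution.\<close>

lemma conv_injective_imp_bounded_below:
  assumes h: "L2 h" and supp: "\<And>x. x \<notin> {a..b} \<Longrightarrow> h x = 0" and R: "0 \<le> R"
    and inj: "\<And>f. L2 f \<Longrightarrow> (\<And>x. x \<notin> {0..R} \<Longrightarrow> f x = 0) \<Longrightarrow>
      (\<And>x. x \<in> {0..R} \<Longrightarrow> f x + conv h f x = 0) \<Longrightarrow> AE x in lborel. f x = 0"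
  obtains C where "C > 0" "\<And>f. L2 f \<Longrightarrow> (\<And>x. x \<notin> {0..R} \<Longrightarrow> f x = 0) \<Longrightarrow>
      nrm2 f \<le> C * nrm2 (cutoff 0 R (\<lambda>x. f x + conv h f x))"
proof -
  define T where "T f = cutoff 0 R (\<lambda>x. f x + conv h f x)" for f
  have hm [measurable]: "h \<in> borel_measurable borel" using h by (rule L2_measurable)
  have "\<exists>C>0. \<forall>f. L2 f \<longrightarrow> (\<forall>x. x \<notin> {0..R} \<longrightarrow> f x = 0) \<longrightarrow> nrm2 f \<le> C * nrm2 (T f)"
  proof (rule ccontr)
    assume c: "\<not> ?thesis"
    have "\<exists>f. L2 f \<and> (\<forall>x. x \<notin> {0..R} \<longrightarrow> f x = 0) \<and> nrm2 f = 1 \<and> nrm2 (T f) \<le> inverse (real (Suc n))" for n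
    proof -
      have "real (Suc n) > 0" by simp
      with c obtain f where f: "L2 f" "\<forall>x. x \<notin> {0..R} \<longrightarrow> f x = 0" "real (Suc n) * nrm2 (T f) < nrm2 f"
        by (meson not_le)
      have p: "nrm2 f > 0" using f(3) mult_nonneg_nonneg[of "real (Suc n)" "nrm2 (T f)"] nrm2_nonneg[of "T f"] of_nat_0_le_iff[of "Suc n"] by linarith
      define s where "s = complex_of_real (1 / sqrt (nrm2 f))"
      have s: "(cmod s)\<^sup>2 = 1 / nrm2 f" using p by (simp add: s_def norm_divide power_divide)
      have Ts: "T (\<lambda>x. s * f x) = (\<lambda>x. s * T f x)"
        by (auto simp: T_def cutoff_def conv_cmult algebra_simps)
      have "nrm2 (T f) * real (Suc n) \<le> nrm2 f" using f(3) by (simp add: mult.commute)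
      then have "nrm2 (T f) / nrm2 f \<le> inverse (real (Suc n))"
        using p by (simp add: field_simps)
      then have "nrm2 (T (\<lambda>x. s * f x)) \<le> inverse (real (Suc n))"
        unfolding Ts nrm2_cmult s by simp
      moreover have "nrm2 (\<lambda>x. s * f x) = 1" unfolding nrm2_cmult s using p by simp
      ultimately show ?thesis using f L2_cmult[OF f(1), of s] by (intro exI[of _ "\<lambda>x. s * f x"]) auto
    qed
    then obtain F where F: "\<And>n. L2 (F n)" "\<And>n x. x \<notin> {0..R} \<Longrightarrow> F n x = 0" "\<And>n. nrm2 (F n) = 1"
      "\<And>n. nrm2 (T (F n)) \<le> inverse (real (Suc n))" by metis
    have Fm [measurable]: "F n \<in> borel_measurable borel" for n using F(1) by (rule L2_measurable)
    \<comment> \<open>All convolutions share the kernel \<open>h\<close> and have second factors of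
      norm 1, so \<open>conv_equicontinuous\<close> gives one modulus of continuity for the whole
      sequence.\<close>
    have "\<exists>g k. continuous_on {0..R} g \<and> strict_mono (k :: nat \<Rightarrow> nat) \<and>
      (\<forall>e>0. \<exists>N. \<forall>n x. n \<ge> N \<and> x \<in> {0..R} \<longrightarrow> norm (conv h (F (k n)) x - g x) < e)"
    proof (rule Arzela_Ascoli[of "{0..R}" "\<lambda>n. conv h (F n)" "nrm2 h + 1"])
      fix g :: "real \<Rightarrow> complex" and k :: "nat \<Rightarrow> nat"
      assume *: "continuous_on {0..R} g" "strict_mono k"
        "\<And>e. 0 < e \<Longrightarrow> \<exists>N. \<forall>n x. N \<le> n \<and> x \<in> {0..R} \<longrightarrow> norm (conv h (F (k n)) x - g x) < e"
      from * show ?thesis by blast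
    next
      show "norm (conv h (F n) x) \<le> nrm2 h + 1" for n x
      proof -
        have "(cmod (conv h (F n) x))\<^sup>2 \<le> nrm2 h" using conv_bound[OF h F(1), of n x] F(3) by simp
        also have "\<dots> \<le> (nrm2 h + 1)\<^sup>2" by (simp add: power2_eq_square algebra_simps)
        finally show ?thesis by (rule power2_le_imp_le) simp
      qed
      show "\<exists>d. 0 < d \<and> (\<forall>n y. y \<in> {0..R} \<and> norm (x - y) < d \<longrightarrow> norm (conv h (F n) x - conv h (F n) y) < e)"
        if "0 < e" for x e
      proof -
        from conv_equicontinuous[OF h supp that zero_le_one] obtain d where "d > 0"
          "\<And>f x y. L2 f \<Longrightarrow> nrm2 f \<le> 1 \<Longrightarrow> \<bar>x - y\<bar> < d \<Longrightarrow> cmod (conv h f x - conv h f y) < e"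
          by blast
        then show ?thesis using F(1,3) by (intro exI[of _ d]) auto
      qed
      show "compact {0..R}" by simp
    qed
    then obtain g k where g: "continuous_on {0..R} g" and k: "strict_mono (k :: nat \<Rightarrow> nat)"
      and unif: "\<And>e. 0 < e \<Longrightarrow> \<exists>N. \<forall>n x. n \<ge> N \<and> x \<in> {0..R} \<longrightarrow> norm (conv h (F (k n)) x - g x) < e"
      by blast
    define G where "G = cutoff 0 R g"
    have Gm [measurable]: "G \<in> borel_measurable borel"
    proof -
      have "(\<lambda>x. indicator {0..R} x *\<^sub>R g x) \<in> borel_measurable borel"
        using g by (intro borel_measurable_continuous_on_indicator) auto
      moreover have "(\<lambda>x. indicator {0..R} x *\<^sub>R g x) = G" by (auto simp: G_def cutoff_def)
      ultimately show ?thesis by simp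
    qed
    have "compact (g ` {0..R})" using g by (rule compact_continuous_image) simp
    then obtain B where B: "\<And>x. x \<in> {0..R} \<Longrightarrow> cmod (g x) \<le> B"
      by (metis bounded_iff compact_imp_bounded imageI)
    have GG: "cutoff 0 R G = G" by (auto simp: G_def cutoff_def)
    have LG: "L2 G"
      using L2_cutoff_bounded[OF Gm, of 0 R B] B unfolding GG by (simp add: G_def cutoff_def)
    have kn: "n \<le> k n" for n using k by (rule strict_mono_imp_increasing)
    \<comment> \<open>On \<open>{0..R}\<close> the sum \<open>F (k n) + G\<close> is
      \<open>T (F (k n))\<close> minus the deviation of the convolution from its uniform limit. Both
      tend to zero, so \<open>F (k n)\<close> tends to \<open>-G\<close> in norm.\<close>
    have small: "\<exists>N. \<forall>n\<ge>N. nrm2 (\<lambda>x. F (k n) x + G x) < e" if "e > 0" for e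
    proof -
      define q where "q = sqrt (e / (4 * (R + 1)))"
      have q: "q > 0" "q\<^sup>2 = e / (4 * (R + 1))" using that R by (auto simp: q_def)
      have qq: "q\<^sup>2 * R \<le> e / 4"
        unfolding q(2) using that R by (simp add: field_simps)
      obtain N1 where N1: "\<And>n x. n \<ge> N1 \<Longrightarrow> x \<in> {0..R} \<Longrightarrow> cmod (conv h (F (k n)) x - g x) < q"
        using unif[OF q(1)] by blast
      obtain N2 where N2: "inverse (real (Suc N2)) < e / 4"
        using reals_Archimedean[OF divide_pos_pos[OF \<open>e > 0\<close> zero_less_numeral]] by blast
      have "nrm2 (\<lambda>x. F (k n) x + G x) < e" if n: "n \<ge> max N1 N2" for n
      proof -
        let ?D = "cutoff 0 R (\<lambda>x. conv h (F (k n)) x - G x)"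
        have Dle: "cmod (conv h (F (k n)) x - G x) \<le> q" if "x \<in> {0..R}" for x
          using N1[of n x] n that by (simp add: G_def cutoff_def)
        have m: "(\<lambda>x. conv h (F (k n)) x - G x) \<in> borel_measurable borel" by measurable
        have D: "nrm2 ?D \<le> q\<^sup>2 * (R - 0)"
          by (rule nrm2_cutoff_le[OF m _ R]) (rule Dle)
        have D2: "L2 ?D" by (rule L2_cutoff_bounded[OF m]) (rule Dle)
        have TL: "L2 (T (F (k n)))"
        proof -
          have "cutoff 0 R (conv h (F (k n))) = (\<lambda>x. ?D x + G x)"
            by (auto simp: G_def cutoff_def)
          then have "L2 (cutoff 0 R (conv h (F (k n))))" using L2_add[OF D2 LG] by simp
          then have "L2 (\<lambda>x. F (k n) x + cutoff 0 R (conv h (F (k n))) x)" by (intro L2_add F)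
          moreover have "(\<lambda>x. F (k n) x + cutoff 0 R (conv h (F (k n))) x) = T (F (k n))"
            using F(2) by (force simp: T_def cutoff_def)
          ultimately show ?thesis by simp
        qed
        have "F (k n) x + G x = T (F (k n)) x - ?D x" for x
          using F(2)[of x "k n"] by (auto simp: T_def cutoff_def G_def)
        then have "nrm2 (\<lambda>x. F (k n) x + G x) \<le> 2 * nrm2 (T (F (k n))) + 2 * nrm2 ?D"
          using nrm2_diff_le[OF TL D2] by simp
        moreover have "nrm2 (T (F (k n))) < e / 4"
        proof -
          have "nrm2 (T (F (k n))) \<le> inverse (real (Suc (k n)))" by (rule F(4))
          also have "\<dots> \<le> inverse (real (Suc N2))"
            using n kn[of n] by (intro le_imp_inverse_le) auto
          also have "\<dots> < e / 4" by (rule N2)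
          finally show ?thesis .
        qed
        moreover have "nrm2 ?D \<le> e / 4" using D qq by simp
        ultimately show ?thesis by linarith
      qed
      then show ?thesis by blast
    qed
    have L: "L2 (\<lambda>x. F (k n) x + G x)" for n by (intro L2_add F LG)
    \<comment> \<open>Norm convergence to \<open>-G\<close> forces the convolutions to converge
      pointwise to \<open>conv h (-G)\<close>; on \<open>{0..R}\<close> they also converge to
      \<open>g\<close>. Equality of the limits is the homogeneous equation for
      \<open>-G\<close>.\<close>
    have "- G x + conv h (\<lambda>t. - G t) x = 0" if x: "x \<in> {0..R}" for x
    proof (rule ccontr)
      assume ne: "- G x + conv h (\<lambda>t. - G t) x \<noteq> 0"
      define e where "e = cmod (- G x + conv h (\<lambda>t. - G t) x) / 2"
      have e: "e > 0" using ne by (simp add: e_def)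
      obtain N1 where N1: "\<And>n. n \<ge> N1 \<Longrightarrow> cmod (conv h (F (k n)) x - g x) < e"
        using unif[OF e] x by blast
      have "e\<^sup>2 / (nrm2 h + 1) > 0" using e by (simp add: add_nonneg_pos)
      from small[OF this] obtain N2 where
        N2: "\<And>n. n \<ge> N2 \<Longrightarrow> nrm2 (\<lambda>x. F (k n) x + G x) < e\<^sup>2 / (nrm2 h + 1)" by blast
      define n where "n = max N1 N2"
      have "conv h (F (k n)) x - conv h (\<lambda>t. - G t) x = conv h (\<lambda>t. F (k n) t + G t) x"
        using conv_diff_right[OF h F(1) L2_minus[OF LG], of "k n" x] by simp
      then have "(cmod (conv h (F (k n)) x - conv h (\<lambda>t. - G t) x))\<^sup>2
          \<le> nrm2 h * nrm2 (\<lambda>x. F (k n) x + G x)"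
        using conv_bound[OF h L[of n], of x] by simp
      also have "\<dots> \<le> (nrm2 h + 1) * nrm2 (\<lambda>x. F (k n) x + G x)"
        by (simp add: distrib_right)
      also have "\<dots> < e\<^sup>2"
        using N2[of n] nrm2_nonneg[of h] by (simp add: n_def pos_less_divide_eq mult.commute)
      finally have 1: "cmod (conv h (F (k n)) x - conv h (\<lambda>t. - G t) x) < e"
        using e by (simp add: power2_less_imp_less)
      have 2: "cmod (conv h (F (k n)) x - g x) < e" using N1[of n] by (simp add: n_def)
      have "- G x + conv h (\<lambda>t. - G t) x
        = (conv h (F (k n)) x - g x) - (conv h (F (k n)) x - conv h (\<lambda>t. - G t) x)"
        using x by (simp add: G_def cutoff_def)
      then have "2 * e \<le> cmod (conv h (F (k n)) x - g x) + cmod (conv h (F (k n)) x - conv h (\<lambda>t. - G t) x)"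
        unfolding e_def by (metis (no_types) norm_triangle_ineq4 field_sum_of_halves mult_2)
      with 1 2 show False by linarith
    qed
    then have "AE x in lborel. - G x = 0"
      by (intro inj L2_minus LG) (auto simp: G_def cutoff_eq_zero)
    then have G0: "nrm2 G = 0" using nrm2_zero_AE[OF _ LG] by simp
    \<comment> \<open>As \<open>G\<close> is negligible, the factor 2 of the squared-norm inequality
      turns 1/2 into a bound strictly below the normalization 1.\<close>
    obtain n where n: "nrm2 (\<lambda>x. F (k n) x + G x) < 1 / 2" using small[of "1/2"] by auto
    have "nrm2 (\<lambda>x. (F (k n) x + G x) - G x) \<le> 2 * nrm2 (\<lambda>x. F (k n) x + G x) + 2 * nrm2 G"
      by (rule nrm2_diff_le[OF L LG])
    then show False using n F(3)[of "k n"] G0 by simp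
  qed
  then show ?thesis using that unfolding T_def by blast
qed

section \<open>The inner product and the quadratic form of the convolution operator\<close>

definition ip :: "(real \<Rightarrow> complex) \<Rightarrow> (real \<Rightarrow> complex) \<Rightarrow> complex" where
  "ip f g = (LINT x|lborel. f x * cnj (g x))"

lemma ip_integrable: "L2 f \<Longrightarrow> L2 g \<Longrightarrow> integrable lborel (\<lambda>x. f x * cnj (g x))"
  by (intro L2_mult_integrable L2_cnj)

lemma ip_add_left: "L2 f \<Longrightarrow> L2 f' \<Longrightarrow> L2 g \<Longrightarrow> ip (\<lambda>x. f x + f' x) g = ip f g + ip f' g"
  by (simp add: ip_def distrib_right ip_integrable)

lemma ip_add_right: "L2 f \<Longrightarrow> L2 g' \<Longrightarrow> L2 g \<Longrightarrow> ip f (\<lambda>x. g x + g' x) = ip f g + ip f g'"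
  by (simp add: ip_def distrib_left ip_integrable)

lemma ip_cmult_left: "ip (\<lambda>x. c * f x) g = c * ip f g"
  by (simp add: ip_def mult.assoc)

lemma ip_cmult_right: "ip f (\<lambda>x. c * g x) = cnj c * ip f g"
  by (simp add: ip_def mult.left_commute)

lemma ip_cnj: "cnj (ip f g) = ip g f"
  unfolding ip_def Bochner_Integration.integral_cnj[symmetric] by (simp add: mult.commute)

lemma ip_self: "ip f f = of_real (nrm2 f)"
  by (simp add: ip_def nrm2_def complex_norm_square[symmetric] flip: of_real_power)

lemma nrm2_cnj: "nrm2 (\<lambda>x. cnj (f x)) = nrm2 f"
  by (simp add: nrm2_def)

lemma ip_bound: "L2 f \<Longrightarrow> L2 g \<Longrightarrow> (cmod (ip f g))\<^sup>2 \<le> nrm2 f * nrm2 g"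
  using Cauchy_Schwarz_L2[of f "\<lambda>x. cnj (g x)"] by (simp add: ip_def L2_cnj nrm2_cnj)

lemma L2_supp_integrable:
  assumes "L2 f" "\<And>x. x \<notin> {a..b} \<Longrightarrow> f x = 0"
  shows "integrable lborel f"
proof -
  have "L2 (cutoff a b (\<lambda>x. 1))" by (rule L2_cutoff_bounded[of _ _ _ 1]) auto
  from L2_mult_integrable[OF assms(1) this] show ?thesis
    by (rule Bochner_Integration.integrable_cong[OF refl, THEN iffD1, rotated])
      (use assms(2) in \<open>force simp: cutoff_def\<close>)
qed

lemma conv_L2_cutoff:
  assumes "L2 h" "L2 f" "a \<le> b"
  shows "L2 (cutoff a b (conv h f))" "nrm2 (cutoff a b (conv h f)) \<le> nrm2 h * nrm2 f * (b - a)"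
proof -
  note [measurable] = assms(1,2)[THEN L2_measurable]
  have m: "conv h f \<in> borel_measurable borel" by measurable
  have le: "cmod (conv h f x) \<le> sqrt (nrm2 h * nrm2 f)" for x
    by (rule real_le_rsqrt) (rule conv_bound[OF assms(1,2)])
  show "L2 (cutoff a b (conv h f))" by (rule L2_cutoff_bounded[OF m le])
  show "nrm2 (cutoff a b (conv h f)) \<le> nrm2 h * nrm2 f * (b - a)"
    using nrm2_cutoff_le[OF m le assms(3)] by simp
qed

text \<open>Cauchy-Schwarz bounds the integral of \<open>|h (x - t) * u t|\<close> over
  \<open>t\<close> uniformly in \<open>x\<close>, so integrability of \<open>v\<close> suffices for
  Fubini's theorem. This exchange underlies the symmetry of the form, the spectral pairing and the
  correlation formulas.\<close>

lemma conv_swap: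
  assumes h: "L2 h" and u: "L2 u" and v: "integrable lborel v"
  shows "(LINT x|lborel. conv h u x * v x) = (LINT t|lborel. (LINT x|lborel. h (x - t) * v x) * u t)"
proof -
  note [measurable] = h[THEN L2_measurable] u[THEN L2_measurable] borel_measurable_integrable[OF v]
  let ?K = "\<lambda>(x, t). h (x - t) * u t * v x"
  have "integrable (lborel \<Otimes>\<^sub>M lborel) ?K"
  proof (rule lborel_pair.Fubini_integrable)
    show "?K \<in> borel_measurable (lborel \<Otimes>\<^sub>M lborel)" by measurable
    show "AE x in lborel. integrable lborel (\<lambda>t. ?K (x, t))"
      using conv_integrable[OF h u] by simp
    show "integrable lborel (\<lambda>x. LINT t|lborel. norm (?K (x, t)))"
    proof (rule Bochner_Integration.integrable_bound)
      show "integrable lborel (\<lambda>x. sqrt (nrm2 h * nrm2 u) * norm (v x))"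
        using v by simp
      show "AE x in lborel. norm (LINT t|lborel. norm (?K (x, t))) \<le> norm (sqrt (nrm2 h * nrm2 u) * norm (v x))"
      proof (rule AE_I2)
        fix x
        have "(LINT t|lborel. cmod (h (x - t)) * cmod (u t)) \<le> sqrt (nrm2 h * nrm2 u)"
          using Cauchy_Schwarz_abs[OF L2_reflect[OF h, of x] u] by (intro real_le_rsqrt) (simp add: nrm2_reflect)
        then show "norm (LINT t|lborel. norm (?K (x, t))) \<le> norm (sqrt (nrm2 h * nrm2 u) * norm (v x))"
          by (simp add: norm_mult mult_right_mono)
      qed
    qed measurable
  qed
  from lborel_pair.Fubini_integral[OF this]
  have "(LINT t|lborel. LINT x|lborel. h (x - t) * u t * v x) = (LINT x|lborel. LINT t|lborel. h (x - t) * u t * v x)"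
    by simp
  moreover have "(LINT x|lborel. h (x - t) * u t * v x) = (LINT x|lborel. h (x - t) * v x) * u t" for t
    by (subst integral_mult_left_zero[symmetric]) (simp add: mult_ac)
  ultimately show ?thesis by (simp add: conv_def)
qed

text \<open>Moving the convolution to the other factor reverses the kernel, and for a hermitian
  kernel reversal is conjugation. Bounded support makes the square integrable \<open>v\<close>
  integrable, as the exchange requires.\<close>

lemma conv_form_hermitian:
  assumes h: "L2 h" and herm: "\<And>x. h (- x) = cnj (h x)" and u: "L2 u" and v: "L2 v"
    and supp: "\<And>x. x \<notin> {a..b} \<Longrightarrow> v x = 0"
  shows "ip (conv h u) v = cnj (ip (conv h v) u)"
proof -
  have "integrable lborel (\<lambda>x. cnj (v x))"
    by (rule L2_supp_integrable[OF L2_cnj[OF v], of a b]) (use supp in auto)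
  from conv_swap[OF h u this]
  have "ip (conv h u) v = (LINT t|lborel. (LINT x|lborel. h (x - t) * cnj (v x)) * u t)"
    by (simp add: ip_def)
  moreover have "(LINT x|lborel. h (x - t) * cnj (v x)) = cnj (conv h v t)" for t
    unfolding conv_def Bochner_Integration.integral_cnj[symmetric] complex_cnj_mult herm[symmetric]
    by simp
  ultimately show ?thesis unfolding ip_def Bochner_Integration.integral_cnj[symmetric] by (simp add: mult.commute)
qed

definition qform :: "(real \<Rightarrow> complex) \<Rightarrow> (real \<Rightarrow> complex) \<Rightarrow> real" where
  "qform h f = nrm2 f + Re (ip (conv h f) f)"

text \<open>With \<open>v = cutoff 0 R (u + conv h u)\<close>, nonnegativity of the form at \<open>u - v / M\<close>, where \<open>M\<close>
  bounds the form, gives \<open>nrm2 v \<le> M * qform h u\<close>; and \<open>nrm2 v\<close> dominates \<open>nrm2 u\<close>.\<close>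

lemma conv_positive_imp_coercive:
  assumes h: "L2 h" and supp: "\<And>x. x \<notin> {a..b} \<Longrightarrow> h x = 0" and R: "0 \<le> R"
    and herm: "\<And>x. h (- x) = cnj (h x)"
    and pos: "\<And>f. L2 f \<Longrightarrow> (\<And>x. x \<notin> {0..R} \<Longrightarrow> f x = 0) \<Longrightarrow> \<not> (AE x in lborel. f x = 0) \<Longrightarrow> 0 < qform h f"
  obtains c where "c > 0" "\<And>f. L2 f \<Longrightarrow> (\<And>x. x \<notin> {0..R} \<Longrightarrow> f x = 0) \<Longrightarrow> c * nrm2 f \<le> qform h f"
proof -
  have ipcut: "ip (conv h f) g = ip (cutoff 0 R (conv h f)) g" if "\<forall>x. x \<notin> {0..R} \<longrightarrow> g x = 0" for f g
    unfolding ip_def by (rule Bochner_Integration.integral_cong) (use that in \<open>auto simp: cutoff_def\<close>)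
  have Tsum: "cutoff 0 R (\<lambda>x. f x + conv h f x) = (\<lambda>x. f x + cutoff 0 R (conv h f) x)"
    if "\<forall>x. x \<notin> {0..R} \<longrightarrow> f x = 0" for f
    using that by (auto simp: cutoff_def)
  have inj: "AE x in lborel. f x = 0" if f: "L2 f" "\<And>x. x \<notin> {0..R} \<Longrightarrow> f x = 0"
    "\<And>x. x \<in> {0..R} \<Longrightarrow> f x + conv h f x = 0" for f
  proof (rule ccontr)
    assume "\<not> (AE x in lborel. f x = 0)"
    then have "0 < qform h f" using f by (intro pos)
    moreover have "(\<lambda>x. conv h f x * cnj (f x)) = (\<lambda>x. (- f x) * cnj (f x))"
    proof
      fix x show "conv h f x * cnj (f x) = (- f x) * cnj (f x)"
        using f(2)[of x] f(3)[of x] by (cases "x \<in> {0..R}")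
          (auto simp: eq_neg_iff_add_eq_0 add.commute simp flip: distrib_right)
    qed
    then have "ip (conv h f) f = - ip f f" by (simp add: ip_def)
    then have "qform h f = 0" by (simp add: qform_def ip_self)
    ultimately show False by simp
  qed
  obtain C where C: "C > 0" "\<And>f. L2 f \<Longrightarrow> (\<And>x. x \<notin> {0..R} \<Longrightarrow> f x = 0) \<Longrightarrow>
      nrm2 f \<le> C * nrm2 (cutoff 0 R (\<lambda>x. f x + conv h f x))"
    using conv_injective_imp_bounded_below[OF h supp R inj] by blast
  \<comment> \<open>One \<open>nrm2 v\<close> comes from the identity and one from
    \<open>|ip w v| <= nrm2 w + nrm2 v\<close>, where \<open>w\<close> is the convolution cut off to
    \<open>{0..R}\<close>; the remaining term bounds \<open>nrm2 w\<close>.\<close>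
  define M where "M = 2 + nrm2 h * R"
  have M: "M > 0" using R by (simp add: M_def add_pos_nonneg)
  have qM: "qform h v \<le> M * nrm2 v" if v: "L2 v" "\<And>x. x \<notin> {0..R} \<Longrightarrow> v x = 0" for v
  proof -
    have sup_v: "\<forall>x. x \<notin> {0..R} \<longrightarrow> v x = 0" using v(2) by blast
    let ?w = "cutoff 0 R (conv h v)"
    have w: "L2 ?w" "nrm2 ?w \<le> nrm2 h * nrm2 v * (R - 0)" using conv_L2_cutoff[OF h v(1) R] by auto
    have "Re (ip ?w v) \<le> cmod (ip ?w v)" by (rule complex_Re_le_cmod)
    also have "\<dots> \<le> nrm2 ?w + nrm2 v"
    proof (rule power2_le_imp_le)
      have "(cmod (ip ?w v))\<^sup>2 \<le> nrm2 ?w * nrm2 v" by (rule ip_bound[OF w(1) v(1)])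
      also have "\<dots> \<le> (nrm2 ?w + nrm2 v)\<^sup>2" by (simp add: power2_sum)
      finally show "(cmod (ip ?w v))\<^sup>2 \<le> (nrm2 ?w + nrm2 v)\<^sup>2" .
    qed simp
    finally have "qform h v \<le> 2 * nrm2 v + nrm2 ?w" unfolding qform_def ipcut[OF sup_v] by simp
    also have "\<dots> \<le> M * nrm2 v" using w(2) by (simp add: M_def algebra_simps)
    finally show ?thesis .
  qed
  have nonneg: "0 \<le> qform h v" if v: "L2 v" "\<And>x. x \<notin> {0..R} \<Longrightarrow> v x = 0" for v
  proof (cases "AE x in lborel. v x = 0")
    case True
    have sup_v: "\<forall>x. x \<notin> {0..R} \<longrightarrow> v x = 0" using v(2) by blast
    have "(cmod (ip (conv h v) v))\<^sup>2 \<le> 0"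
      using ip_bound[OF conv_L2_cutoff(1)[OF h v(1) R] v(1)] nrm2_zero_AE[OF True v(1)]
      unfolding ipcut[OF sup_v] by simp
    then have "ip (conv h v) v = 0" by simp
    then show ?thesis by (simp add: qform_def)
  next
    case False
    from pos[OF v this] show ?thesis by simp
  qed
  have "nrm2 u \<le> C * M * qform h u" if u: "L2 u" "\<And>x. x \<notin> {0..R} \<Longrightarrow> u x = 0" for u
  proof -
    define v where "v = cutoff 0 R (\<lambda>x. u x + conv h u x)"
    have vs: "v x = 0" if "x \<notin> {0..R}" for x using that unfolding v_def by (rule cutoff_eq_zero)
    have sup_u: "\<forall>x. x \<notin> {0..R} \<longrightarrow> u x = 0" using u(2) by blast
    have sup_vs: "\<forall>x. x \<notin> {0..R} \<longrightarrow> v x = 0" using vs by blast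
    have Lu: "L2 (cutoff 0 R (conv h u))" by (rule conv_L2_cutoff[OF h u(1) R])
    have v: "L2 v" unfolding v_def Tsum[OF sup_u] by (intro L2_add u Lu)
    have Lv: "L2 (cutoff 0 R (conv h v))" by (rule conv_L2_cutoff[OF h v R])
    define s where "s = complex_of_real (- 1 / M)"
    let ?w = "\<lambda>x. u x + s * v x"
    have w: "L2 ?w" by (intro L2_add L2_cmult u v)
    have ws: "?w x = 0" if "x \<notin> {0..R}" for x using u(2)[OF that] vs[OF that] by simp
    then have sup_ws: "\<forall>x. x \<notin> {0..R} \<longrightarrow> ?w x = 0" by blast
    have cw: "conv h ?w x = conv h u x + s * conv h v x" for x
      using u v by (simp add: conv_def distrib_left conv_integrable h mult.left_commute)
    have cw': "cutoff 0 R (conv h ?w) = (\<lambda>x. cutoff 0 R (conv h u) x + s * cutoff 0 R (conv h v) x)"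
      by (auto simp: cutoff_def cw)
    have sv: "L2 (\<lambda>x. s * v x)" "L2 (\<lambda>x. s * cutoff 0 R (conv h v) x)" by (intro L2_cmult v Lv)+
    \<comment> \<open>\<open>v\<close> is the cut-off image of \<open>u\<close>, so pairing that
      image with \<open>v\<close> gives the squared norm of \<open>v\<close>. By hermitian symmetry
      both cross terms of the expanded form equal this real number.\<close>
    have uv: "ip u v + ip (conv h u) v = of_real (nrm2 v)"
    proof -
      have "ip u v + ip (conv h u) v = ip v v"
        unfolding ipcut[OF sup_vs] using ip_add_left[OF u(1) Lu v] by (simp add: v_def Tsum[OF sup_u])
      then show ?thesis by (simp add: ip_self)
    qed
    have hs: "ip (conv h v) u = cnj (ip (conv h u) v)"
      by (rule conv_form_hermitian[OF h herm v u(1) u(2)])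
    have sr: "cnj s = s" "Re s = - 1 / M" "Im s = 0" by (simp_all add: s_def)
    have "of_real (nrm2 ?w) = ip ?w ?w" by (simp add: ip_self)
    also have "\<dots> = ip u u + s * ip v u + s * (ip u v + s * ip v v)"
      by (simp add: ip_add_left ip_add_right ip_cmult_left ip_cmult_right u v w sv sr distrib_left)
    finally have n: "of_real (nrm2 ?w) = ip u u + s * ip v u + s * (ip u v + s * ip v v)" .
    have "ip (conv h ?w) ?w = ip (conv h u) u + s * ip (conv h v) u + s * (ip (conv h u) v + s * ip (conv h v) v)"
      unfolding ipcut[OF sup_ws] ipcut[OF sup_u] ipcut[OF sup_vs] cw'
      by (simp add: ip_add_left ip_add_right ip_cmult_left ip_cmult_right u v w sv sr Lu Lv L2_add distrib_left)
    then have "of_real (nrm2 ?w) + ip (conv h ?w) ?w = (ip u u + ip (conv h u) u) + s * cnj (ip u v + ip (conv h u) v)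
        + s * ((ip u v + ip (conv h u) v) + s * (ip v v + ip (conv h v) v))"
      unfolding n hs by (simp add: ip_cnj algebra_simps)
    then have "of_real (nrm2 ?w) + ip (conv h ?w) ?w = (of_real (nrm2 u) + ip (conv h u) u)
        + s * (of_real (2 * nrm2 v) + s * (of_real (nrm2 v) + ip (conv h v) v))"
      unfolding uv ip_self by (simp add: algebra_simps)
    from arg_cong[OF this, of Re] have "qform h ?w = qform h u - (2 * nrm2 v - qform h v / M) / M"
      by (simp add: qform_def sr)
    moreover have "0 \<le> qform h ?w" by (rule nonneg[OF w ws])
    ultimately have "(2 * nrm2 v - qform h v / M) / M \<le> qform h u" by simp
    moreover have "qform h v / M \<le> nrm2 v" using qM[OF v vs] M by (simp add: field_simps)
    then have "nrm2 v / M \<le> (2 * nrm2 v - qform h v / M) / M" using M by (intro divide_right_mono) auto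
    ultimately have "nrm2 v / M \<le> qform h u" by linarith
    then have "nrm2 v \<le> M * qform h u" using M by (simp add: field_simps)
    then have "C * nrm2 v \<le> C * (M * qform h u)" using C(1) by simp
    then show ?thesis using C(2)[OF u] unfolding v_def by simp
  qed
  then have "1 / (C * M) * nrm2 f \<le> qform h f" if "L2 f" "\<And>x. x \<notin> {0..R} \<Longrightarrow> f x = 0" for f
    using that C(1) M by (simp add: field_simps)
  moreover have "1 / (C * M) > 0" using C(1) M by simp
  ultimately show ?thesis using that by blast
qed

text \<open>With \<open>g\<close> only integrable, the argument runs on its primitive
  \<open>G\<close>: on an interval of length \<open>1 / (2 * C)\<close> beyond a zero of
  \<open>G\<close>, the hypothesis and monotonicity bound \<open>G\<close> by half of itself.
  Finitely many such steps reach \<open>t\<close>.\<close>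

lemma gronwall_zero:
  fixes g :: "real \<Rightarrow> real"
  assumes int: "integrable lborel g" and nn: "\<And>t. 0 \<le> g t" and "C > 0"
    and le: "\<And>t. t \<in> {0..R} \<Longrightarrow> g t \<le> C * (LINT s|lborel. indicator {0..t} s * g s)"
    and t: "t \<in> {0..R}"
  shows "g t = 0"
proof -
  define G where "G t = (LINT s|lborel. indicator {0..t} s * g s)" for t
  have i: "integrable lborel (\<lambda>s. indicator {0..t} s * g s)" for t
    using integrable_mult_indicator[OF _ int, of "{0..t}"] by simp
  have mono: "G s \<le> G t" if "s \<le> t" for s t
    unfolding G_def
    by (rule integral_mono[OF i i]) (use that nn in \<open>auto simp: indicator_def\<close>)
  have nnG: "0 \<le> G t" for t unfolding G_def by (rule Bochner_Integration.integral_nonneg) (auto simp: nn)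
  define d where "d = 1 / (2 * C)"
  have d: "d > 0" using \<open>C > 0\<close> by (simp add: d_def)
  have step: "G b = 0" if a: "G a = 0" "0 \<le> a" "a \<le> b" "b \<le> a + d" "b \<le> R" for a b
  proof -
    have "G b \<le> (LINT s|lborel. indicator {0..a} s * g s + indicator {a..b} s * (C * G b))"
      unfolding G_def[of b]
    proof (rule integral_mono[OF i])
      show "integrable lborel (\<lambda>s. indicator {0..a} s * g s + indicator {a..b} s * (C * (LINT s|lborel. indicator {0..b} s * g s)))"
        by (intro Bochner_Integration.integrable_add i integrable_mult_left integrable_real_indicator)
          (auto simp: emeasure_lborel_Icc_eq)
      show "indicator {0..b} s * g s
        \<le> indicator {0..a} s * g s + indicator {a..b} s * (C * (LINT s|lborel. indicator {0..b} s * g s))" for s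
      proof -
        have "g s \<le> C * G b" if "s \<in> {a..b}"
        proof -
          have "g s \<le> C * G s" using le[of s] that a by (simp add: G_def)
          also have "\<dots> \<le> C * G b" using mono[of s b] that \<open>C > 0\<close> by simp
          finally show ?thesis .
        qed
        moreover have "0 \<le> C * G b" using nnG \<open>C > 0\<close> by simp
        ultimately show ?thesis using nn[of s] a unfolding G_def[symmetric]
          by (auto simp: indicator_def)
      qed
    qed
    also have "\<dots> = G a + (b - a) * (C * G b)"
      using i a by (subst Bochner_Integration.integral_add)
        (auto simp: G_def[symmetric] emeasure_lborel_Icc_eq)
    also have "\<dots> \<le> d * (C * G b)"
      using a nnG[of b] \<open>C > 0\<close> by (simp add: mult_right_mono)
    also have "\<dots> = G b / 2" using \<open>C > 0\<close> by (simp add: d_def)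
    finally show ?thesis using nnG[of b] by simp
  qed
  have G0: "G 0 = 0"
  proof -
    have "AE s in lborel. s \<noteq> (0::real)" by (rule AE_lborel_singleton)
    then have "AE s in lborel. indicator {0..0} s * g s = 0"
      by eventually_elim (auto simp: indicator_def)
    then show ?thesis unfolding G_def by (rule integral_eq_zero_AE)
  qed
  have "G (min (real n * d) t) = 0" for n
  proof (induction n)
    case 0
    then show ?case using G0 t by (simp add: min_def)
  next
    case (Suc n)
    have "min (real (Suc n) * d) t \<le> min (real n * d) t + d" using d by (auto simp: min_def algebra_simps)
    moreover have "min (real n * d) t \<le> min (real (Suc n) * d) t" using d by (auto simp: min_def algebra_simps)
    moreover have "0 \<le> min (real n * d) t" using d t by auto
    moreover have "min (real (Suc n) * d) t \<le> R" using t by auto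
    ultimately show ?case using step[OF Suc] by blast
  qed
  moreover obtain n where "t / d \<le> real n" using real_arch_simple by blast
  then have "min (real n * d) t = t" using d by (simp add: field_simps min_def)
  ultimately have "G t = 0" by metis
  then show ?thesis using le[OF t] nn[of t] by (simp add: G_def)
qed

section \<open>The Krein-Bellman equation\<close>

text \<open>Pairing the equation with its solution gives \<open>c * nrm2 g <= Re (ip e g)\<close>,
  with \<open>e\<close> cut off to the interval, and Cauchy-Schwarz finishes. Coercivity thus bounds
  the inverse of the identity plus convolution.\<close>

lemma nrm2_cutoff_AE_bound:
  assumes "L2 e" "L2 g" "\<And>x. x \<notin> {0..\<rho>} \<Longrightarrow> g x = 0"
    and "AE t in lborel. t \<in> {0..\<rho>} \<longrightarrow> g t + conv h g t = e t"
    and h: "L2 h" and c: "c > 0" "c * nrm2 g \<le> qform h g"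
  shows "nrm2 g \<le> nrm2 (cutoff 0 \<rho> e) / c\<^sup>2"
proof -
  note [measurable] = h[THEN L2_measurable] assms(1,2)[THEN L2_measurable]
  have eq: "(LINT x|lborel. (g x + cutoff 0 \<rho> (conv h g) x) * cnj (g x)) = ip (cutoff 0 \<rho> e) g"
    unfolding ip_def
  proof (rule integral_cong_AE)
    show "AE x in lborel. (g x + cutoff 0 \<rho> (conv h g) x) * cnj (g x) = cutoff 0 \<rho> e x * cnj (g x)"
      using assms(4) by eventually_elim (use assms(3) in \<open>auto simp: cutoff_def\<close>)
  qed measurable
  have c2: "L2 (cutoff 0 \<rho> (conv h g))"
  proof (cases "0 \<le> \<rho>")
    case True then show ?thesis using conv_L2_cutoff[OF h assms(2)] by blast
  next
    case False
    then have "cutoff 0 \<rho> (conv h g) = (\<lambda>x. 0)" by (auto simp: cutoff_def)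
    then show ?thesis by (simp add: L2_zero)
  qed
  have "(\<lambda>x. conv h g x * cnj (g x)) = (\<lambda>x. cutoff 0 \<rho> (conv h g) x * cnj (g x))"
    using assms(3) by (force simp: cutoff_def)
  then have "ip (conv h g) g = ip (cutoff 0 \<rho> (conv h g)) g" by (simp add: ip_def)
  then have "qform h g = Re (ip g g + ip (cutoff 0 \<rho> (conv h g)) g)"
    by (simp add: qform_def ip_self)
  also have "ip g g + ip (cutoff 0 \<rho> (conv h g)) g = ip (cutoff 0 \<rho> e) g"
    using ip_add_left[OF assms(2) c2 assms(2)] eq by (simp add: ip_def)
  finally have "qform h g \<le> cmod (ip (cutoff 0 \<rho> e) g)" by (simp add: complex_Re_le_cmod)
  with c(2) have "c * nrm2 g \<le> cmod (ip (cutoff 0 \<rho> e) g)" by simp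
  then have "(c * nrm2 g)\<^sup>2 \<le> (cmod (ip (cutoff 0 \<rho> e) g))\<^sup>2"
    using c(1) by (intro power_mono) auto
  also have "\<dots> \<le> nrm2 (cutoff 0 \<rho> e) * nrm2 g" by (intro ip_bound L2_cutoff assms)
  finally have *: "c\<^sup>2 * nrm2 g * nrm2 g \<le> nrm2 (cutoff 0 \<rho> e) * nrm2 g"
    by (simp add: power2_eq_square mult_ac)
  show ?thesis
  proof (cases "nrm2 g = 0")
    case True then show ?thesis by simp
  next
    case False
    then have "nrm2 g > 0" using nrm2_nonneg[of g] by linarith
    with * have "c\<^sup>2 * nrm2 g \<le> nrm2 (cutoff 0 \<rho> e)" by (simp add: mult_le_cancel_right)
    then show ?thesis using c(1) by (simp add: field_simps)
  qed
qed

text \<open>The data of an accelerant on a window, in Borel form: \<open>h\<close> stands for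
  \<open>H\<close>, and \<open>f \<rho>\<close> for the column \<open>\<Gamma> \<rho> t 0\<close>
  extended by zero. Symmetry is required at every point, so that it can be used inside integrals by
  rewriting.\<close>

locale krein_kernel =
  fixes R c :: real and h :: "real \<Rightarrow> complex" and f :: "real \<Rightarrow> real \<Rightarrow> complex"
  assumes R: "0 < R" and h: "L2 h" and h_supp: "\<And>x. x \<notin> {-R..R} \<Longrightarrow> h x = 0"
    and herm: "\<And>x. h (- x) = cnj (h x)"
    and c: "c > 0"
    and coercive: "\<And>g. L2 g \<Longrightarrow> (\<And>x. x \<notin> {0..R} \<Longrightarrow> g x = 0) \<Longrightarrow> c * nrm2 g \<le> qform h g"
    and f: "\<And>\<rho>. \<rho> \<in> {0..R} \<Longrightarrow> L2 (f \<rho>)"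
    and f_supp: "\<And>\<rho> x. \<rho> \<in> {0..R} \<Longrightarrow> x \<notin> {0..\<rho>} \<Longrightarrow> f \<rho> x = 0"
    and f_eq: "\<And>\<rho>. \<rho> \<in> {0..R} \<Longrightarrow> AE t in lborel. t \<in> {0..\<rho>} \<longrightarrow> f \<rho> t + conv h (f \<rho>) t = h t"
begin

section \<open>Bounds and continuity of the resolvent columns\<close>

lemma h_meas [measurable]: "h \<in> borel_measurable borel" using h by (rule L2_measurable)

lemma f_meas: "\<rho> \<in> {0..R} \<Longrightarrow> f \<rho> \<in> borel_measurable borel" by (rule L2_measurable[OF f])

text \<open>Functions supported in a shorter interval inherit the coercivity on
  \<open>{0..R}\<close>, so one constant serves all \<open>\<rho>\<close>.\<close>

lemma resolvent_bound:
  assumes "\<rho> \<in> {0..R}" "L2 e" "L2 g" "\<And>x. x \<notin> {0..\<rho>} \<Longrightarrow> g x = 0"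
    and "AE t in lborel. t \<in> {0..\<rho>} \<longrightarrow> g t + conv h g t = e t"
  shows "nrm2 g \<le> nrm2 (cutoff 0 \<rho> e) / c\<^sup>2"
  by (rule nrm2_cutoff_AE_bound[OF assms(2-5) h c coercive])
    (use assms(1,3,4) in auto)

lemma nrm2_cutoff_mono: "L2 e \<Longrightarrow> nrm2 (cutoff a b e) \<le> nrm2 e"
  by (rule nrm2_mono_AE) (auto simp: cutoff_def L2_cutoff intro!: AE_I2)

definition B where "B = nrm2 h / c\<^sup>2"

lemma B_nonneg: "0 \<le> B" by (simp add: B_def)

lemma f_bound: assumes "\<rho> \<in> {0..R}" shows "nrm2 (f \<rho>) \<le> B"
proof -
  have "nrm2 (f \<rho>) \<le> nrm2 (cutoff 0 \<rho> h) / c\<^sup>2"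
    by (rule resolvent_bound[OF assms h f[OF assms] _ f_eq[OF assms]]) (rule f_supp[OF assms])
  also have "\<dots> \<le> B" unfolding B_def using nrm2_cutoff_mono[OF h] by (intro divide_right_mono) auto
  finally show ?thesis .
qed

text \<open>The difference solves a resolvent equation on \<open>{0..\<rho>'}\<close> whose
  right-hand side lives on the thin strip \<open>{\<rho>..\<rho>'}\<close>: left of
  \<open>\<rho>\<close> the two equations cancel, and right of it \<open>f \<rho>\<close> vanishes,
  leaving \<open>h - conv h (f \<rho>)\<close>.\<close>

lemma f_diff_bound:
  assumes "0 \<le> \<rho>" "\<rho> \<le> \<rho>'" "\<rho>' \<le> R"
  shows "nrm2 (\<lambda>t. f \<rho>' t - f \<rho> t) \<le> (2 * nrm2 (cutoff \<rho> \<rho>' h) + 2 * (nrm2 h * B * (\<rho>' - \<rho>))) / c\<^sup>2"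
proof -
  have r: "\<rho> \<in> {0..R}" "\<rho>' \<in> {0..R}" using assms by auto
  let ?k = "cutoff \<rho> \<rho>' (conv h (f \<rho>))"
  let ?e = "\<lambda>t. cutoff \<rho> \<rho>' h t - ?k t"
  have k: "L2 ?k" "nrm2 ?k \<le> nrm2 h * nrm2 (f \<rho>) * (\<rho>' - \<rho>)"
    using conv_L2_cutoff[OF h f[OF r(1)] assms(2)] by auto
  have hc: "L2 (cutoff \<rho> \<rho>' h)" by (rule L2_cutoff[OF h])
  have e: "L2 ?e" by (rule L2_diff[OF hc k(1)])
  have "nrm2 (\<lambda>t. f \<rho>' t - f \<rho> t) \<le> nrm2 (cutoff 0 \<rho>' ?e) / c\<^sup>2"
  proof (rule resolvent_bound[OF r(2) e L2_diff[OF f f]])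
    show "\<rho> \<in> {0..R}" "\<rho>' \<in> {0..R}" by fact+
    show "f \<rho>' x - f \<rho> x = 0" if "x \<notin> {0..\<rho>'}" for x
      using that f_supp[OF r(1), of x] f_supp[OF r(2), of x] assms by auto
    have "AE t in lborel. t \<noteq> \<rho>" by (rule AE_lborel_singleton)
    then show "AE t in lborel. t \<in> {0..\<rho>'} \<longrightarrow> f \<rho>' t - f \<rho> t + conv h (\<lambda>t. f \<rho>' t - f \<rho> t) t = ?e t"
      using f_eq[OF r(1)] f_eq[OF r(2)]
    proof eventually_elim
      case (elim t)
      show ?case
      proof (cases "t \<le> \<rho>")
        case True
        then have "cutoff \<rho> \<rho>' h t = 0" "?k t = 0" using elim(1) by (auto simp: cutoff_def)
        moreover have "t \<in> {0..\<rho>} \<longleftrightarrow> t \<in> {0..\<rho>'}" using True assms by auto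
        ultimately show ?thesis
          using elim by (auto simp: conv_diff_right[OF h f[OF r(2)] f[OF r(1)]])
            (metis add_diff_add add_uminus_conv_diff diff_self)
      next
        case False
        then have z: "f \<rho> t = 0" by (intro f_supp[OF r(1)]) auto
        show ?thesis
        proof
          assume t: "t \<in> {0..\<rho>'}"
          with False have "t \<in> {\<rho>..\<rho>'}" by auto
          then show "f \<rho>' t - f \<rho> t + conv h (\<lambda>t. f \<rho>' t - f \<rho> t) t = ?e t"
            using elim(3) t z by (simp add: conv_diff_right[OF h f[OF r(2)] f[OF r(1)]] cutoff_def)
        qed
      qed
    qed
  qed
  also have "\<dots> \<le> nrm2 ?e / c\<^sup>2" using nrm2_cutoff_mono[OF e] by (intro divide_right_mono) auto
  also have "\<dots> \<le> (2 * nrm2 (cutoff \<rho> \<rho>' h) + 2 * nrm2 ?k) / c\<^sup>2"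
    by (intro divide_right_mono nrm2_diff_le hc k) auto
  also have "\<dots> \<le> (2 * nrm2 (cutoff \<rho> \<rho>' h) + 2 * (nrm2 h * B * (\<rho>' - \<rho>))) / c\<^sup>2"
  proof -
    have "nrm2 h * nrm2 (f \<rho>) * (\<rho>' - \<rho>) \<le> nrm2 h * B * (\<rho>' - \<rho>)"
      using f_bound[OF r(1)] assms by (intro mult_right_mono mult_left_mono) auto
    with k(2) show ?thesis by (intro divide_right_mono) auto
  qed
  finally show ?thesis .
qed

text \<open>The strip between \<open>x n\<close> and \<open>\<rho>\<close> shrinks to a null set, so
  the part of \<open>h\<close> on it tends to zero in norm, and \<open>f_diff_bound\<close> does the
  rest.\<close>

lemma f_continuous:
  assumes "x \<longlonglongrightarrow> \<rho>" "\<And>n. x n \<in> {0..R}" "\<rho> \<in> {0..R}"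
  shows "(\<lambda>n. nrm2 (\<lambda>t. f (x n) t - f \<rho> t)) \<longlonglongrightarrow> 0"
proof -
  let ?k = "\<lambda>n. cutoff (min (x n) \<rho>) (max (x n) \<rho>) h"
  have "(\<lambda>n. nrm2 (\<lambda>t. ?k n t - 0)) \<longlonglongrightarrow> 0"
  proof (rule nrm2_dominated_convergence)
    show "integrable lborel (\<lambda>t. (cmod (h t))\<^sup>2)" by (rule L2_integrable[OF h])
    show "(cmod (?k n t - 0))\<^sup>2 \<le> (cmod (h t))\<^sup>2" for n t by (simp add: cutoff_def)
    have "AE t in lborel. t \<noteq> \<rho>" by (rule AE_lborel_singleton)
    then show "AE t in lborel. (\<lambda>n. ?k n t) \<longlonglongrightarrow> 0"
    proof eventually_elim
      case (elim t)
      have "eventually (\<lambda>n. ?k n t = 0) sequentially"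
      proof (cases "t < \<rho>")
        case True
        from order_tendstoD(1)[OF assms(1) this] show ?thesis
          by eventually_elim (use True in \<open>auto simp: cutoff_def\<close>)
      next
        case False
        with elim have t: "t > \<rho>" by auto
        from order_tendstoD(2)[OF assms(1) this] show ?thesis
          by eventually_elim (use t in \<open>auto simp: cutoff_def\<close>)
      qed
      then show ?case by (rule tendsto_eventually)
    qed
  qed measurable
  then have 1: "(\<lambda>n. nrm2 (?k n)) \<longlonglongrightarrow> 0" by simp
  have "(\<lambda>n. (2 * nrm2 (?k n) + 2 * (nrm2 h * B * \<bar>x n - \<rho>\<bar>)) / c\<^sup>2)
      \<longlonglongrightarrow> (2 * 0 + 2 * (nrm2 h * B * \<bar>\<rho> - \<rho>\<bar>)) / c\<^sup>2"
    using c by (intro tendsto_intros 1 assms) auto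
  then have lim: "(\<lambda>n. (2 * nrm2 (?k n) + 2 * (nrm2 h * B * \<bar>x n - \<rho>\<bar>)) / c\<^sup>2) \<longlonglongrightarrow> 0" by simp
  have "nrm2 (\<lambda>t. f (x n) t - f \<rho> t) \<le> (2 * nrm2 (?k n) + 2 * (nrm2 h * B * \<bar>x n - \<rho>\<bar>)) / c\<^sup>2" for n
  proof (cases "x n \<le> \<rho>")
    case True
    then show ?thesis using f_diff_bound[of "x n" \<rho>] assms(2)[of n] assms(3)
      unfolding nrm2_minus_commute[of "f (x n)"] by (simp add: min_def max_def)
  next
    case False
    then show ?thesis using f_diff_bound[of \<rho> "x n"] assms(2)[of n] assms(3)
      by (simp add: min_def max_def)
  qed
  then show ?thesis
    by (intro real_tendsto_sandwich[OF _ _ tendsto_const lim]) (auto intro: always_eventually)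
qed

text \<open>Convolution is bounded from L2 to the supremum norm, so norm continuity in
  \<open>\<rho>\<close> becomes pointwise continuity. In particular the value on the diagonal is
  meaningful although each column is known only almost everywhere.\<close>

lemma conv_jointly_continuous: "continuous_on ({0..R} \<times> UNIV) (\<lambda>p. conv h (f (fst p)) (snd p))"
  unfolding continuous_on_sequentially
proof (intro allI ballI impI, elim conjE)
  fix x and p :: "real \<times> real" assume p: "p \<in> {0..R} \<times> UNIV"
    and x: "\<forall>n. x n \<in> {0..R} \<times> UNIV" "x \<longlonglongrightarrow> p"
  have x1: "(\<lambda>n. fst (x n)) \<longlonglongrightarrow> fst p" and x2: "(\<lambda>n. snd (x n)) \<longlonglongrightarrow> snd p"
    using x(2) by (auto intro: tendsto_fst tendsto_snd)
  have xr: "fst (x n) \<in> {0..R}" for n using x(1) by (auto simp: mem_Times_iff)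
  have pr: "fst p \<in> {0..R}" using p by (auto simp: mem_Times_iff)
  let ?d = "\<lambda>n t. f (fst (x n)) t - f (fst p) t"
  have d: "L2 (?d n)" for n by (intro L2_diff f xr pr)
  have "(\<lambda>n. conv h (?d n) (snd (x n))) \<longlonglongrightarrow> 0"
  proof (rule Lim_null_comparison)
    show "\<forall>\<^sub>F n in sequentially. cmod (conv h (?d n) (snd (x n))) \<le> sqrt (nrm2 h * nrm2 (?d n))"
      by (intro always_eventually allI real_le_rsqrt conv_bound h d)
    have "(\<lambda>n. sqrt (nrm2 h * nrm2 (?d n))) \<longlonglongrightarrow> sqrt (nrm2 h * 0)"
      by (intro tendsto_intros f_continuous x1 xr pr)
    then show "(\<lambda>n. sqrt (nrm2 h * nrm2 (?d n))) \<longlonglongrightarrow> 0" by simp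
  qed
  moreover have "(\<lambda>n. conv h (f (fst p)) (snd (x n))) \<longlonglongrightarrow> conv h (f (fst p)) (snd p)"
  proof -
    have "continuous_on UNIV (conv h (f (fst p)))"
      by (rule continuous_on_conv[OF h _ f[OF pr], of "-R" R]) (rule h_supp)
    then show ?thesis using x2
      by (auto simp: continuous_on_eq_continuous_at intro: isCont_tendsto_compose)
  qed
  ultimately have "(\<lambda>n. conv h (?d n) (snd (x n)) + conv h (f (fst p)) (snd (x n)))
      \<longlonglongrightarrow> 0 + conv h (f (fst p)) (snd p)" by (rule tendsto_add)
  then show "((\<lambda>p. conv h (f (fst p)) (snd p)) \<circ> x) \<longlonglongrightarrow> conv h (f (fst p)) (snd p)"
    by (simp add: o_def conv_diff_right[OF h f[OF xr] f[OF pr]])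
qed

text \<open>Clamping the first argument extends a function that is continuous only on \<open>{0..R}\<close> times the
  line to a globally continuous, hence jointly Borel measurable one.\<close>

definition y where "y \<rho> t = conv h (f (max 0 (min R \<rho>))) t"

lemma y_eq: "\<rho> \<in> {0..R} \<Longrightarrow> y \<rho> t = conv h (f \<rho>) t"
  by (simp add: y_def)

lemma y_continuous: "continuous_on UNIV (\<lambda>p. y (fst p) (snd p))"
proof -
  have "continuous_on UNIV (\<lambda>p. conv h (f (fst (max 0 (min R (fst p)), snd p))) (snd (max 0 (min R (fst p)), snd p)))"
    by (rule continuous_on_compose2[OF conv_jointly_continuous])
      (use R in \<open>auto intro!: continuous_intros\<close>)
  then show ?thesis by (simp add: y_def)
qed

lemma y_meas [measurable (raw)]:
  assumes "F \<in> borel_measurable M" "F' \<in> borel_measurable M"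
  shows "(\<lambda>x. y (F x) (F' x)) \<in> borel_measurable M"
  using borel_measurable_continuous_on[OF y_continuous borel_measurable_Pair[OF assms]] by simp

definition b where "b = sqrt (nrm2 h * B)"

lemma y_bound: "cmod (y \<rho> t) \<le> b"
proof -
  have r: "max 0 (min R \<rho>) \<in> {0..R}" using R by auto
  have "(cmod (y \<rho> t))\<^sup>2 \<le> nrm2 h * nrm2 (f (max 0 (min R \<rho>)))"
    unfolding y_def by (rule conv_bound[OF h f[OF r]])
  also have "\<dots> \<le> nrm2 h * B" by (intro mult_left_mono f_bound r) simp
  finally show ?thesis unfolding b_def by (rule real_le_rsqrt)
qed

text \<open>The representative of \<open>f \<rho>\<close> read off from the resolvent equation. It
  is jointly Borel in both variables, which the separately chosen columns need not be and which
  Fubini's theorem demands.\<close>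

definition G where "G \<rho> t = (if 0 \<le> t \<and> t \<le> \<rho> then h t - y \<rho> t else 0)"

lemma G_meas [measurable (raw)]:
  assumes [measurable]: "F \<in> borel_measurable M" "F' \<in> borel_measurable M"
  shows "(\<lambda>x. G (F x) (F' x)) \<in> borel_measurable M"
  unfolding G_def by measurable

lemma f_eq_G: assumes "\<rho> \<in> {0..R}" shows "AE t in lborel. f \<rho> t = G \<rho> t"
  using f_eq[OF assms]
proof eventually_elim
  case (elim t)
  then show ?case using f_supp[OF assms, of t] assms by (auto simp: G_def y_eq eq_diff_eq)
qed

lemma G_L2: assumes "\<rho> \<in> {0..R}" shows "L2 (G \<rho>)" "nrm2 (G \<rho>) \<le> B"
proof -
  note [measurable] = f_meas[OF assms]
  have Gm: "G \<rho> \<in> borel_measurable borel" by measurable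
  have "integrable lborel (\<lambda>x. (cmod (f \<rho> x))\<^sup>2)" by (rule L2_integrable[OF f[OF assms]])
  then have "integrable lborel (\<lambda>x. (cmod (G \<rho> x))\<^sup>2)"
    by (rule integrable_cong_AE_imp) (use f_eq_G[OF assms] in auto)
  then show "L2 (G \<rho>)" using Gm by (simp add: L2_def)
  have "nrm2 (G \<rho>) = nrm2 (f \<rho>)" by (rule nrm2_cong_AE[symmetric]) (use f_eq_G[OF assms] Gm in auto)
  then show "nrm2 (G \<rho>) \<le> B" using f_bound[OF assms] by simp
qed

lemma conv_G: "\<rho> \<in> {0..R} \<Longrightarrow> conv h (G \<rho>) t = y \<rho> t"
  using conv_cong_AE[OF f_eq_G h f G_L2(1)] by (simp add: y_eq)

text \<open>Formally the diagonal value of the column, \<open>f \<rho> \<rho>\<close>; for an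
  accelerant of \<open>A\<close> it agrees almost everywhere on the window with
  \<open>cnj (A \<rho>)\<close>.\<close>

definition a where "a = cutoff 0 R (\<lambda>\<rho>. h \<rho> - y \<rho> \<rho>)"

lemma a_meas [measurable]: "a \<in> borel_measurable borel"
  unfolding a_def by measurable

lemma a_L2: "L2 a"
proof -
  have "L2 (cutoff 0 R (\<lambda>\<rho>. y \<rho> \<rho>))"
    by (rule L2_cutoff_bounded[of _ _ _ b]) (auto simp: y_bound)
  from L2_diff[OF L2_cutoff[OF h] this]
  have "L2 (\<lambda>\<rho>. cutoff 0 R h \<rho> - cutoff 0 R (\<lambda>\<rho>. y \<rho> \<rho>) \<rho>)" .
  moreover have "(\<lambda>\<rho>. cutoff 0 R h \<rho> - cutoff 0 R (\<lambda>\<rho>. y \<rho> \<rho>) \<rho>) = a" by (auto simp: a_def cutoff_def)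
  ultimately show ?thesis by simp
qed

lemma a_integrable: "integrable lborel a"
  by (rule L2_supp_integrable[OF a_L2, of 0 R]) (simp add: a_def cutoff_eq_zero)

section \<open>The integrated Krein-Bellman function\<close>

definition J where "J r s = (LINT \<rho>|lborel. cutoff 0 r a \<rho> * cnj (G \<rho> (\<rho> - s)))"

lemma J_meas [measurable]: "J r \<in> borel_measurable borel"
  unfolding J_def[abs_def] by measurable

lemma J_supp: "s \<notin> {0..r} \<Longrightarrow> J r s = 0"
proof -
  assume "s \<notin> {0..r}"
  then have "(\<lambda>\<rho>. cutoff 0 r a \<rho> * cnj (G \<rho> (\<rho> - s))) = (\<lambda>\<rho>. 0)" by (auto simp: G_def cutoff_def)
  then show "J r s = 0" unfolding J_def by simp
qed

lemma J_L2: "L2 (J r)"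
proof -
  \<comment> \<open>\<open>|G|\<close> is at most \<open>|h| + b\<close>: the first summand pairs
    \<open>a\<close> with a translate of \<open>h\<close>, the second with the constant
    \<open>b\<close>.\<close>
  define m where "m = sqrt (nrm2 a * nrm2 h) + b * (LINT \<rho>|lborel. cmod (a \<rho>))"
  have "cmod (J r s) \<le> m" for s
  proof -
    have hs: "L2 (\<lambda>\<rho>. h (\<rho> - s))" using L2_translate[OF h, of "-s"] by simp
    have nh: "nrm2 (\<lambda>\<rho>. h (\<rho> - s)) = nrm2 h"
      unfolding nrm2_def by (subst (2) lborel_integral_real_affine[of 1 _ "-s"]) (auto simp: add.commute)
    have i1: "integrable lborel (\<lambda>\<rho>. cmod (a \<rho>) * cmod (h (\<rho> - s)))"
      using integrable_norm[OF L2_mult_integrable[OF a_L2 hs]] by (simp add: norm_mult)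
    have i2: "integrable lborel (\<lambda>\<rho>. b * cmod (a \<rho>))" using integrable_norm[OF a_integrable] by simp
    have "cmod (J r s) \<le> (LINT \<rho>|lborel. cmod (cutoff 0 r a \<rho> * cnj (G \<rho> (\<rho> - s))))"
      unfolding J_def by (rule integral_norm_bound)
    also have "\<dots> \<le> (LINT \<rho>|lborel. cmod (a \<rho>) * cmod (h (\<rho> - s)) + b * cmod (a \<rho>))"
    proof (rule Bochner_Integration.integral_mono')
      show "integrable lborel (\<lambda>\<rho>. cmod (a \<rho>) * cmod (h (\<rho> - s)) + b * cmod (a \<rho>))" using i1 i2 by simp
      show "cmod (cutoff 0 r a \<rho> * cnj (G \<rho> (\<rho> - s))) \<le> cmod (a \<rho>) * cmod (h (\<rho> - s)) + b * cmod (a \<rho>)" for \<rho>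
      proof -
        have "cmod (G \<rho> (\<rho> - s)) \<le> cmod (h (\<rho> - s)) + b"
          using norm_triangle_ineq4[of "h (\<rho> - s)" "y \<rho> (\<rho> - s)"] y_bound[of \<rho> "\<rho> - s"]
            order_trans[OF norm_ge_zero y_bound[of \<rho> "\<rho> - s"]] norm_ge_zero[of "h (\<rho> - s)"]
          unfolding G_def by auto
        moreover have "cmod (cutoff 0 r a \<rho>) \<le> cmod (a \<rho>)" by (simp add: cutoff_def)
        ultimately have "cmod (cutoff 0 r a \<rho>) * cmod (G \<rho> (\<rho> - s)) \<le> cmod (a \<rho>) * (cmod (h (\<rho> - s)) + b)"
          by (intro mult_mono) auto
        then show ?thesis by (simp add: norm_mult algebra_simps)
      qed
    qed (simp add: b_def B_nonneg)
    also have "\<dots> = (LINT \<rho>|lborel. cmod (a \<rho>) * cmod (h (\<rho> - s))) + b * (LINT \<rho>|lborel. cmod (a \<rho>))"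
      using i1 i2 by simp
    also have "(LINT \<rho>|lborel. cmod (a \<rho>) * cmod (h (\<rho> - s))) \<le> sqrt (nrm2 a * nrm2 h)"
      by (rule real_le_rsqrt) (use Cauchy_Schwarz_abs[OF a_L2 hs] nh in simp)
    finally show ?thesis by (simp add: m_def)
  qed
  then have "L2 (cutoff 0 r (J r))" by (intro L2_cutoff_bounded[of _ _ _ m]) auto
  moreover have "cutoff 0 r (J r) = J r" using J_supp by (force simp: cutoff_def)
  ultimately show ?thesis by simp
qed

text \<open>For fixed \<open>s\<close> the evolution in \<open>r\<close> starts at
  \<open>r = s\<close> with the diagonal value \<open>a s\<close>; since
  \<open>G \<rho> (\<rho> - s)\<close> vanishes for \<open>\<rho> < s\<close>, the integral
  \<open>J r s\<close> runs over \<open>{s..r}\<close>.\<close>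

definition \<eta> where "\<eta> r s = cutoff 0 r a s - J r s"

lemma \<eta>_L2: "L2 (\<eta> r)"
  unfolding \<eta>_def[abs_def] by (intro L2_diff L2_cutoff a_L2 J_L2)

lemma \<eta>_supp: "s \<notin> {0..r} \<Longrightarrow> \<eta> r s = 0"
  by (simp add: \<eta>_def J_supp cutoff_eq_zero del: atLeastAtMost_iff)

lemma L2_G_shift: assumes "\<rho> \<in> {0..R}" shows "L2 (\<lambda>s. cnj (G \<rho> (\<rho> - s)))"
  "nrm2 (\<lambda>s. cnj (G \<rho> (\<rho> - s))) \<le> B"
  using L2_cnj[OF L2_reflect[OF G_L2(1)[OF assms], of \<rho>]] G_L2(2)[OF assms]
  by (simp_all add: nrm2_cnj nrm2_reflect)

text \<open>Fubini's theorem transfers a test function to the resolvent columns. A reflected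
  \<open>h\<close> as test function gives the resolvent equation for \<open>\<eta>\<close>, and an
  exponential gives the equation for \<open>p\<close>.\<close>

lemma integral_\<eta>:
  assumes \<phi>: "L2 \<phi>" and r: "r \<in> {0..R}"
  shows "(LINT s|lborel. \<phi> s * \<eta> r s)
    = (LINT \<rho>|lborel. cutoff 0 r a \<rho> * (\<phi> \<rho> - (LINT s|lborel. \<phi> s * cnj (G \<rho> (\<rho> - s)))))"
    (is "_ = (LINT \<rho>|lborel. cutoff 0 r a \<rho> * (\<phi> \<rho> - ?g \<rho>))")
proof -
  note [measurable] = \<phi>[THEN L2_measurable]
  have ca: "L2 (cutoff 0 r a)" by (rule L2_cutoff[OF a_L2])
  let ?K = "\<lambda>(\<rho>, s). \<phi> s * (cutoff 0 r a \<rho> * cnj (G \<rho> (\<rho> - s)))"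
  have K: "integrable (lborel \<Otimes>\<^sub>M lborel) ?K"
  proof (rule lborel_pair.Fubini_integrable)
    show "?K \<in> borel_measurable (lborel \<Otimes>\<^sub>M lborel)" by measurable
    show "AE \<rho> in lborel. integrable lborel (\<lambda>s. ?K (\<rho>, s))"
    proof (rule AE_I2)
      fix \<rho>
      show "integrable lborel (\<lambda>s. ?K (\<rho>, s))"
      proof (cases "\<rho> \<in> {0..R}")
        case True
        from integrable_mult_right[OF L2_mult_integrable[OF \<phi> L2_G_shift(1)[OF True]], of "cutoff 0 r a \<rho>"]
        show ?thesis by (simp add: mult_ac)
      next
        case False
        then have "a \<rho> = 0" unfolding a_def by (rule cutoff_eq_zero)
        then show ?thesis by (simp add: cutoff_def)
      qed
    qed
    show "integrable lborel (\<lambda>\<rho>. LINT s|lborel. norm (?K (\<rho>, s)))"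
    proof (rule Bochner_Integration.integrable_bound)
      show "integrable lborel (\<lambda>\<rho>. cmod (a \<rho>) * sqrt (nrm2 \<phi> * B))"
        using integrable_norm[OF a_integrable] by simp
      show "AE \<rho> in lborel. norm (LINT s|lborel. norm (?K (\<rho>, s))) \<le> norm (cmod (a \<rho>) * sqrt (nrm2 \<phi> * B))"
      proof (rule AE_I2)
        fix \<rho>
        have eq: "(LINT s|lborel. norm (?K (\<rho>, s)))
          = cmod (cutoff 0 r a \<rho>) * (LINT s|lborel. cmod (\<phi> s) * cmod (cnj (G \<rho> (\<rho> - s))))"
          by (subst integral_mult_right_zero[symmetric]) (simp add: norm_mult mult_ac)
        show "norm (LINT s|lborel. norm (?K (\<rho>, s))) \<le> norm (cmod (a \<rho>) * sqrt (nrm2 \<phi> * B))"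
        proof (cases "\<rho> \<in> {0..R}")
          case True
          have "(LINT s|lborel. cmod (\<phi> s) * cmod (cnj (G \<rho> (\<rho> - s)))) \<le> sqrt (nrm2 \<phi> * B)"
            using Cauchy_Schwarz_abs[OF \<phi> L2_G_shift(1)[OF True]]
              mult_left_mono[OF L2_G_shift(2)[OF True] nrm2_nonneg[of \<phi>]]
            by (intro real_le_rsqrt) linarith
          then have "cmod (cutoff 0 r a \<rho>) * (LINT s|lborel. cmod (\<phi> s) * cmod (cnj (G \<rho> (\<rho> - s))))
            \<le> cmod (a \<rho>) * sqrt (nrm2 \<phi> * B)"
            by (intro mult_mono) (auto simp: cutoff_def)
          moreover have "0 \<le> (LINT s|lborel. norm (?K (\<rho>, s)))" by simp
          ultimately show ?thesis unfolding eq by (simp add: B_nonneg)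
        next
          case False
          then have "a \<rho> = 0" unfolding a_def by (rule cutoff_eq_zero)
          then show ?thesis by (simp add: cutoff_def)
        qed
      qed
    qed measurable
  qed
  have "(LINT s|lborel. \<phi> s * \<eta> r s) = (LINT s|lborel. \<phi> s * cutoff 0 r a s) - (LINT s|lborel. \<phi> s * J r s)"
    unfolding \<eta>_def right_diff_distrib
    by (rule Bochner_Integration.integral_diff) (intro L2_mult_integrable \<phi> ca J_L2)+
  also have "(LINT s|lborel. \<phi> s * J r s) = (LINT s|lborel. LINT \<rho>|lborel. ?K (\<rho>, s))"
    by (simp add: J_def)
  also have "\<dots> = (LINT \<rho>|lborel. LINT s|lborel. ?K (\<rho>, s))"
    using lborel_pair.Fubini_integral[OF K] by simp
  also have gK: "(\<lambda>\<rho>. LINT s|lborel. ?K (\<rho>, s)) = (\<lambda>\<rho>. cutoff 0 r a \<rho> * ?g \<rho>)"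
    by (rule ext) (subst integral_mult_right_zero[symmetric], simp add: mult_ac)
  also have "(LINT s|lborel. \<phi> s * cutoff 0 r a s) - (LINT \<rho>|lborel. cutoff 0 r a \<rho> * ?g \<rho>)
    = (LINT \<rho>|lborel. \<phi> \<rho> * cutoff 0 r a \<rho> - cutoff 0 r a \<rho> * ?g \<rho>)"
  proof (rule Bochner_Integration.integral_diff[symmetric])
    show "integrable lborel (\<lambda>s. \<phi> s * cutoff 0 r a s)" by (intro L2_mult_integrable \<phi> ca)
    have "integrable lborel (\<lambda>\<rho>. LINT s|lborel. ?K (\<rho>, s))"
      by (rule lborel_pair.integrable_fst) (use K in simp)
    then show "integrable lborel (\<lambda>\<rho>. cutoff 0 r a \<rho> * ?g \<rho>)" unfolding gK .
  qed
  finally show ?thesis by (simp add: algebra_simps)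
qed


text \<open>The function \<open>\<eta> r\<close> integrates the Krein--Bellman equation
  \<open>\<partial>\<^sub>r f\<^sub>r(t) = - cnj (f\<^sub>r (r - t)) a(r)\<close>. It satisfies the resolvent equation up to the error
  \<open>e t = conv h (\<eta> t - f t) t\<close>, which no longer depends on \<open>r\<close>.\<close>

definition e where "e t = conv h (\<eta> t) t - y t t"

text \<open>After the substitution \<open>s = \<rho> - u\<close>, hermitian symmetry turns the inner
  integral into the conjugate of \<open>conv h (G \<rho>)\<close> at \<open>\<rho> - t\<close>. That
  point may be negative, so \<open>y\<close> appears here and not \<open>G\<close>.\<close>

lemma conv_\<eta>:
  assumes r: "r \<in> {0..R}"
  shows "conv h (\<eta> r) t = (LINT \<rho>|lborel. cutoff 0 r a \<rho> * cnj (h (\<rho> - t) - y \<rho> (\<rho> - t)))"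
proof -
  have "conv h (\<eta> r) t = (LINT \<rho>|lborel. cutoff 0 r a \<rho> * (h (t - \<rho>) - (LINT s|lborel. h (t - s) * cnj (G \<rho> (\<rho> - s)))))"
    unfolding conv_def by (rule integral_\<eta>[OF L2_reflect[OF h] r])
  also have "\<dots> = (LINT \<rho>|lborel. cutoff 0 r a \<rho> * cnj (h (\<rho> - t) - y \<rho> (\<rho> - t)))"
  proof (rule Bochner_Integration.integral_cong[OF refl])
    fix \<rho>
    show "cutoff 0 r a \<rho> * (h (t - \<rho>) - (LINT s|lborel. h (t - s) * cnj (G \<rho> (\<rho> - s))))
      = cutoff 0 r a \<rho> * cnj (h (\<rho> - t) - y \<rho> (\<rho> - t))"
    proof (cases "\<rho> \<in> {0..R}")
      case True
      have "(LINT s|lborel. h (t - s) * cnj (G \<rho> (\<rho> - s))) = (LINT u|lborel. h (t - (\<rho> - u)) * cnj (G \<rho> u))"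
        by (subst lborel_integral_real_affine[of "-1" _ \<rho>]) auto
      also have "\<dots> = (LINT u|lborel. cnj (h ((\<rho> - t) - u) * G \<rho> u))"
        by (simp add: herm[symmetric] algebra_simps)
      also have "\<dots> = cnj (y \<rho> (\<rho> - t))"
        unfolding Bochner_Integration.integral_cnj conv_G[OF True, symmetric] conv_def ..
      finally show ?thesis by (simp add: herm[symmetric])
    next
      case False
      then have "a \<rho> = 0" unfolding a_def by (rule cutoff_eq_zero)
      then show ?thesis by (simp add: cutoff_def)
    qed
  qed
  finally show ?thesis .
qed

text \<open>Split the integral for \<open>conv h (\<eta> r) t\<close> at \<open>\<rho> = t\<close>.
  Beyond \<open>t\<close> the bracket is \<open>G \<rho> (\<rho> - t)\<close> and produces
  \<open>J r t\<close>, which cancels the integral term of \<open>\<eta> r t\<close>; up to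
  \<open>t\<close> it is \<open>conv h (\<eta> t) t\<close>, free of \<open>r\<close>.\<close>

lemma \<eta>_equation:
  assumes r: "r \<in> {0..R}" and t: "t \<in> {0..r}"
  shows "\<eta> r t + conv h (\<eta> r) t = h t + e t"
proof -
  have tR: "t \<in> {0..R}" using r t by auto
  let ?X = "\<lambda>\<rho>. cnj (h (\<rho> - t) - y \<rho> (\<rho> - t))"
  have iX: "integrable lborel (\<lambda>\<rho>. cutoff 0 u a \<rho> * ?X \<rho>)" for u
  proof -
    have ca: "L2 (cutoff 0 u a)" by (rule L2_cutoff[OF a_L2])
    have "L2 (\<lambda>\<rho>. cnj (h (\<rho> - t)))"
      using L2_cnj[OF L2_translate[OF h, of "-t"]] by simp
    from L2_mult_integrable[OF ca this] have 1: "integrable lborel (\<lambda>\<rho>. cutoff 0 u a \<rho> * cnj (h (\<rho> - t)))" .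
    have "L2 (cutoff 0 u (\<lambda>\<rho>. cnj (y \<rho> (\<rho> - t))))"
      by (rule L2_cutoff_bounded[of _ _ _ b]) (auto simp: y_bound)
    from L2_mult_integrable[OF a_L2 this]
    have "integrable lborel (\<lambda>\<rho>. cutoff 0 u a \<rho> * cnj (y \<rho> (\<rho> - t)))"
      by (rule Bochner_Integration.integrable_cong[OF refl, THEN iffD1, rotated]) (auto simp: cutoff_def)
    from Bochner_Integration.integrable_diff[OF 1 this] show ?thesis by (simp add: algebra_simps)
  qed
  have iG: "integrable lborel (\<lambda>\<rho>. cutoff 0 r a \<rho> * cnj (G \<rho> (\<rho> - t)))"
  proof (rule Bochner_Integration.integrable_bound[OF iX[of r]])
    show "AE \<rho> in lborel. norm (cutoff 0 r a \<rho> * cnj (G \<rho> (\<rho> - t))) \<le> norm (cutoff 0 r a \<rho> * ?X \<rho>)"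
      by (rule AE_I2) (auto simp: G_def norm_mult simp del: complex_cnj_diff)
  qed measurable
  have "conv h (\<eta> r) t = (LINT \<rho>|lborel. cutoff 0 t a \<rho> * ?X \<rho> + cutoff 0 r a \<rho> * cnj (G \<rho> (\<rho> - t)))"
    unfolding conv_\<eta>[OF r]
  proof (rule integral_cong_AE)
    \<comment> \<open>At \<open>\<rho> = t\<close> itself both pieces are present.\<close>
    have "AE \<rho> in lborel. \<rho> \<noteq> t" by (rule AE_lborel_singleton)
    then show "AE \<rho> in lborel. cutoff 0 r a \<rho> * ?X \<rho>
      = cutoff 0 t a \<rho> * ?X \<rho> + cutoff 0 r a \<rho> * cnj (G \<rho> (\<rho> - t))"
      by eventually_elim (use t in \<open>auto simp: cutoff_def G_def\<close>)
  qed measurable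
  also have "\<dots> = conv h (\<eta> t) t + J r t"
    unfolding conv_\<eta>[OF tR] J_def by (rule Bochner_Integration.integral_add[OF iX iG])
  finally have "conv h (\<eta> r) t = conv h (\<eta> t) t + J r t" .
  moreover have "\<eta> r t = h t - y t t - J r t"
    using t tR r by (simp add: \<eta>_def cutoff_def a_def)
  ultimately show ?thesis by (simp add: e_def)
qed

text \<open>As the error does not depend on \<open>r\<close>, the equation for \<open>r = R\<close>
  expresses it by square integrable functions on the whole window.\<close>

lemma e_L2: "L2 (cutoff 0 R e)"
proof -
  have RR: "R \<in> {0..R}" using R by simp
  have "L2 (\<lambda>t. cutoff 0 R (\<eta> R) t + cutoff 0 R (conv h (\<eta> R)) t - cutoff 0 R h t)"
    using R by (intro L2_diff L2_add L2_cutoff \<eta>_L2 h conv_L2_cutoff) auto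
  moreover have "(\<lambda>t. cutoff 0 R (\<eta> R) t + cutoff 0 R (conv h (\<eta> R)) t - cutoff 0 R h t) = cutoff 0 R e"
  proof
    fix t show "cutoff 0 R (\<eta> R) t + cutoff 0 R (conv h (\<eta> R)) t - cutoff 0 R h t = cutoff 0 R e t"
      using \<eta>_equation[OF RR, of t] by (cases "t \<in> {0..R}")
        (simp_all add: cutoff_def del: atLeastAtMost_iff)
  qed
  ultimately show ?thesis by simp
qed

lemma \<eta>_minus_f_bound:
  assumes r: "r \<in> {0..R}"
  shows "nrm2 (\<lambda>t. \<eta> r t - f r t) \<le> nrm2 (cutoff 0 r (cutoff 0 R e)) / c\<^sup>2"
proof (rule resolvent_bound[OF r e_L2 L2_diff[OF \<eta>_L2 f[OF r]]])
  show "\<eta> r x - f r x = 0" if "x \<notin> {0..r}" for x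
    using \<eta>_supp[OF that] f_supp[OF r that] by simp
  show "AE t in lborel. t \<in> {0..r} \<longrightarrow> \<eta> r t - f r t + conv h (\<lambda>t. \<eta> r t - f r t) t = cutoff 0 R e t"
    using f_eq[OF r]
  proof eventually_elim
    case (elim t)
    show ?case
    proof
      assume t: "t \<in> {0..r}"
      then have "cutoff 0 R e t = e t" using r by (simp add: cutoff_def)
      moreover have "f r t + conv h (f r) t = h t" using elim t by simp
      ultimately show "\<eta> r t - f r t + conv h (\<lambda>t. \<eta> r t - f r t) t = cutoff 0 R e t"
        using \<eta>_equation[OF r t] by (simp add: conv_diff_right[OF h \<eta>_L2 f[OF r]] algebra_simps)
    qed
  qed
qed

text \<open>The error controls itself: \<open>e t\<close> is the convolution of \<open>h\<close>
  with \<open>\<eta> t - f t\<close>, and the resolvent bound estimates this difference by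
  \<open>e\<close> on \<open>{0..t}\<close> alone. Gronwall's argument then gives zero, so
  \<open>\<eta>\<close> is the resolvent column.\<close>

lemma e_zero: assumes "t \<in> {0..R}" shows "e t = 0"
proof -
  let ?e = "cutoff 0 R e"
  have "(cmod (?e t))\<^sup>2 = 0"
  proof (rule gronwall_zero[of "\<lambda>t. (cmod (?e t))\<^sup>2" "(nrm2 h + 1) / c\<^sup>2" R])
    show "integrable lborel (\<lambda>t. (cmod (?e t))\<^sup>2)" by (rule L2_integrable[OF e_L2])
    show "(nrm2 h + 1) / c\<^sup>2 > 0" using c by (simp add: add_nonneg_pos)
    show "(cmod (?e t))\<^sup>2 \<le> (nrm2 h + 1) / c\<^sup>2 * (LINT s|lborel. indicator {0..t} s * (cmod (?e s))\<^sup>2)"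
      if t: "t \<in> {0..R}" for t
    proof -
      have n: "(LINT s|lborel. indicator {0..t} s * (cmod (?e s))\<^sup>2) = nrm2 (cutoff 0 t ?e)"
        unfolding nrm2_def by (rule Bochner_Integration.integral_cong) (auto simp: cutoff_def indicator_def)
      have "?e t = conv h (\<lambda>s. \<eta> t s - f t s) t"
        using t by (simp add: cutoff_def e_def conv_diff_right[OF h \<eta>_L2 f[OF t]] y_eq)
      then have "(cmod (?e t))\<^sup>2 \<le> nrm2 h * nrm2 (\<lambda>s. \<eta> t s - f t s)"
        using conv_bound[OF h L2_diff[OF \<eta>_L2 f[OF t]]] by simp
      also have "\<dots> \<le> (nrm2 h + 1) * (nrm2 (cutoff 0 t ?e) / c\<^sup>2)"
        using \<eta>_minus_f_bound[OF t] by (intro mult_mono) auto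
      finally show ?thesis unfolding n by simp
    qed
  qed (use assms in auto)
  then show ?thesis using assms by (simp add: cutoff_def)
qed

lemma f_eq_\<eta>: assumes r: "r \<in> {0..R}" shows "AE t in lborel. f r t = \<eta> r t"
proof -
  have "cutoff 0 r (cutoff 0 R e) = (\<lambda>t. 0)" using e_zero by (auto simp: cutoff_def)
  then have "nrm2 (\<lambda>t. \<eta> r t - f r t) \<le> 0" using \<eta>_minus_f_bound[OF r] by (simp add: nrm2_def)
  then have "nrm2 (\<lambda>t. \<eta> r t - f r t) = 0" using nrm2_nonneg[of "\<lambda>t. \<eta> r t - f r t"] by linarith
  from nrm2_eq_0[OF L2_diff[OF \<eta>_L2 f[OF r]] this] show ?thesis by eventually_elim simp
qed

text \<open>\<open>p\<close> is the first solution of the Krein system with the factor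
  \<open>exp (\<i> * z * of_real r)\<close> removed, and \<open>q\<close> is the second solution
  \<open>Ps\<close>.\<close>

definition p where "p z r = 1 - (LINT s|lborel. f r s * exp (- \<i> * z * of_real s))"
definition q where "q z r = 1 - (LINT s|lborel. cnj (f r s) * exp (\<i> * z * of_real s))"

lemma q_eq_cnj_p: "q z r = cnj (p (cnj z) r)"
  by (simp add: p_def q_def exp_cnj flip: Bochner_Integration.integral_cnj)

text \<open>Test \<open>\<eta>\<close> with an exponential. The shift by \<open>\<rho>\<close> in
  the column splits off \<open>E \<rho>\<close>, and what remains of the bracket is exactly
  \<open>q z \<rho>\<close>.\<close>

lemma p_equation:
  assumes r: "r \<in> {0..R}"
  shows "p z r = 1 - (LINT \<rho>|lborel. cutoff 0 r a \<rho> * exp (- \<i> * z * of_real \<rho>) * q z \<rho>)"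
proof -
  define E where "E s = exp (- \<i> * z * complex_of_real s)" for s
  have Ec: "continuous_on UNIV E" unfolding E_def by (intro continuous_intros)
  have Em [measurable]: "E \<in> borel_measurable borel" using Ec by (rule borel_measurable_continuous_onI)
  note [measurable] = f_meas[OF r] \<eta>_L2[THEN L2_measurable]
  have \<phi>: "L2 (cutoff 0 R E)" by (rule L2_cutoff_continuous[OF Ec])
  have "(LINT s|lborel. f r s * E s) = (LINT s|lborel. cutoff 0 R E s * \<eta> r s)"
  proof (rule integral_cong_AE)
    show "AE s in lborel. f r s * E s = cutoff 0 R E s * \<eta> r s"
      using f_eq_\<eta>[OF r]
    proof eventually_elim
      case (elim s)
      then show ?case using f_supp[OF r, of s] r by (auto simp: cutoff_def)
    qed
  qed measurable
  also have "\<dots> = (LINT \<rho>|lborel. cutoff 0 r a \<rho> * (cutoff 0 R E \<rho> - (LINT s|lborel. cutoff 0 R E s * cnj (G \<rho> (\<rho> - s)))))"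
    by (rule integral_\<eta>[OF \<phi> r])
  also have "\<dots> = (LINT \<rho>|lborel. cutoff 0 r a \<rho> * E \<rho> * q z \<rho>)"
  proof (rule Bochner_Integration.integral_cong[OF refl])
    fix \<rho>
    show "cutoff 0 r a \<rho> * (cutoff 0 R E \<rho> - (LINT s|lborel. cutoff 0 R E s * cnj (G \<rho> (\<rho> - s))))
      = cutoff 0 r a \<rho> * E \<rho> * q z \<rho>"
    proof (cases "\<rho> \<in> {0..r}")
      case True
      then have \<rho>: "\<rho> \<in> {0..R}" using r by auto
      note [measurable] = f_meas[OF \<rho>]
      have "(LINT s|lborel. cutoff 0 R E s * cnj (G \<rho> (\<rho> - s))) = (LINT s|lborel. E s * cnj (G \<rho> (\<rho> - s)))"
        by (rule Bochner_Integration.integral_cong) (use \<rho> in \<open>auto simp: cutoff_def G_def\<close>)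
      also have "\<dots> = (LINT u|lborel. E (\<rho> - u) * cnj (G \<rho> u))"
        by (subst lborel_integral_real_affine[of "-1" _ \<rho>]) auto
      also have "\<dots> = (LINT u|lborel. E \<rho> * (cnj (f \<rho> u) * exp (\<i> * z * of_real u)))"
      proof (rule integral_cong_AE)
        show "AE u in lborel. E (\<rho> - u) * cnj (G \<rho> u) = E \<rho> * (cnj (f \<rho> u) * exp (\<i> * z * of_real u))"
          using f_eq_G[OF \<rho>]
          by eventually_elim (simp add: E_def exp_add[symmetric] algebra_simps)
      qed measurable
      also have "\<dots> = E \<rho> * (LINT u|lborel. cnj (f \<rho> u) * exp (\<i> * z * of_real u))" by simp
      finally show ?thesis using \<rho> by (simp add: cutoff_def q_def algebra_simps)
    next
      case False
      then have "cutoff 0 r a \<rho> = 0" by (rule cutoff_eq_zero)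
      then show ?thesis by simp
    qed
  qed
  finally show ?thesis by (simp add: p_def E_def)
qed

lemma q_equation:
  assumes r: "r \<in> {0..R}"
  shows "q z r = 1 - (LINT \<rho>|lborel. cutoff 0 r (\<lambda>\<rho>. cnj (a \<rho>)) \<rho> * exp (\<i> * z * of_real \<rho>) * p z \<rho>)"
  unfolding q_eq_cnj_p p_equation[OF r] complex_cnj_diff Bochner_Integration.integral_cnj[symmetric]
  by (simp add: exp_cnj cutoff_def if_distrib[of cnj] q_eq_cnj_p cong: if_cong)

end

section \<open>The Krein system of an accelerant\<close>

context krein_kernel
begin

text \<open>Stated for differences of solutions, hence without initial values. With \<open>a\<close>
  only in L2, Cauchy-Schwarz is applied to each integral and Gronwall's argument to the sum of the
  squares.\<close>

lemma volterra_unique: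
  assumes U: "L2 (cutoff 0 R U)" and V: "L2 (cutoff 0 R V)"
    and Ueq: "\<And>t. t \<in> {0..R} \<Longrightarrow> U t = (LINT s|lborel. cutoff 0 t (\<lambda>s. \<i> * z * U s - a s * V s) s)"
    and Veq: "\<And>t. t \<in> {0..R} \<Longrightarrow> V t = (LINT s|lborel. cutoff 0 t (\<lambda>s. - cnj (a s) * U s) s)"
    and t: "t \<in> {0..R}"
  shows "U t = 0"
proof -
  define g where "g t = (cmod (cutoff 0 R U t))\<^sup>2 + (cmod (cutoff 0 R V t))\<^sup>2" for t
  have gi: "integrable lborel g" unfolding g_def
    using L2_integrable[OF U] L2_integrable[OF V] by simp
  \<comment> \<open>The term with \<open>z\<close> contributes \<open>2 * (cmod z)^2 * R\<close>,
    the two terms with \<open>a\<close> contribute \<open>2 * nrm2 a\<close> and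
    \<open>nrm2 a\<close>, and the 1 makes \<open>C\<close> positive.\<close>
  define C where "C = 2 * (cmod z)\<^sup>2 * R + 3 * nrm2 a + 1"
  have C: "C > 0" unfolding C_def using R by (intro add_nonneg_pos) auto
  have "g t = 0"
  proof (rule gronwall_zero[OF gi _ C _ t])
    show "0 \<le> g t" for t by (simp add: g_def)
    show "g t \<le> C * (LINT s|lborel. indicator {0..t} s * g s)" if t: "t \<in> {0..R}" for t
    proof -
      let ?U = "cutoff 0 t (cutoff 0 R U)" and ?V = "cutoff 0 t (cutoff 0 R V)"
      have LU: "L2 ?U" and LV: "L2 ?V" by (intro L2_cutoff U V)+
      have one: "L2 (cutoff 0 R (\<lambda>x. 1))" by (rule L2_cutoff_bounded[of _ _ _ 1]) auto
      have n1: "nrm2 (cutoff 0 R (\<lambda>x. 1)) \<le> R"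
        using nrm2_cutoff_le[of "\<lambda>x. 1" 0 R 1] R by simp
      have "(LINT s|lborel. indicator {0..t} s * g s)
        = (LINT s|lborel. (cmod (?U s))\<^sup>2 + (cmod (?V s))\<^sup>2)"
        by (rule Bochner_Integration.integral_cong) (use t in \<open>auto simp: g_def cutoff_def indicator_def\<close>)
      also have "\<dots> = nrm2 ?U + nrm2 ?V"
        unfolding nrm2_def by (rule Bochner_Integration.integral_add) (intro L2_integrable LU LV)+
      finally have I: "(LINT s|lborel. indicator {0..t} s * g s) = nrm2 ?U + nrm2 ?V" .
      have i1: "integrable lborel (\<lambda>s. cutoff 0 R (\<lambda>x. 1) s * ?U s)"
        and i2: "integrable lborel (\<lambda>s. a s * ?V s)" by (intro L2_mult_integrable one LU LV a_L2)+
      have "U t = (LINT s|lborel. (\<i> * z) * (cutoff 0 R (\<lambda>x. 1) s * ?U s) - a s * ?V s)"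
        unfolding Ueq[OF t] by (rule Bochner_Integration.integral_cong) (use t in \<open>auto simp: cutoff_def\<close>)
      also have "\<dots> = \<i> * z * (LINT s|lborel. cutoff 0 R (\<lambda>x. 1) s * ?U s) - (LINT s|lborel. a s * ?V s)"
        using i1 i2 by simp
      finally have "(cmod (U t))\<^sup>2 \<le> 2 * (cmod (\<i> * z * (LINT s|lborel. cutoff 0 R (\<lambda>x. 1) s * ?U s)))\<^sup>2
          + 2 * (cmod (- (LINT s|lborel. a s * ?V s)))\<^sup>2"
        using cmod_add_sq_le[of "\<i> * z * (LINT s|lborel. cutoff 0 R (\<lambda>x. 1) s * ?U s)" "- (LINT s|lborel. a s * ?V s)"]
        by simp
      also have "\<dots> = 2 * ((cmod z)\<^sup>2 * (cmod (LINT s|lborel. cutoff 0 R (\<lambda>x. 1) s * ?U s))\<^sup>2)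
          + 2 * (cmod (LINT s|lborel. a s * ?V s))\<^sup>2"
        by (simp add: norm_mult power_mult_distrib)
      also have "\<dots> \<le> 2 * ((cmod z)\<^sup>2 * (R * nrm2 ?U)) + 2 * (nrm2 a * nrm2 ?V)"
      proof -
        have "(cmod (LINT s|lborel. cutoff 0 R (\<lambda>x. 1) s * ?U s))\<^sup>2 \<le> nrm2 (cutoff 0 R (\<lambda>x. 1)) * nrm2 ?U"
          by (rule Cauchy_Schwarz_L2[OF one LU])
        also have "\<dots> \<le> R * nrm2 ?U" by (rule mult_right_mono[OF n1]) simp
        finally show ?thesis using Cauchy_Schwarz_L2[OF a_L2 LV]
          by (intro add_mono mult_left_mono) auto
      qed
      finally have u: "(cmod (U t))\<^sup>2 \<le> 2 * ((cmod z)\<^sup>2 * (R * nrm2 ?U)) + 2 * (nrm2 a * nrm2 ?V)" .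
      have "V t = (LINT s|lborel. - (cnj (a s) * ?U s))"
        unfolding Veq[OF t] by (rule Bochner_Integration.integral_cong) (use t in \<open>auto simp: cutoff_def\<close>)
      then have v: "(cmod (V t))\<^sup>2 \<le> nrm2 a * nrm2 ?U"
        using Cauchy_Schwarz_L2[OF L2_cnj[OF a_L2] LU] by (simp add: nrm2_cnj)
      have "g t \<le> 2 * ((cmod z)\<^sup>2 * (R * nrm2 ?U)) + 2 * (nrm2 a * nrm2 ?V) + nrm2 a * nrm2 ?U"
        using u v t by (simp add: g_def cutoff_def)
      also have "\<dots> \<le> C * (nrm2 ?U + nrm2 ?V)"
      proof -
        have "0 \<le> (cmod z)\<^sup>2 * (R * nrm2 ?V)" "0 \<le> nrm2 a * nrm2 ?U" "0 \<le> nrm2 a * nrm2 ?V"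
          using R by auto
        then show ?thesis using nrm2_nonneg[of ?U] nrm2_nonneg[of ?V]
          by (simp add: C_def algebra_simps)
      qed
      finally show ?thesis unfolding I .
    qed
  qed
  then have "(cmod (cutoff 0 R U t))\<^sup>2 \<le> 0" unfolding g_def using zero_le_power2[of "cmod (cutoff 0 R V t)"] by linarith
  then show ?thesis using t by (simp add: cutoff_def)
qed

lemma L2_exp: "L2 (cutoff 0 R (\<lambda>s. exp (z * complex_of_real s)))"
  by (intro L2_cutoff_continuous continuous_intros)

lemma p_L2: "L2 (cutoff 0 R (p z))"
proof -
  \<comment> \<open>Measurability in \<open>r\<close> is visible only after \<open>f\<close> is
    replaced by its jointly Borel representative \<open>G\<close>.\<close>
  define P where "P r = 1 - (LINT s|lborel. G r s * exp (- \<i> * z * of_real s))" for r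
  have [measurable]: "P \<in> borel_measurable borel" unfolding P_def[abs_def] by measurable
  have pP: "p z r = P r" if "r \<in> {0..R}" for r
  proof -
    note [measurable] = f_meas[OF that]
    have "(LINT s|lborel. f r s * exp (- \<i> * z * of_real s)) = (LINT s|lborel. G r s * exp (- \<i> * z * of_real s))"
    proof (rule integral_cong_AE)
      show "AE s in lborel. f r s * exp (- \<i> * z * of_real s) = G r s * exp (- \<i> * z * of_real s)"
        using f_eq_G[OF that] by eventually_elim simp
    qed measurable
    then show ?thesis by (simp add: p_def P_def)
  qed
  let ?E = "cutoff 0 R (\<lambda>s. exp ((- \<i> * z) * complex_of_real s))"
  have "L2 (cutoff 0 R P)"
  proof (rule L2_cutoff_bounded)
    show "cmod (P r) \<le> 1 + sqrt (B * nrm2 ?E)" if r: "r \<in> {0..R}" for r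
    proof -
      have "(LINT s|lborel. G r s * exp (- \<i> * z * of_real s)) = (LINT s|lborel. G r s * ?E s)"
        by (rule Bochner_Integration.integral_cong) (use r in \<open>auto simp: G_def cutoff_def\<close>)
      then have "cmod (P r) \<le> 1 + cmod (LINT s|lborel. G r s * ?E s)"
        using norm_triangle_ineq4[of 1 "LINT s|lborel. G r s * ?E s"] by (simp add: P_def)
      moreover have "cmod (LINT s|lborel. G r s * ?E s) \<le> sqrt (B * nrm2 ?E)"
      proof (rule real_le_rsqrt)
        have "(cmod (LINT s|lborel. G r s * ?E s))\<^sup>2 \<le> nrm2 (G r) * nrm2 ?E"
          by (rule Cauchy_Schwarz_L2[OF G_L2(1)[OF r] L2_exp])
        also have "\<dots> \<le> B * nrm2 ?E" by (rule mult_right_mono[OF G_L2(2)[OF r]]) simp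
        finally show "(cmod (LINT s|lborel. G r s * ?E s))\<^sup>2 \<le> B * nrm2 ?E" .
      qed
      ultimately show ?thesis by simp
    qed
  qed measurable
  moreover have "cutoff 0 R P = cutoff 0 R (p z)" using pP by (auto simp: cutoff_def)
  ultimately show ?thesis by simp
qed

lemma q_L2: "L2 (cutoff 0 R (q z))"
proof -
  have "(\<lambda>r. cnj (cutoff 0 R (p (cnj z)) r)) = cutoff 0 R (q z)"
    by (auto simp: cutoff_def q_eq_cnj_p)
  then show ?thesis using L2_cnj[OF p_L2[of "cnj z"]] by simp
qed

text \<open>Multiplying \<open>p\<close> by \<open>exp (\<i> z r)\<close> turns the equation for \<open>p\<close> into the first equation of the
  Krein system; this is integration by parts, done with Fubini's theorem on a triangle.\<close>

lemma exp_p_equation: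
  assumes t: "t \<in> {0..R}"
  shows "exp (\<i> * z * of_real t) * p z t
    = 1 + (LINT s|lborel. cutoff 0 t (\<lambda>s. \<i> * z * (exp (\<i> * z * of_real s) * p z s) - a s * q z s) s)"
proof -
  define E where "E s = exp (\<i> * z * complex_of_real s)" for s
  define b where "b s = a s * exp (- \<i> * z * of_real s) * q z s" for s
  have Ec: "continuous_on S E" for S unfolding E_def by (intro continuous_intros)
  have [measurable]: "E \<in> borel_measurable borel" using Ec by (rule borel_measurable_continuous_onI)
  have LE: "L2 (cutoff 0 R E)" using L2_exp[of "\<i> * z"] by (simp add: E_def[abs_def])
  \<comment> \<open>The exponentials cancel, which is why the term with \<open>q\<close> in the
    Krein system carries none.\<close>
  have Eb: "E s * b s = a s * q z s" for s
    by (simp add: E_def b_def exp_minus field_simps)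
  have qa: "integrable lborel (cutoff 0 t (\<lambda>s. a s * q z s))"
  proof -
    have "integrable lborel (\<lambda>s. cutoff 0 t a s * cutoff 0 R (q z) s)" by (intro L2_mult_integrable L2_cutoff a_L2 q_L2)
    moreover have "(\<lambda>s. cutoff 0 t a s * cutoff 0 R (q z) s) = cutoff 0 t (\<lambda>s. a s * q z s)"
      using t by (auto simp: cutoff_def)
    ultimately show ?thesis by simp
  qed
  define bb where "bb = cutoff 0 t b"
  have bbi: "integrable lborel bb"
  proof -
    have "continuous_on UNIV (\<lambda>s. exp (- \<i> * z * complex_of_real s))" by (intro continuous_intros)
    from L2_mult_integrable[OF L2_cutoff[OF a_L2, of 0 t] L2_mult_continuous[OF this q_L2]]
    show ?thesis
      by (rule Bochner_Integration.integrable_cong[OF refl, THEN iffD1, rotated])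
        (use t in \<open>auto simp: bb_def b_def cutoff_def\<close>)
  qed
  have bbm [measurable]: "bb \<in> borel_measurable borel" using borel_measurable_integrable[OF bbi] by simp
  have pb: "p z \<rho> = 1 - (LINT s|lborel. cutoff 0 \<rho> bb s)" if "\<rho> \<in> {0..t}" for \<rho>
  proof -
    have "\<rho> \<in> {0..R}" using that t by auto
    from p_equation[OF this, of z] show ?thesis
      using that by (simp add: bb_def b_def cutoff_def if_distrib[of "\<lambda>x. x * _"] cong: if_cong)
  qed
  let ?E' = "\<lambda>\<rho>. \<i> * z * E \<rho>"
  have FTC: "(LINT \<rho>|lborel. cutoff s t ?E' \<rho>) = E t - E s" if "s \<le> t" for s
  proof -
    have "(LBINT \<rho>. indicator {s..t} \<rho> *\<^sub>R ?E' \<rho>) = E t - E s"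
    proof (rule integral_FTC_Icc[OF that])
      show "(E has_vector_derivative ?E' \<rho>) (at \<rho> within {s..t})" for \<rho>
        unfolding E_def[abs_def]
        by (rule has_vector_derivative_real_field) (auto intro!: derivative_eq_intros)
      show "continuous_on {s..t} ?E'" by (intro continuous_intros Ec)
    qed
    moreover have "(\<lambda>\<rho>. indicator {s..t} \<rho> *\<^sub>R ?E' \<rho>) = cutoff s t ?E'"
      by (auto simp: cutoff_def indicator_def)
    ultimately show ?thesis by simp
  qed
  let ?K = "\<lambda>(\<rho>, s). cutoff 0 t ?E' \<rho> * cutoff 0 \<rho> bb s"
  have LE': "L2 (cutoff 0 t ?E')"
  proof -
    have "cutoff 0 t ?E' = cutoff 0 t (\<lambda>s. \<i> * z * cutoff 0 R E s)" using t by (auto simp: cutoff_def)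
    then show ?thesis using L2_cutoff[OF L2_cmult[OF LE, of "\<i> * z"]] by simp
  qed
  have iE': "integrable lborel (cutoff 0 t ?E')"
    by (rule L2_supp_integrable[OF LE', of 0 t]) (rule cutoff_eq_zero)
  have icut: "integrable lborel (cutoff 0 \<rho> bb)" for \<rho>
    by (rule Bochner_Integration.integrable_bound[OF bbi]) (auto simp: cutoff_def intro!: AE_I2 borel_measurable_cutoff[unfolded cutoff_def[abs_def]])
  have K: "integrable (lborel \<Otimes>\<^sub>M lborel) ?K"
  proof (rule lborel_pair.Fubini_integrable)
    show "?K \<in> borel_measurable (lborel \<Otimes>\<^sub>M lborel)" by measurable
    show "AE \<rho> in lborel. integrable lborel (\<lambda>s. ?K (\<rho>, s))" using icut by simp
    show "integrable lborel (\<lambda>\<rho>. LINT s|lborel. norm (?K (\<rho>, s)))"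
    proof (rule Bochner_Integration.integrable_bound)
      show "integrable lborel (\<lambda>\<rho>. cmod (cutoff 0 t ?E' \<rho>) * (LINT s|lborel. cmod (bb s)))"
        using integrable_norm[OF iE'] by simp
      show "AE \<rho> in lborel. norm (LINT s|lborel. norm (?K (\<rho>, s))) \<le> norm (cmod (cutoff 0 t ?E' \<rho>) * (LINT s|lborel. cmod (bb s)))"
      proof (rule AE_I2)
        fix \<rho>
        have "(LINT s|lborel. norm (?K (\<rho>, s))) = cmod (cutoff 0 t ?E' \<rho>) * (LINT s|lborel. cmod (cutoff 0 \<rho> bb s))"
          by (simp add: norm_mult)
        moreover have "(LINT s|lborel. cmod (cutoff 0 \<rho> bb s)) \<le> (LINT s|lborel. cmod (bb s))"
          by (rule Bochner_Integration.integral_mono[OF integrable_norm[OF icut] integrable_norm[OF bbi]])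
            (simp add: cutoff_def)
        ultimately show "norm (LINT s|lborel. norm (?K (\<rho>, s))) \<le> norm (cmod (cutoff 0 t ?E' \<rho>) * (LINT s|lborel. cmod (bb s)))"
          by (simp add: mult_left_mono)
      qed
    qed measurable
  qed
  have "(LINT \<rho>|lborel. cutoff 0 t (\<lambda>\<rho>. ?E' \<rho> * p z \<rho>) \<rho>)
      = (LINT \<rho>|lborel. cutoff 0 t ?E' \<rho> - (LINT s|lborel. ?K (\<rho>, s)))"
  proof (rule Bochner_Integration.integral_cong[OF refl])
    fix \<rho>
    show "cutoff 0 t (\<lambda>\<rho>. ?E' \<rho> * p z \<rho>) \<rho> = cutoff 0 t ?E' \<rho> - (LINT s|lborel. ?K (\<rho>, s))"
      using pb[of \<rho>] by (cases "\<rho> \<in> {0..t}") (simp_all add: cutoff_def[of 0 t] right_diff_distrib del: atLeastAtMost_iff)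
  qed
  also have "\<dots> = (LINT \<rho>|lborel. cutoff 0 t ?E' \<rho>) - (LINT \<rho>|lborel. LINT s|lborel. ?K (\<rho>, s))"
    by (rule Bochner_Integration.integral_diff[OF iE']) (use lborel_pair.integrable_fst[of "\<lambda>\<rho> s. ?K (\<rho>, s)"] K in simp)
  also have "(LINT \<rho>|lborel. LINT s|lborel. ?K (\<rho>, s)) = (LINT s|lborel. LINT \<rho>|lborel. ?K (\<rho>, s))"
    using lborel_pair.Fubini_integral[of "\<lambda>\<rho> s. ?K (\<rho>, s)"] K by simp
  \<comment> \<open>In the exchanged order \<open>\<rho>\<close> runs over \<open>{s..t}\<close>, so
    the inner integral of the derivative is \<open>E t - E s\<close>; the part with
    \<open>E s\<close> gives \<open>a * q\<close>.\<close>
  also have "\<dots> = (LINT s|lborel. E t * bb s - cutoff 0 t (\<lambda>s. a s * q z s) s)"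
  proof (rule Bochner_Integration.integral_cong[OF refl])
    fix s
    show "(LINT \<rho>|lborel. ?K (\<rho>, s)) = E t * bb s - cutoff 0 t (\<lambda>s. a s * q z s) s"
    proof (cases "s \<in> {0..t}")
      case True
      have "(LINT \<rho>|lborel. ?K (\<rho>, s)) = (LINT \<rho>|lborel. cutoff s t ?E' \<rho> * bb s)"
        by (rule Bochner_Integration.integral_cong) (use True in \<open>auto simp: cutoff_def\<close>)
      also have "\<dots> = (E t - E s) * bb s" using FTC[of s] True by simp
      also have "\<dots> = E t * bb s - cutoff 0 t (\<lambda>s. a s * q z s) s"
        using True Eb[of s] by (simp add: bb_def cutoff_def algebra_simps)
      finally show ?thesis .
    next
      case False
      then have "(\<lambda>\<rho>. ?K (\<rho>, s)) = (\<lambda>\<rho>. 0)" by (auto simp: bb_def cutoff_def)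
      then show ?thesis using False by (simp add: bb_def cutoff_eq_zero del: atLeastAtMost_iff)
    qed
  qed
  also have "\<dots> = E t * (LINT s|lborel. bb s) - (LINT s|lborel. cutoff 0 t (\<lambda>s. a s * q z s) s)"
    using bbi qa by simp
  finally have 1: "(LINT \<rho>|lborel. cutoff 0 t (\<lambda>\<rho>. ?E' \<rho> * p z \<rho>) \<rho>)
    = E t - 1 - (E t * (LINT s|lborel. bb s) - (LINT s|lborel. cutoff 0 t (\<lambda>s. a s * q z s) s))"
    using FTC[of 0] t by (simp add: E_def)
  have ip: "integrable lborel (cutoff 0 t (\<lambda>\<rho>. ?E' \<rho> * p z \<rho>))"
  proof -
    have "integrable lborel (\<lambda>s. cutoff 0 t ?E' s * cutoff 0 R (p z) s)" by (intro L2_mult_integrable LE' p_L2)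
    moreover have "(\<lambda>s. cutoff 0 t ?E' s * cutoff 0 R (p z) s) = cutoff 0 t (\<lambda>\<rho>. ?E' \<rho> * p z \<rho>)"
      using t by (auto simp: cutoff_def)
    ultimately show ?thesis by simp
  qed
  have "(LINT s|lborel. cutoff 0 t (\<lambda>s. \<i> * z * (E s * p z s) - a s * q z s) s)
    = (LINT s|lborel. cutoff 0 t (\<lambda>\<rho>. ?E' \<rho> * p z \<rho>) s - cutoff 0 t (\<lambda>s. a s * q z s) s)"
    by (rule Bochner_Integration.integral_cong) (auto simp: cutoff_def)
  also have "\<dots> = E t - 1 - E t * (LINT s|lborel. bb s)"
    using ip qa 1 by simp
  also have "\<dots> = E t * p z t - 1"
  proof -
    have "cutoff 0 t bb = bb" by (auto simp: bb_def cutoff_def)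
    then show ?thesis using pb[of t] t by (simp add: right_diff_distrib)
  qed
  finally show ?thesis by (simp add: E_def)
qed

end

section \<open>From Lebesgue data to Borel versions\<close>

lemma AE_lborel_reflect:
  assumes "AE t in lborel. Q (t :: real)" shows "AE t in lborel. Q (x - t)"
proof -
  have "lborel = density (distr lborel borel (\<lambda>t. x + (-1) * t)) (\<lambda>_. ennreal \<bar>-1\<bar>)"
    by (rule lborel_real_affine) simp
  then have eq: "lborel = distr lborel borel (\<lambda>t. x - t)" by (simp add: density_1)
  have "AE t in distr lborel borel (\<lambda>t. x - t). Q t" by (subst eq[symmetric]) (rule assms)
  then show ?thesis by (rule AE_distrD[rotated]) measurable
qed

text \<open>A Lebesgue measurable function agrees almost everywhere with a Borel one. Borel versions
  make two-variable kernels such as \<open>h (x - t)\<close> measurable on the product, as Fubini's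
  theorem requires.\<close>

lemma L2_on_borel_version:
  assumes "L2_on {a..b} F"
  obtains k where "L2 k" "\<And>x. x \<notin> {a..b} \<Longrightarrow> k x = 0" "AE x in lborel. x \<in> {a..b} \<longrightarrow> k x = F x"
proof -
  define F' where "F' x = (if x \<in> {a..b} then F x else 0)" for x
  have F'm: "F' \<in> borel_measurable lebesgue"
    unfolding F'_def[abs_def] using assms by (intro borel_measurable_if_I) (auto simp: L2_on_def)
  then have "(\<lambda>x. Re (F' x)) \<in> borel_measurable (completion lborel)"
    "(\<lambda>x. Im (F' x)) \<in> borel_measurable (completion lborel)" by measurable
  then obtain u v where u: "u \<in> borel_measurable lborel" "AE x in lborel. Re (F' x) = u x"
    and v: "v \<in> borel_measurable lborel" "AE x in lborel. Im (F' x) = v x"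
    using completion_ex_borel_measurable_real[of "\<lambda>x. Re (F' x)" lborel]
      completion_ex_borel_measurable_real[of "\<lambda>x. Im (F' x)" lborel] by blast
  define k where "k = cutoff a b (\<lambda>x. of_real (u x) + \<i> * of_real (v x))"
  have [measurable]: "u \<in> borel_measurable borel" "v \<in> borel_measurable borel" using u v by auto
  have km [measurable]: "k \<in> borel_measurable borel"
    unfolding k_def by measurable
  have ae: "AE x in lborel. k x = F' x"
    using u(2) v(2) by eventually_elim (auto simp: k_def cutoff_def F'_def complex_eq_iff)
  have "integrable lebesgue (\<lambda>x. if x \<in> {a..b} then (cmod (F x))\<^sup>2 else 0)"
    using assms by (subst Lebesgue_Measure.integrable_restrict_UNIV) (auto simp: L2_on_def)
  moreover have "(\<lambda>x. if x \<in> {a..b} then (cmod (F x))\<^sup>2 else 0) = (\<lambda>x. (cmod (F' x))\<^sup>2)"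
    by (auto simp: F'_def)
  ultimately have "integrable lebesgue (\<lambda>x. (cmod (F' x))\<^sup>2)" by simp
  then have "integrable lebesgue (\<lambda>x. (cmod (k x))\<^sup>2)"
  proof (rule integrable_cong_AE_imp)
    show "(\<lambda>x. (cmod (k x))\<^sup>2) \<in> borel_measurable lebesgue"
      by (rule measurable_completion) measurable
    show "AE x in lebesgue. (cmod (F' x))\<^sup>2 = (cmod (k x))\<^sup>2"
      unfolding AE_completion_iff using ae by eventually_elim simp
  qed
  then have "L2 k" by (simp add: L2_def integrable_completion km)
  moreover have "k x = 0" if "x \<notin> {a..b}" for x using that unfolding k_def by (rule cutoff_eq_zero)
  moreover have "AE x in lborel. x \<in> {a..b} \<longrightarrow> k x = F x"
    using ae by eventually_elim (simp add: F'_def)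
  ultimately show ?thesis using that by blast
qed

lemma integral_lebesgue_on_borel_version:
  assumes km: "k \<in> borel_measurable borel" and ae: "AE x in lborel. x \<in> {a..b} \<longrightarrow> k x = F x"
  shows "(LINT x|lebesgue_on {a..b}. F x) = (LINT x|lborel. cutoff a b k x)"
proof -
  note [measurable] = km
  have cm: "cutoff a b k \<in> borel_measurable lebesgue"
    by (rule measurable_completion) measurable
  have ae': "AE x in lebesgue. cutoff a b k x = (if x \<in> {a..b} then F x else 0)"
    unfolding AE_completion_iff using ae by eventually_elim (simp add: cutoff_def)
  have "(LINT x|lebesgue_on {a..b}. F x) = (LINT x|lebesgue. (if x \<in> {a..b} then F x else 0))"
    by (rule Lebesgue_Measure.integral_restrict_UNIV[symmetric]) simp
  also have "\<dots> = (LINT x|lebesgue. cutoff a b k x)"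
    by (rule integral_cong_AE[OF borel_measurable_AE[OF cm ae'] cm])
      (use ae' in \<open>eventually_elim, simp\<close>)
  also have "\<dots> = (LINT x|lborel. cutoff a b k x)"
    by (rule integral_completion) measurable
  finally show ?thesis .
qed

lemma accelerant_of_imp_krein_kernel:
  assumes acc: "accelerant_of A H" and R: "R > 0"
  obtains c h f where "krein_kernel R c h f" "AE x in lborel. x \<in> {-R..R} \<longrightarrow> h x = H x"
    "AE \<rho> in lborel. \<rho> \<in> {0..R} \<longrightarrow> cnj (A \<rho>) = h \<rho> - conv h (f \<rho>) \<rho>"
    "\<And>g. L2 g \<Longrightarrow> (\<And>x. x \<notin> {0..R} \<Longrightarrow> g x = 0) \<Longrightarrow> \<not> (AE x in lborel. g x = 0) \<Longrightarrow> 0 < qform h g"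
proof -
  have acc1: "accelerant H" using acc by (simp add: accelerant_of_def)
  then have "L2_on {-R..R} H" using R by (simp add: accelerant_def L2_loc_line_def)
  from L2_on_borel_version[OF this] obtain k where k: "L2 k" "\<And>x. x \<notin> {-R..R} \<Longrightarrow> k x = 0"
    "AE x in lborel. x \<in> {-R..R} \<longrightarrow> k x = H x" by metis
  \<comment> \<open>Symmetrizing makes the hermitian symmetry hold at every point; the result still
    equals \<open>H\<close> almost everywhere on the window, because \<open>H\<close> is symmetric
    almost everywhere.\<close>
  define h where "h x = (k x + cnj (k (- x))) / 2" for x
  have km: "L2 (\<lambda>x. k (- x))" using L2_reflect[OF k(1), of 0] by simp
  have h: "L2 h"
    using L2_cmult[OF L2_add[OF k(1) L2_cnj[OF km]], of "1/2"] by (simp add: h_def[abs_def])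
  have hm [measurable]: "h \<in> borel_measurable borel" by (rule L2_measurable[OF h])
  have herm: "h (- x) = cnj (h x)" for x by (simp add: h_def)
  have hs: "h x = 0" if "x \<notin> {-R..R}" for x
  proof -
    have "- x \<notin> {-R..R}" using that by auto
    then show ?thesis using k(2)[OF that] k(2)[of "- x"] by (simp add: h_def)
  qed
  have "AE x in lborel. 0 - x \<in> {-R..R} \<longrightarrow> k (0 - x) = H (0 - x)"
    by (rule AE_lborel_reflect[OF k(3)])
  moreover have "AE x in lborel. H (- x) = cnj (H x)"
    using acc1 by (simp add: accelerant_def AE_completion_iff)
  ultimately have hH: "AE x in lborel. x \<in> {-R..R} \<longrightarrow> h x = H x"
    using k(3) by eventually_elim (auto simp: h_def)
  have convH: "conv_op H \<rho> F x = conv h g x"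
    if "g \<in> borel_measurable borel" "\<And>t. t \<notin> {0..\<rho>} \<Longrightarrow> g t = 0"
      "AE t in lborel. t \<in> {0..\<rho>} \<longrightarrow> g t = F t" "x \<in> {0..\<rho>}" "\<rho> \<le> R" for \<rho> g F x
  proof -
    note [measurable] = that(1)
    have "conv_op H \<rho> F x = (LINT t|lborel. cutoff 0 \<rho> (\<lambda>t. h (x - t) * g t) t)"
      unfolding conv_op_def
    proof (rule integral_lebesgue_on_borel_version)
      show "(\<lambda>t. h (x - t) * g t) \<in> borel_measurable borel" by measurable
      show "AE t in lborel. t \<in> {0..\<rho>} \<longrightarrow> h (x - t) * g t = H (x - t) * F t"
        using AE_lborel_reflect[OF hH, of x] that(3)
      proof eventually_elim
        case (elim t)
        show ?case
        proof
          assume t: "t \<in> {0..\<rho>}"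
          then have "x - t \<in> {-R..R}" using that(4,5) by auto
          with elim t show "h (x - t) * g t = H (x - t) * F t" by simp
        qed
      qed
    qed
    also have "(\<lambda>t. cutoff 0 \<rho> (\<lambda>t. h (x - t) * g t) t) = (\<lambda>t. h (x - t) * g t)"
      using that(2) by (force simp: cutoff_def)
    finally show ?thesis by (simp add: conv_def)
  qed
  have pos: "0 < qform h g"
    if g: "L2 g" "\<And>x. x \<notin> {0..R} \<Longrightarrow> g x = 0" "\<not> (AE x in lborel. g x = 0)" for g
  proof -
    note [measurable] = L2_measurable[OF g(1)]
    have gm: "g \<in> borel_measurable borel" by measurable
    have "L2_on {0..R} g"
      unfolding L2_on_def
    proof
      show "g \<in> borel_measurable (lebesgue_on {0..R})"
        by (intro measurable_restrict_space1 measurable_completion) measurable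
      have "integrable lebesgue (\<lambda>x. (cmod (g x))\<^sup>2)"
        using L2_integrable[OF g(1)] by (subst integrable_completion) measurable
      moreover have "(\<lambda>x. (cmod (g x))\<^sup>2) = (\<lambda>x. if x \<in> {0..R} then (cmod (g x))\<^sup>2 else 0)"
        using g(2) by force
      ultimately have "integrable lebesgue (\<lambda>x. if x \<in> {0..R} then (cmod (g x))\<^sup>2 else 0)" by simp
      then show "integrable (lebesgue_on {0..R}) (\<lambda>x. (cmod (g x))\<^sup>2)"
        by (subst (asm) Lebesgue_Measure.integrable_restrict_UNIV) auto
    qed
    moreover have "\<not> (AE x in lebesgue_on {0..R}. g x = 0)"
    proof
      assume "AE x in lebesgue_on {0..R}. g x = 0"
      then have "AE x in lborel. x \<in> {0..R} \<longrightarrow> g x = 0"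
        by (simp add: AE_restrict_space_iff AE_completion_iff)
      then have "AE x in lborel. g x = 0" by eventually_elim (use g(2) in auto)
      with g(3) show False by simp
    qed
    ultimately have "0 < Re (LINT x|lebesgue_on {0..R}. (g x + conv_op H R g x) * cnj (g x))"
      using acc1 R unfolding accelerant_def by blast
    also have "(LINT x|lebesgue_on {0..R}. (g x + conv_op H R g x) * cnj (g x))
      = (LINT x|lborel. cutoff 0 R (\<lambda>x. (g x + conv h g x) * cnj (g x)) x)"
    proof (rule integral_lebesgue_on_borel_version)
      show "(\<lambda>x. (g x + conv h g x) * cnj (g x)) \<in> borel_measurable borel" by measurable
      show "AE x in lborel. x \<in> {0..R} \<longrightarrow> (g x + conv h g x) * cnj (g x) = (g x + conv_op H R g x) * cnj (g x)"
        using convH[of g R g] gm g(2) by (intro AE_I2) auto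
    qed
    also have "\<dots> = (LINT x|lborel. g x * cnj (g x) + cutoff 0 R (conv h g) x * cnj (g x))"
      by (rule Bochner_Integration.integral_cong) (use g(2) in \<open>auto simp: cutoff_def algebra_simps\<close>)
    also have "\<dots> = ip g g + ip (cutoff 0 R (conv h g)) g"
      unfolding ip_def
      by (rule Bochner_Integration.integral_add) (use R in \<open>intro ip_integrable g conv_L2_cutoff h; simp\<close>)+
    also have "ip (cutoff 0 R (conv h g)) g = ip (conv h g) g"
      unfolding ip_def by (rule Bochner_Integration.integral_cong) (use g(2) in \<open>auto simp: cutoff_def\<close>)
    finally show ?thesis by (simp add: qform_def ip_self)
  qed
  obtain c where c: "c > 0" "\<And>g. L2 g \<Longrightarrow> (\<And>x. x \<notin> {0..R} \<Longrightarrow> g x = 0) \<Longrightarrow> c * nrm2 g \<le> qform h g"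
    using conv_positive_imp_coercive[OF h hs less_imp_le[OF R] herm pos] by blast
  obtain \<Gamma> where \<Gamma>: "\<And>\<rho>. \<rho> > 0 \<Longrightarrow> resolvent_kernel H \<rho> (\<Gamma> \<rho>)"
    and A: "AE \<rho> in lebesgue_on {0..}. cnj (A \<rho>) = H \<rho> - (LINT u|lebesgue_on {0..\<rho>}. H (\<rho> - u) * \<Gamma> \<rho> u 0)"
    using acc unfolding accelerant_of_def by blast
  \<comment> \<open>For \<open>\<rho> <= 0\<close> there is no resolvent kernel; the zero function
    serves as default.\<close>
  have "\<exists>g. L2 g \<and> (\<forall>x. x \<notin> {0..\<rho>} \<longrightarrow> g x = 0) \<and> (\<rho> > 0 \<longrightarrow> (AE t in lborel. t \<in> {0..\<rho>} \<longrightarrow> g t = \<Gamma> \<rho> t 0))" for \<rho>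
  proof (cases "\<rho> > 0")
    case True
    then have "L2_on {0..\<rho>} (\<lambda>t. \<Gamma> \<rho> t 0)" using \<Gamma>[OF True] by (simp add: resolvent_kernel_def)
    from L2_on_borel_version[OF this] show ?thesis by metis
  next
    case False
    then show ?thesis using L2_zero by (intro exI[of _ "\<lambda>x. 0"]) auto
  qed
  then obtain f where f: "\<And>\<rho>. L2 (f \<rho>)" "\<And>\<rho> x. x \<notin> {0..\<rho>} \<Longrightarrow> f \<rho> x = 0"
    "\<And>\<rho>. \<rho> > 0 \<Longrightarrow> AE t in lborel. t \<in> {0..\<rho>} \<longrightarrow> f \<rho> t = \<Gamma> \<rho> t 0" by metis
  have fm: "f \<rho> \<in> borel_measurable borel" for \<rho> by (rule L2_measurable[OF f(1)])
  have feq: "AE t in lborel. t \<in> {0..\<rho>} \<longrightarrow> f \<rho> t + conv h (f \<rho>) t = h t" if \<rho>: "\<rho> \<in> {0..R}" for \<rho>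
  proof (cases "\<rho> > 0")
    case True
    have "AE t in lebesgue_on {0..\<rho>}. \<Gamma> \<rho> t 0 + conv_op H \<rho> (\<lambda>u. \<Gamma> \<rho> u 0) t = H (t - 0)"
      using \<Gamma>[OF True] True unfolding resolvent_kernel_def by (metis atLeastAtMost_iff order_refl less_imp_le)
    then have "AE t in lborel. t \<in> {0..\<rho>} \<longrightarrow> \<Gamma> \<rho> t 0 + conv_op H \<rho> (\<lambda>u. \<Gamma> \<rho> u 0) t = H t"
      by (simp add: AE_restrict_space_iff AE_completion_iff)
    then show ?thesis using hH f(3)[OF True]
    proof eventually_elim
      case (elim t)
      show ?case
      proof
        assume t: "t \<in> {0..\<rho>}"
        then have "t \<in> {-R..R}" using \<rho> by auto
        moreover have "conv_op H \<rho> (\<lambda>u. \<Gamma> \<rho> u 0) t = conv h (f \<rho>) t"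
          using \<rho> by (intro convH[OF fm _ f(3)[OF True] t]) (auto intro: f(2))
        ultimately show "f \<rho> t + conv h (f \<rho>) t = h t" using elim t by simp
      qed
    qed
  next
    case False
    \<comment> \<open>Here the equation is demanded on a single point, a null set, so the default
      value satisfies it.\<close>
    then have z: "\<rho> = 0" using \<rho> by simp
    have "AE t in lborel. t \<noteq> (0::real)" by (rule AE_lborel_singleton)
    then show ?thesis by eventually_elim (simp add: z)
  qed
  have "krein_kernel R c h f"
    by unfold_locales (fact R h hs herm c | rule f(1) | erule feq | erule f(2))+
  moreover have "AE \<rho> in lborel. \<rho> \<in> {0..R} \<longrightarrow> cnj (A \<rho>) = h \<rho> - conv h (f \<rho>) \<rho>"
  proof -
    have "AE \<rho> in lborel. \<rho> \<in> {0..} \<longrightarrow> cnj (A \<rho>) = H \<rho> - (LINT u|lebesgue_on {0..\<rho>}. H (\<rho> - u) * \<Gamma> \<rho> u 0)"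
      using A by (simp add: AE_restrict_space_iff AE_completion_iff)
    moreover have "AE \<rho> in lborel. \<rho> \<noteq> (0::real)" by (rule AE_lborel_singleton)
    ultimately show ?thesis using hH
    proof eventually_elim
      case (elim \<rho>)
      show ?case
      proof
        assume \<rho>: "\<rho> \<in> {0..R}"
        then have p: "\<rho> > 0" "\<rho> \<in> {-R..R}" "\<rho> \<in> {0..\<rho>}" using elim(2) by auto
        have "conv_op H \<rho> (\<lambda>u. \<Gamma> \<rho> u 0) \<rho> = conv h (f \<rho>) \<rho>"
          using \<rho> by (intro convH[OF fm _ f(3)[OF p(1)] p(3)]) (auto intro: f(2))
        then show "cnj (A \<rho>) = h \<rho> - conv h (f \<rho>) \<rho>"
          using elim \<rho> p by (simp add: conv_op_def)
      qed
    qed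
  qed
  ultimately show ?thesis using that hH pos by blast
qed

text \<open>The given solution and the pair built from the resolvent satisfy the same Volterra
  system, since \<open>a\<close> equals \<open>cnj A\<close> almost everywhere on the window;
  \<open>volterra_unique\<close> is applied to their difference.\<close>

lemma (in krein_kernel) krein_solution_eq:
  assumes sol: "krein_solution A P Ps"
    and A: "AE \<rho> in lborel. \<rho> \<in> {0..R} \<longrightarrow> cnj (A \<rho>) = h \<rho> - conv h (f \<rho>) \<rho>"
  shows "P R z = exp (\<i> * z * of_real R) * p z R"
proof -
  have aA: "AE \<rho> in lborel. \<rho> \<in> {0..R} \<longrightarrow> a \<rho> = cnj (A \<rho>)"
    using A by eventually_elim (auto simp: a_def cutoff_def y_eq)
  \<comment> \<open>The solutions are continuous only on the half-line; cutting them off makes them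
    Borel on the whole line.\<close>
  define U' where "U' = cutoff 0 R (\<lambda>t. P t z)"
  define V' where "V' = cutoff 0 R (\<lambda>t. Ps t z)"
  have cont: "continuous_on {0..} (\<lambda>t. P t z)" "continuous_on {0..} (\<lambda>t. Ps t z)"
    using sol by (auto simp: krein_solution_def)
  have cutL2: "L2 (cutoff 0 R g)" if "continuous_on {0..} g" for g
  proof -
    have c: "continuous_on {0..R} g" by (rule continuous_on_subset[OF that]) auto
    have "(\<lambda>x. indicator {0..R} x *\<^sub>R g x) \<in> borel_measurable borel"
      using c by (intro borel_measurable_continuous_on_indicator) auto
    moreover have "(\<lambda>x. indicator {0..R} x *\<^sub>R g x) = cutoff 0 R g" by (auto simp: cutoff_def)
    ultimately have m: "cutoff 0 R g \<in> borel_measurable borel" by simp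
    have "compact (g ` {0..R})" using c by (rule compact_continuous_image) simp
    then obtain m where "\<And>x. x \<in> {0..R} \<Longrightarrow> cmod (g x) \<le> m"
      by (metis bounded_iff compact_imp_bounded imageI)
    then have "L2 (cutoff 0 R (cutoff 0 R g))"
      by (intro L2_cutoff_bounded[OF m, of 0 R m]) (simp add: cutoff_def)
    moreover have "cutoff 0 R (cutoff 0 R g) = cutoff 0 R g" by (auto simp: cutoff_def)
    ultimately show ?thesis by simp
  qed
  have LU: "L2 U'" and LV: "L2 V'" unfolding U'_def V'_def by (intro cutL2 cont)+
  note [measurable] = LU[THEN L2_measurable] LV[THEN L2_measurable]
  let ?E = "\<lambda>t. exp (\<i> * z * of_real t) * p z t"
  have LE: "L2 (cutoff 0 R ?E)"
    by (intro L2_mult_continuous p_L2 continuous_intros)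
  let ?U = "\<lambda>t. U' t - ?E t" and ?V = "\<lambda>t. V' t - q z t"
  have i1: "integrable lborel (cutoff 0 t (\<lambda>s. \<i> * z * U' s - a s * V' s))"
    "integrable lborel (cutoff 0 t (\<lambda>s. \<i> * z * ?E s - a s * q z s))"
    "integrable lborel (cutoff 0 t (\<lambda>s. - cnj (a s) * U' s))"
    "integrable lborel (cutoff 0 t (\<lambda>s. - cnj (a s) * ?E s))" if "t \<in> {0..R}" for t
  proof -
    have one: "L2 (cutoff 0 t (\<lambda>x. \<i> * z))" by (rule L2_cutoff_bounded[of _ _ _ "cmod z"]) (auto simp: norm_mult)
    have ca: "L2 (cutoff 0 t a)" by (rule L2_cutoff[OF a_L2])
    have *: "integrable lborel (\<lambda>s. cutoff 0 t (\<lambda>x. \<i> * z) s * cutoff 0 R u s - cutoff 0 t a s * cutoff 0 R v s)"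
      "integrable lborel (\<lambda>s. - (cnj (cutoff 0 t a s) * cutoff 0 R u s))"
      if "L2 (cutoff 0 R u)" "L2 (cutoff 0 R v)" for u v
      by (intro Bochner_Integration.integrable_diff Bochner_Integration.integrable_minus L2_mult_integrable L2_cnj one ca that)+
    have **: "(\<lambda>s. cutoff 0 t (\<lambda>x. \<i> * z) s * cutoff 0 R u s - cutoff 0 t a s * cutoff 0 R v s)
        = cutoff 0 t (\<lambda>s. \<i> * z * u s - a s * v s)"
      "(\<lambda>s. - (cnj (cutoff 0 t a s) * cutoff 0 R u s)) = cutoff 0 t (\<lambda>s. - cnj (a s) * u s)" for u v
      using that by (auto simp: cutoff_def)
    have L': "L2 (cutoff 0 R U')" "L2 (cutoff 0 R V')" using L2_cutoff LU LV by auto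
    show "integrable lborel (cutoff 0 t (\<lambda>s. \<i> * z * U' s - a s * V' s))"
      "integrable lborel (cutoff 0 t (\<lambda>s. - cnj (a s) * U' s))"
      using *[OF L'] unfolding ** by auto
    show "integrable lborel (cutoff 0 t (\<lambda>s. \<i> * z * ?E s - a s * q z s))"
      "integrable lborel (cutoff 0 t (\<lambda>s. - cnj (a s) * ?E s))"
      using *[OF LE q_L2[of z]] unfolding ** by auto
  qed
  have RR: "R \<in> {0..R}" using R by simp
  have "?U R = 0"
  proof (rule volterra_unique[of ?U ?V z R])
    show "L2 (cutoff 0 R ?U)"
    proof -
      have "cutoff 0 R ?U = (\<lambda>t. cutoff 0 R U' t - cutoff 0 R ?E t)" by (auto simp: cutoff_def)
      then show ?thesis using L2_diff[OF L2_cutoff[OF LU, of 0 R] LE] by simp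
    qed
    show "L2 (cutoff 0 R ?V)"
    proof -
      have "cutoff 0 R ?V = (\<lambda>t. cutoff 0 R V' t - cutoff 0 R (q z) t)" by (auto simp: cutoff_def)
      then show ?thesis using L2_diff[OF L2_cutoff[OF LV, of 0 R] q_L2] by simp
    qed
    fix t assume t: "t \<in> {0..R}"
    have ae: "AE s in lborel. s \<in> {0..t} \<longrightarrow> a s = cnj (A s)" using aA by eventually_elim (use t in auto)
    have "P t z = 1 + (LINT s|lebesgue_on {0..t}. \<i> * z * P s z - cnj (A s) * Ps s z)"
      using sol t by (auto simp: krein_solution_def)
    also have "(LINT s|lebesgue_on {0..t}. \<i> * z * P s z - cnj (A s) * Ps s z)
      = (LINT s|lborel. cutoff 0 t (\<lambda>s. \<i> * z * U' s - a s * V' s) s)"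
    proof (rule integral_lebesgue_on_borel_version)
      show "AE s in lborel. s \<in> {0..t} \<longrightarrow> \<i> * z * U' s - a s * V' s = \<i> * z * P s z - cnj (A s) * Ps s z"
        using ae by eventually_elim (use t in \<open>auto simp: U'_def V'_def cutoff_def\<close>)
    qed measurable
    finally have "?U t = (LINT s|lborel. cutoff 0 t (\<lambda>s. \<i> * z * U' s - a s * V' s) s)
        - (LINT s|lborel. cutoff 0 t (\<lambda>s. \<i> * z * ?E s - a s * q z s) s)"
      using exp_p_equation[OF t, of z] t by (simp add: U'_def cutoff_def)
    also have "\<dots> = (LINT s|lborel. cutoff 0 t (\<lambda>s. \<i> * z * U' s - a s * V' s) s
        - cutoff 0 t (\<lambda>s. \<i> * z * ?E s - a s * q z s) s)"
      by (rule Bochner_Integration.integral_diff[symmetric, OF i1(1,2)[OF t]])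
    also have "\<dots> = (LINT s|lborel. cutoff 0 t (\<lambda>s. \<i> * z * ?U s - a s * ?V s) s)"
      by (rule Bochner_Integration.integral_cong) (auto simp: cutoff_def algebra_simps)
    finally show "?U t = (LINT s|lborel. cutoff 0 t (\<lambda>s. \<i> * z * ?U s - a s * ?V s) s)" .
    have "Ps t z = 1 + (LINT s|lebesgue_on {0..t}. - A s * P s z)"
      using sol t by (auto simp: krein_solution_def)
    also have "(LINT s|lebesgue_on {0..t}. - A s * P s z) = (LINT s|lborel. cutoff 0 t (\<lambda>s. - cnj (a s) * U' s) s)"
    proof (rule integral_lebesgue_on_borel_version)
      show "AE s in lborel. s \<in> {0..t} \<longrightarrow> - cnj (a s) * U' s = - A s * P s z"
        using ae by eventually_elim (use t in \<open>auto simp: U'_def cutoff_def\<close>)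
    qed measurable
    finally have Vt: "?V t = 1 + (LINT s|lborel. cutoff 0 t (\<lambda>s. - cnj (a s) * U' s) s) - q z t"
      using t by (simp add: V'_def cutoff_def)
    have "q z t = 1 - (LINT s|lborel. - cutoff 0 t (\<lambda>s. - cnj (a s) * ?E s) s)"
      unfolding q_equation[OF t] by (rule arg_cong[where f = "\<lambda>x. 1 - x"], rule Bochner_Integration.integral_cong)
        (auto simp: cutoff_def)
    then have "?V t = (LINT s|lborel. cutoff 0 t (\<lambda>s. - cnj (a s) * U' s) s)
        - (LINT s|lborel. cutoff 0 t (\<lambda>s. - cnj (a s) * ?E s) s)"
      unfolding Vt by simp
    also have "\<dots> = (LINT s|lborel. cutoff 0 t (\<lambda>s. - cnj (a s) * U' s) s - cutoff 0 t (\<lambda>s. - cnj (a s) * ?E s) s)"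
      by (rule Bochner_Integration.integral_diff[symmetric, OF i1(3,4)[OF t]])
    also have "\<dots> = (LINT s|lborel. cutoff 0 t (\<lambda>s. - cnj (a s) * ?U s) s)"
      by (rule Bochner_Integration.integral_cong) (auto simp: cutoff_def algebra_simps)
    finally show "?V t = (LINT s|lborel. cutoff 0 t (\<lambda>s. - cnj (a s) * ?U s) s)" .
  qed (rule RR)
  then show ?thesis using RR by (simp add: U'_def cutoff_def)
qed

section \<open>The spectral measure\<close>

lemma integral_lebesgue_borel_version:
  fixes k F :: "real \<Rightarrow> complex"
  assumes km: "k \<in> borel_measurable borel" and ae: "AE x in lborel. k x = F x"
  shows "(LINT x|lebesgue. F x) = (LINT x|lborel. k x)"
proof -
  have cm: "k \<in> borel_measurable lebesgue" by (rule measurable_completion) (use km in simp)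
  have ae': "AE x in lebesgue. k x = F x" using ae by (simp add: AE_completion_iff)
  have "(LINT x|lebesgue. F x) = (LINT x|lebesgue. k x)"
    by (rule integral_cong_AE[OF borel_measurable_AE[OF cm ae'] cm]) (use ae' in \<open>eventually_elim, simp\<close>)
  also have "\<dots> = (LINT x|lborel. k x)" by (rule integral_completion) (use km in simp)
  finally show ?thesis .
qed

definition ft :: "(real \<Rightarrow> complex) \<Rightarrow> complex \<Rightarrow> complex" where
  "ft k z = (LINT x|lborel. k x * exp (\<i> * z * of_real x))"

definition tri :: "real \<Rightarrow> real \<Rightarrow> real" where
  "tri e x = max (e - \<bar>x\<bar>) 0"

text \<open>The kernel that writes the oriented integral of \<open>(x - s) * H s\<close> from 0 to
  \<open>x\<close> as one integral over the line for either sign of \<open>x\<close>. The value at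
  \<open>s = 0\<close> is arbitrary, hence the later exclusion of that point.\<close>

definition ramp :: "real \<Rightarrow> real \<Rightarrow> real" where
  "ramp x s = (if s > 0 then max (x - s) 0 else if s < 0 then max (s - x) 0 else 0)"

lemma tri_measurable [measurable]: "tri e \<in> borel_measurable borel"
  unfolding tri_def[abs_def] by measurable

lemma ramp_second_difference:
  "e > 0 \<Longrightarrow> s \<noteq> 0 \<Longrightarrow> ramp (x + e) s + ramp (x - e) s - 2 * ramp x s = tri e (x - s)"
  unfolding ramp_def tri_def max_def abs_real_def by (simp split: if_splits)

lemma abs_second_difference:
  "e > 0 \<Longrightarrow> \<bar>x + e\<bar> / 2 + \<bar>x - e\<bar> / 2 - 2 * (\<bar>x\<bar> / 2) = tri e x"
  unfolding tri_def max_def abs_real_def by (auto simp: field_simps)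

text \<open>The transform of \<open>tri e\<close>; it arises as the second difference of the spectral integrand, just as
  \<open>tri e\<close> is the second difference of \<open>\<bar>x\<bar> / 2\<close>.\<close>

definition fejer :: "real \<Rightarrow> real \<Rightarrow> real" where
  "fejer e l = (if l = 0 then e\<^sup>2 else (2 - 2 * cos (l * e)) / l\<^sup>2)"

text \<open>Second differences in \<open>x\<close> annihilate the constant and the compensator,
  which is linear in \<open>x\<close>; the exponential remains, multiplied by a kernel of quadratic
  decay.\<close>

lemma spectral_integrand_second_difference:
  "spectral_integrand (x + e) l + spectral_integrand (x - e) l - 2 * spectral_integrand x l
    = exp (\<i> * of_real (l * x)) * of_real (fejer e l)"
proof (cases "l = 0")
  case True
  then show ?thesis
    by (simp add: spectral_integrand_def fejer_def power2_eq_square field_simps)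
next
  case False
  have "exp (\<i> * of_real (l * (x + e))) + exp (\<i> * of_real (l * (x - e)))
    = exp (\<i> * of_real (l * x)) * (exp (\<i> * of_real (l * e)) + exp (- (\<i> * of_real (l * e))))"
    by (simp add: exp_add[symmetric] algebra_simps)
  also have "exp (\<i> * of_real (l * e)) + exp (- (\<i> * of_real (l * e))) = of_real (2 * cos (l * e))"
    by (simp add: cos_exp_eq cos_of_real[symmetric] del: cos_of_real)
  finally have e: "exp (\<i> * of_real (l * (x + e))) + exp (\<i> * of_real (l * (x - e)))
    = exp (\<i> * of_real (l * x)) * of_real (2 * cos (l * e))" .
  have lin: "l * (x + e) / (1 + l\<^sup>2) + l * (x - e) / (1 + l\<^sup>2) - 2 * (l * x / (1 + l\<^sup>2)) = 0"
  proof -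
    have "l * (x + e) / (1 + l\<^sup>2) + l * (x - e) / (1 + l\<^sup>2) - 2 * (l * x / (1 + l\<^sup>2))
      = (l * (x + e) + l * (x - e) - 2 * (l * x)) / (1 + l\<^sup>2)"
      by (simp only: add_divide_distrib diff_divide_distrib times_divide_eq_right)
    also have "l * (x + e) + l * (x - e) - 2 * (l * x) = 0" by algebra
    finally show ?thesis by simp
  qed
  have "spectral_integrand (x + e) l + spectral_integrand (x - e) l - 2 * spectral_integrand x l
    = (\<i> * of_real (l * (x + e) / (1 + l\<^sup>2) + l * (x - e) / (1 + l\<^sup>2) - 2 * (l * x / (1 + l\<^sup>2)))
       - (exp (\<i> * of_real (l * (x + e))) + exp (\<i> * of_real (l * (x - e)))) + 2 * exp (\<i> * of_real (l * x))) / of_real (l\<^sup>2)"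
    using False unfolding spectral_integrand_def
    by (simp only: if_False of_real_add of_real_diff of_real_mult[of 2]) (simp add: add_divide_distrib diff_divide_distrib algebra_simps)
  also have "\<dots> = exp (\<i> * of_real (l * x)) * of_real (fejer e l)"
    unfolding lin e using False by (simp add: fejer_def algebra_simps)
  finally show ?thesis .
qed

text \<open>For \<open>|l| >= 1\<close> the numerator is at most \<open>2 + |x|\<close>. For small
  \<open>l\<close> the second order Taylor estimate applies, because the compensator differs from
  \<open>\<i> * l * x\<close> by at most \<open>|x| * l^2\<close>.\<close>

lemma norm_spectral_integrand_le:
  "cmod (spectral_integrand x l) \<le> (4 + 2 * \<bar>x\<bar> + 2 * x\<^sup>2) * (1 / (1 + l\<^sup>2))"
proof -
  have p: "1 + l\<^sup>2 > 0" by (simp add: add_pos_nonneg)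
  define N where "N = cmod (1 + \<i> * of_real (l * x / (1 + l\<^sup>2)) - exp (\<i> * of_real (l * x)))"
  have ne: "cmod (exp (\<i> * of_real (l * x))) = 1" by simp
  have lin: "\<bar>l * x / (1 + l\<^sup>2)\<bar> \<le> \<bar>x\<bar>"
  proof -
    have "\<bar>l\<bar> \<le> 1 + l\<^sup>2" using sum_squares_bound[of "\<bar>l\<bar>" 1] by simp
    then have "\<bar>l\<bar> * \<bar>x\<bar> \<le> (1 + l\<^sup>2) * \<bar>x\<bar>" by (rule mult_right_mono) simp
    then show ?thesis using p by (simp add: abs_mult field_simps)
  qed
  show ?thesis
  proof (cases "l = 0")
    case True
    then have "cmod (spectral_integrand x l) = x\<^sup>2 / 2"
      unfolding spectral_integrand_def by (simp only: if_True norm_of_real) (simp add: norm_power)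
    also have "\<dots> \<le> 4 + 2 * \<bar>x\<bar> + 2 * x\<^sup>2" using zero_le_power2[of x] abs_ge_zero[of x] by linarith
    finally show ?thesis using True by simp
  next
    case False
    then have l2: "l\<^sup>2 > 0" by simp
    have eq: "cmod (spectral_integrand x l) = N / l\<^sup>2"
      using False by (simp add: spectral_integrand_def N_def norm_divide norm_power)
    show ?thesis
    proof (cases "l\<^sup>2 \<ge> 1")
      case True
      have "N \<le> cmod 1 + cmod (\<i> * of_real (l * x / (1 + l\<^sup>2))) + cmod (exp (\<i> * of_real (l * x)))"
        unfolding N_def by (rule order_trans[OF norm_triangle_ineq4 add_right_mono[OF norm_triangle_ineq]])
      also have "\<dots> = 2 + \<bar>l * x / (1 + l\<^sup>2)\<bar>" unfolding norm_mult ne norm_of_real by simp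
      finally have N: "N \<le> 2 + \<bar>x\<bar>" using lin by linarith
      have "N / l\<^sup>2 \<le> (2 + \<bar>x\<bar>) / l\<^sup>2" using N l2 by (intro divide_right_mono) auto
      also have "\<dots> \<le> (2 + \<bar>x\<bar>) * (2 / (1 + l\<^sup>2))"
      proof -
        have "1 / l\<^sup>2 \<le> 2 / (1 + l\<^sup>2)" using True l2 p by (simp add: field_simps)
        then have "(2 + \<bar>x\<bar>) * (1 / l\<^sup>2) \<le> (2 + \<bar>x\<bar>) * (2 / (1 + l\<^sup>2))" by (intro mult_left_mono) auto
        then show ?thesis by simp
      qed
      also have "\<dots> \<le> (4 + 2 * \<bar>x\<bar> + 2 * x\<^sup>2) * (1 / (1 + l\<^sup>2))"
        using p by (simp add: field_simps)
      finally show ?thesis unfolding eq .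
    next
      case False
      let ?z = "\<i> * complex_of_real (l * x)"
      have "cmod (exp ?z - (\<Sum>k\<le>1. ?z ^ k / fact k)) \<le> exp \<bar>Re ?z\<bar> * cmod ?z ^ Suc 1 / fact 1"
        by (rule Taylor_exp)
      then have t: "cmod (exp ?z - (1 + ?z)) \<le> (l * x)\<^sup>2"
        by (simp add: norm_mult power2_eq_square abs_mult)
      have d: "l * x - l * x / (1 + l\<^sup>2) = l * x * l\<^sup>2 / (1 + l\<^sup>2)"
        using p by (simp add: field_simps)
      have dl: "\<bar>l * x * l\<^sup>2 / (1 + l\<^sup>2)\<bar> \<le> \<bar>x\<bar> * l\<^sup>2"
        using mult_right_mono[OF lin, of "l\<^sup>2"] by (simp add: abs_mult)
      have "1 + \<i> * of_real (l * x / (1 + l\<^sup>2)) - exp ?z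
        = - (exp ?z - (1 + ?z)) - \<i> * of_real (l * x - l * x / (1 + l\<^sup>2))"
        by (simp add: algebra_simps)
      then have "N \<le> cmod (exp ?z - (1 + ?z)) + cmod (\<i> * of_real (l * x - l * x / (1 + l\<^sup>2)))"
        unfolding N_def by (metis norm_minus_cancel norm_triangle_ineq4)
      also have "\<dots> \<le> (l * x)\<^sup>2 + \<bar>x\<bar> * l\<^sup>2"
        using t dl unfolding d norm_mult norm_of_real by simp
      also have "\<dots> = (x\<^sup>2 + \<bar>x\<bar>) * l\<^sup>2" by (simp add: power_mult_distrib algebra_simps)
      finally have N: "N / l\<^sup>2 \<le> x\<^sup>2 + \<bar>x\<bar>" using l2 by (simp add: pos_divide_le_eq)
      also have "\<dots> \<le> (x\<^sup>2 + \<bar>x\<bar>) * (2 / (1 + l\<^sup>2))"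
      proof -
        have "1 \<le> 2 / (1 + l\<^sup>2)" using False p by (simp add: pos_le_divide_eq)
        then have "(x\<^sup>2 + \<bar>x\<bar>) * 1 \<le> (x\<^sup>2 + \<bar>x\<bar>) * (2 / (1 + l\<^sup>2))" by (intro mult_left_mono) auto
        then show ?thesis by simp
      qed
      also have "\<dots> \<le> (4 + 2 * \<bar>x\<bar> + 2 * x\<^sup>2) * (1 / (1 + l\<^sup>2))"
        using p by (simp add: field_simps)
      finally show ?thesis unfolding eq .
    qed
  qed
qed

lemma integral_tri: "(LINT u|lborel. tri 1 u) = 1"
proof -
  have 1: "(LBINT u. indicator {-1..0} u *\<^sub>R (1 + u)) = (\<lambda>u. u + u\<^sup>2 / 2) 0 - (\<lambda>u. u + u\<^sup>2 / 2) (-1 :: real)"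
    by (rule integral_FTC_Icc)
      (auto intro!: derivative_eq_intros continuous_intros simp flip: has_real_derivative_iff_has_vector_derivative)
  have 2: "(LBINT u. indicator {0..1} u *\<^sub>R (1 - u)) = (\<lambda>u. u - u\<^sup>2 / 2) 1 - (\<lambda>u. u - u\<^sup>2 / 2) (0 :: real)"
    by (rule integral_FTC_Icc)
      (auto intro!: derivative_eq_intros continuous_intros simp flip: has_real_derivative_iff_has_vector_derivative)
  have i: "integrable lborel (\<lambda>u. indicator {-1..0} u *\<^sub>R (1 + u :: real))"
    "integrable lborel (\<lambda>u. indicator {0..1} u *\<^sub>R (1 - u :: real))"
    by (intro borel_integrable_compact; auto intro!: continuous_intros)+
  have "(LINT u|lborel. tri 1 u)
    = (LINT u|lborel. indicator {-1..0} u *\<^sub>R (1 + u) + indicator {0..1} u *\<^sub>R (1 - u))"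
  proof (rule integral_cong_AE)
    have "AE u in lborel. u \<noteq> (0::real)" by (rule AE_lborel_singleton)
    then show "AE u in lborel. tri 1 u = indicator {-1..0} u *\<^sub>R (1 + u) + indicator {0..1} u *\<^sub>R (1 - u)"
      by eventually_elim (auto simp: tri_def indicator_def)
  qed measurable
  also have "\<dots> = 1" using i 1 2 by simp
  finally show ?thesis .
qed

lemma tri_scale: "e > 0 \<Longrightarrow> tri e (e * u) = e * tri 1 u"
proof -
  assume "e > 0"
  then have "tri e (e * u) = max (e * (1 - \<bar>u\<bar>)) (e * 0)" by (simp add: tri_def abs_mult algebra_simps)
  also have "\<dots> = e * tri 1 u" using \<open>e > 0\<close> unfolding tri_def by (subst max_mult_distrib_left) auto
  finally show ?thesis .
qed

section \<open>Pairing functions with the spectral measure\<close>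

locale spectral_data =
  fixes H :: "real \<Rightarrow> complex" and \<sigma> :: "real measure" and \<beta> :: real
  assumes sets_\<sigma>: "sets \<sigma> = sets borel"
    and int_\<sigma>: "integrable \<sigma> (\<lambda>l. 1 / (1 + l\<^sup>2))"
    and rep: "\<And>x::real. of_real (\<bar>x\<bar> / 2) + (LINT s=ereal 0..ereal x|lebesgue. (of_real (x - s) * H s)) =
          \<i> * of_real (\<beta> * x) + (LINT l|\<sigma>. spectral_integrand x l)"
begin

lemma measurable_\<sigma> [measurable (raw)]: "f \<in> borel_measurable borel \<Longrightarrow> f \<in> borel_measurable \<sigma>"
  using measurable_cong_sets[OF sets_\<sigma> refl] by blast

lemma space_\<sigma> [simp]: "space \<sigma> = UNIV"
  using sets_eq_imp_space_eq[OF sets_\<sigma>] by simp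

lemma integrable_decay:
  assumes "f \<in> borel_measurable borel" "\<And>l. norm (f l) \<le> C * (1 / (1 + l\<^sup>2))"
  shows "integrable \<sigma> (f :: real \<Rightarrow> complex)"
proof (rule Bochner_Integration.integrable_bound)
  show "integrable \<sigma> (\<lambda>l. C * (1 / (1 + l\<^sup>2)))" by (rule integrable_mult_right[OF int_\<sigma>])
  show "f \<in> borel_measurable \<sigma>" using assms(1) by (rule measurable_\<sigma>)
  show "AE l in \<sigma>. norm (f l) \<le> norm (C * (1 / (1 + l\<^sup>2)))"
    by (rule AE_I2) (rule order_trans[OF assms(2)], simp only: real_norm_def abs_ge_self)
qed

text \<open>Integrability of \<open>1 / (1 + l^2)\<close> bounds the measure of every interval
  \<open>{-n..n}\<close>; Fubini's theorem with \<open>\<sigma>\<close> depends on this.\<close>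

lemma sigma_finite: "sigma_finite_measure \<sigma>"
proof
  have f: "emeasure \<sigma> {- real n..real n} \<noteq> \<infinity>" for n
  proof -
    have "integrable \<sigma> (indicat_real {- real n..real n})"
    proof (rule Bochner_Integration.integrable_bound)
      show "integrable \<sigma> (\<lambda>l. (1 + (real n)\<^sup>2) * (1 / (1 + l\<^sup>2)))" by (rule integrable_mult_right[OF int_\<sigma>])
      show "indicat_real {- real n..real n} \<in> borel_measurable \<sigma>" by (rule measurable_\<sigma>) measurable
      show "AE l in \<sigma>. norm (indicat_real {- real n..real n} l) \<le> norm ((1 + (real n)\<^sup>2) * (1 / (1 + l\<^sup>2)))"
      proof (rule AE_I2)
        fix l
        have "l\<^sup>2 \<le> (real n)\<^sup>2" if "l \<in> {- real n..real n}" using that by (intro power2_le_iff_abs_le[THEN iffD2]) auto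
        then show "norm (indicat_real {- real n..real n} l) \<le> norm ((1 + (real n)\<^sup>2) * (1 / (1 + l\<^sup>2)))"
          by (auto simp: indicator_def divide_simps add_pos_nonneg)
      qed
    qed
    then show ?thesis unfolding integrable_indicator_iff by (simp add: less_top)
  qed
  show "\<exists>A. countable A \<and> A \<subseteq> sets \<sigma> \<and> \<Union>A = space \<sigma> \<and> (\<forall>a\<in>A. emeasure \<sigma> a \<noteq> \<infinity>)"
  proof (intro exI conjI ballI)
    show "countable (range (\<lambda>n. {- real n..real n}))" by simp
    show "range (\<lambda>n. {- real n..real n}) \<subseteq> sets \<sigma>" by (auto simp: sets_\<sigma>)
    show "\<Union>(range (\<lambda>n. {- real n..real n})) = space \<sigma>"
    proof -
      have "\<exists>n. x \<in> {- real n..real n}" for x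
        using real_arch_simple[of "\<bar>x\<bar>"] by (auto simp: abs_le_iff) (metis minus_le_iff)
      then show ?thesis by auto
    qed
    show "emeasure \<sigma> a \<noteq> \<infinity>" if "a \<in> range (\<lambda>n. {- real n..real n})" for a using f that by auto
  qed
qed

lemma spectral_integrand_integrable: "integrable \<sigma> (spectral_integrand x)"
proof (rule integrable_decay)
  show "spectral_integrand x \<in> borel_measurable borel"
    unfolding spectral_integrand_def[abs_def] by measurable
  show "cmod (spectral_integrand x l) \<le> (4 + 2 * \<bar>x\<bar> + 2 * x\<^sup>2) * (1 / (1 + l\<^sup>2))" for l
    by (rule norm_spectral_integrand_le)
qed

text \<open>The second difference with step \<open>e\<close> of the defining representation. The
  linear term with \<open>\<beta>\<close> disappears, and only values of \<open>H\<close> on the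
  window enter, since \<open>x\<close> and \<open>x\<close> plus or minus \<open>e\<close> lie in
  it.\<close>

lemma triangle_identity:
  assumes e: "e > 0" and x: "\<bar>x\<bar> + e \<le> M"
    and h: "integrable lborel h" and hH: "AE s in lborel. s \<in> {-M..M} \<longrightarrow> h s = H s"
  shows "of_real (tri e x) + (LINT s|lborel. of_real (tri e (x - s)) * h s)
    = (LINT l|\<sigma>. exp (\<i> * of_real (l * x)) * of_real (fejer e l))"
proof -
  have hm [measurable]: "h \<in> borel_measurable borel" using borel_measurable_integrable[OF h] by simp
  have rm [measurable]: "ramp t \<in> borel_measurable borel" for t
    unfolding ramp_def[abs_def] by measurable
  define hc where "hc = cutoff (-M) M h"
  have hc: "integrable lborel hc"
    by (rule Bochner_Integration.integrable_bound[OF h])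
      (auto simp: hc_def cutoff_def intro!: AE_I2 borel_measurable_cutoff[unfolded cutoff_def[abs_def]])
  have hcm [measurable]: "hc \<in> borel_measurable borel" unfolding hc_def by measurable
  have I: "(LINT s=ereal 0..ereal t|lebesgue. (of_real (t - s) * H s)) = (LINT s|lborel. of_real (ramp t s) * hc s)"
    if "\<bar>t\<bar> \<le> M" for t
  proof -
    have nz: "AE s in lborel. s \<noteq> (0::real)" by (rule AE_lborel_singleton)
    show ?thesis
    proof (cases "0 \<le> t")
      case True
      have "(LINT s=ereal 0..ereal t|lebesgue. (of_real (t - s) * H s))
        = (LINT s|lebesgue. indicator {0<..<t} s *\<^sub>R (of_real (t - s) * H s))"
        using True by (simp add: interval_lebesgue_integral_def set_lebesgue_integral_def)
      also have "\<dots> = (LINT s|lborel. of_real (ramp t s) * hc s)"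
      proof (rule integral_lebesgue_borel_version)
        show "AE s in lborel. of_real (ramp t s) * hc s = indicator {0<..<t} s *\<^sub>R (of_real (t - s) * H s)"
          using nz hH by eventually_elim
            (use True that in \<open>auto simp: ramp_def hc_def cutoff_def indicator_def max_def\<close>)
      qed measurable
      finally show ?thesis .
    next
      case False
      have "(LINT s=ereal 0..ereal t|lebesgue. (of_real (t - s) * H s))
        = - (LINT s|lebesgue. indicator {t<..<0} s *\<^sub>R (of_real (t - s) * H s))"
        using False by (simp add: interval_lebesgue_integral_def set_lebesgue_integral_def)
      also have "\<dots> = (LINT s|lebesgue. - (indicator {t<..<0} s *\<^sub>R (of_real (t - s) * H s)))"
        by simp
      also have "\<dots> = (LINT s|lborel. of_real (ramp t s) * hc s)"
      proof (rule integral_lebesgue_borel_version)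
        show "AE s in lborel. of_real (ramp t s) * hc s = - (indicator {t<..<0} s *\<^sub>R (of_real (t - s) * H s))"
          using nz hH by eventually_elim
            (use False that in \<open>auto simp: ramp_def hc_def cutoff_def indicator_def max_def algebra_simps\<close>)
      qed measurable
      finally show ?thesis .
    qed
  qed
  have ir: "integrable lborel (\<lambda>s. of_real (ramp t s) * hc s)" for t
  proof (rule Bochner_Integration.integrable_bound[OF integrable_mult_right[OF integrable_norm[OF hc], of "\<bar>t\<bar> + M"]])
    show "AE s in lborel. norm (of_real (ramp t s) * hc s) \<le> norm ((\<bar>t\<bar> + M) * norm (hc s))"
    proof (rule AE_I2)
      fix s
      show "norm (of_real (ramp t s) * hc s) \<le> norm ((\<bar>t\<bar> + M) * norm (hc s))"
      proof (cases "s \<in> {-M..M}")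
        case True
        then have "\<bar>ramp t s\<bar> \<le> \<bar>\<bar>t\<bar> + M\<bar>" by (auto simp: ramp_def max_def)
        then show ?thesis by (simp add: norm_mult abs_mult mult_right_mono)
      next
        case False then show ?thesis by (simp add: hc_def cutoff_eq_zero del: atLeastAtMost_iff)
      qed
    qed
  qed measurable
  define \<Phi> where "\<Phi> t = of_real (\<bar>t\<bar> / 2) + (LINT s|lborel. of_real (ramp t s) * hc s)" for t
  have \<Phi>: "\<Phi> t = \<i> * of_real (\<beta> * t) + (LINT l|\<sigma>. spectral_integrand t l)" if "\<bar>t\<bar> \<le> M" for t
    using rep[of t] I[OF that] by (simp add: \<Phi>_def)
  \<comment> \<open>The triangle around \<open>x\<close> lies inside \<open>{-M..M}\<close>, so the
    cut-off does not affect the product.\<close>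
  have tc: "of_real (tri e (x - s)) * hc s = of_real (tri e (x - s)) * h s" for s
    using x e by (auto simp: hc_def cutoff_def tri_def max_def)
  have "\<Phi> (x + e) + \<Phi> (x - e) - 2 * \<Phi> x
    = of_real (\<bar>x + e\<bar> / 2 + \<bar>x - e\<bar> / 2 - 2 * (\<bar>x\<bar> / 2))
      + ((LINT s|lborel. of_real (ramp (x + e) s) * hc s) + (LINT s|lborel. of_real (ramp (x - e) s) * hc s)
         - (LINT s|lborel. 2 * (of_real (ramp x s) * hc s)))"
    by (simp add: \<Phi>_def)
  also have "(LINT s|lborel. of_real (ramp (x + e) s) * hc s) + (LINT s|lborel. of_real (ramp (x - e) s) * hc s)
         - (LINT s|lborel. 2 * (of_real (ramp x s) * hc s))
      = (LINT s|lborel. of_real (ramp (x + e) s) * hc s + of_real (ramp (x - e) s) * hc s - 2 * (of_real (ramp x s) * hc s))"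
    using ir by simp
  also have "\<dots> = (LINT s|lborel. of_real (tri e (x - s)) * h s)"
  proof (rule integral_cong_AE)
    have "AE s in lborel. s \<noteq> (0::real)" by (rule AE_lborel_singleton)
    then show "AE s in lborel. of_real (ramp (x + e) s) * hc s + of_real (ramp (x - e) s) * hc s - 2 * (of_real (ramp x s) * hc s)
      = of_real (tri e (x - s)) * h s"
    proof eventually_elim
      case (elim s)
      have "of_real (ramp (x + e) s) * hc s + of_real (ramp (x - e) s) * hc s - 2 * (of_real (ramp x s) * hc s)
        = of_real (ramp (x + e) s + ramp (x - e) s - 2 * ramp x s) * hc s" by (simp add: algebra_simps)
      also have "\<dots> = of_real (tri e (x - s)) * h s" unfolding ramp_second_difference[OF e elim] by (rule tc)
      finally show ?case .
    qed
  qed measurable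
  also have "\<bar>x + e\<bar> / 2 + \<bar>x - e\<bar> / 2 - 2 * (\<bar>x\<bar> / 2) = tri e x" by (rule abs_second_difference[OF e])
  finally have L: "\<Phi> (x + e) + \<Phi> (x - e) - 2 * \<Phi> x
    = of_real (tri e x) + (LINT s|lborel. of_real (tri e (x - s)) * h s)" .
  have "\<Phi> (x + e) + \<Phi> (x - e) - 2 * \<Phi> x
    = (LINT l|\<sigma>. spectral_integrand (x + e) l) + (LINT l|\<sigma>. spectral_integrand (x - e) l) - 2 * (LINT l|\<sigma>. spectral_integrand x l)"
    using x e by (subst (1 2 3) \<Phi>) (auto simp: algebra_simps)
  also have "\<dots> = (LINT l|\<sigma>. spectral_integrand (x + e) l + spectral_integrand (x - e) l - 2 * spectral_integrand x l)"
    using spectral_integrand_integrable by simp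
  finally show ?thesis unfolding L spectral_integrand_second_difference .
qed


lemma fejer_bound: assumes "e > 0" shows "\<bar>fejer e l / e\<^sup>2\<bar> \<le> 1"
  and fejer_sin: "l \<noteq> 0 \<Longrightarrow> fejer e l / e\<^sup>2 = (sin (l * e / 2) / (l * e / 2))\<^sup>2"
proof -
  have s: "fejer e l / e\<^sup>2 = (sin (l * e / 2) / (l * e / 2))\<^sup>2" if "l \<noteq> 0"
  proof -
    have "2 - 2 * cos (l * e) = 4 * (sin (l * e / 2))\<^sup>2"
      using cos_double_sin[of "l * e / 2"] by simp
    then show ?thesis using that assms by (simp add: fejer_def power_divide power_mult_distrib field_simps)
  qed
  then show "l \<noteq> 0 \<Longrightarrow> fejer e l / e\<^sup>2 = (sin (l * e / 2) / (l * e / 2))\<^sup>2" .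
  show "\<bar>fejer e l / e\<^sup>2\<bar> \<le> 1"
  proof (cases "l = 0")
    case True then show ?thesis using assms by (simp add: fejer_def)
  next
    case False
    have "\<bar>sin (l * e / 2) / (l * e / 2)\<bar> \<le> 1"
      using abs_sin_x_le_abs_x[of "l * e / 2"] False assms by (simp add: abs_mult)
    then show ?thesis unfolding s[OF False] by (simp add: abs_square_le_1)
  qed
qed

lemma fejer_limit:
  assumes "\<And>n. x n > 0" "x \<longlonglongrightarrow> 0" shows "(\<lambda>n. fejer (x n) l / (x n)\<^sup>2) \<longlonglongrightarrow> 1"
proof (cases "l = 0")
  case True
  have "fejer (x n) l / (x n)\<^sup>2 = 1" for n using True assms(1)[of n] by (simp add: fejer_def)
  then have "(\<lambda>n. fejer (x n) l / (x n)\<^sup>2) = (\<lambda>n. 1)" by (rule ext)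
  then show ?thesis by (simp only: tendsto_const)
next
  case False
  have "((\<lambda>t. (sin (0 + t) - sin 0) / t) \<longlongrightarrow> cos 0) (at (0::real))"
    using DERIV_sin[of "0::real"] unfolding DERIV_def .
  then have l: "((\<lambda>t. sin t / t) \<longlongrightarrow> 1) (at (0::real))" by simp
  have "(\<lambda>n. l * x n / 2) \<longlonglongrightarrow> l * 0 / 2" by (intro tendsto_intros assms) auto
  then have "filterlim (\<lambda>n. l * x n / 2) (at 0) sequentially"
    using False assms(1) by (auto simp: filterlim_at less_imp_neq[THEN not_sym])
  from filterlim_compose[OF l this] have "(\<lambda>n. sin (l * x n / 2) / (l * x n / 2)) \<longlonglongrightarrow> 1" .
  from tendsto_power[OF this, of 2] show ?thesis
    using fejer_sin[OF assms(1) False] by simp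
qed

text \<open>Integrate \<open>triangle_identity\<close> against \<open>k\<close>. Since
  \<open>fejer e\<close> itself is integrable against \<open>\<sigma>\<close>, Fubini's theorem
  applies with no decay of \<open>ft k\<close>; the price is that \<open>k\<close> is replaced by
  its average \<open>ka\<close> over a triangle.\<close>

lemma spectral_pairing_mollified:
  assumes h: "L2 h" "\<And>x. x \<notin> {-M..M} \<Longrightarrow> h x = 0"
    and hH: "AE s in lborel. s \<in> {-M..M} \<longrightarrow> h s = H s"
    and kc: "continuous_on UNIV k" and ks: "\<And>x. x \<notin> {-R..R} \<Longrightarrow> k x = 0"
    and e: "e > 0" "R + e \<le> M"
  defines "ka t \<equiv> (LINT u|lborel. of_real (tri 1 u) * k (t + e * u))"
  shows "ka 0 + (LINT s|lborel. ka s * h s) = (LINT l|\<sigma>. of_real (fejer e l / e\<^sup>2) * ft k (of_real l))"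
proof -
  interpret s: sigma_finite_measure \<sigma> by (rule sigma_finite)
  interpret p: pair_sigma_finite lborel \<sigma> ..
  have km [measurable]: "k \<in> borel_measurable borel" using kc by (rule borel_measurable_continuous_onI)
  have "L2 (cutoff (-R) R k)" by (rule L2_cutoff_continuous[OF kc])
  moreover have "cutoff (-R) R k = k" using ks by (force simp: cutoff_def)
  ultimately have kL: "L2 k" by simp
  have ki: "integrable lborel k" by (rule L2_supp_integrable[OF kL]) (rule ks)
  have hi: "integrable lborel h" by (rule L2_supp_integrable[OF h(1)]) (rule h(2))
  define T where "T x = complex_of_real (tri e x)" for x
  have Tm [measurable]: "T \<in> borel_measurable borel" unfolding T_def[abs_def] by measurable
  have TL: "L2 T"
  proof -
    have "L2 (cutoff (-e) e T)"
      by (rule L2_cutoff_bounded[of _ _ _ e]) (use e in \<open>auto simp: T_def tri_def\<close>)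
    moreover have "cutoff (-e) e T = T"
      by (rule ext) (use e in \<open>auto simp: cutoff_def T_def tri_def max_def\<close>)
    ultimately show ?thesis by simp
  qed
  \<comment> \<open>The substitution \<open>x = t + e * u\<close> yields one factor \<open>e\<close>
    from the measure and one from the height of the triangle.\<close>
  have ke: "(LINT x|lborel. T (x - t) * k x) = e\<^sup>2 * ka t" for t
  proof -
    have "(LINT x|lborel. T (x - t) * k x) = \<bar>e\<bar> *\<^sub>R (LINT u|lborel. T (t + e * u - t) * k (t + e * u))"
      by (rule lborel_integral_real_affine) (use e in simp)
    also have "(\<lambda>u. T (t + e * u - t) * k (t + e * u)) = (\<lambda>u. e * (of_real (tri 1 u) * k (t + e * u)))"
      using e by (simp add: T_def tri_scale mult.assoc)
    finally show ?thesis using e by (simp add: ka_def scaleR_conv_of_real power2_eq_square)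
  qed
  let ?r = "\<lambda>x. LINT l|\<sigma>. exp (\<i> * of_real (l * x)) * of_real (fejer e l)"
  have fi: "integrable \<sigma> (\<lambda>l. exp (\<i> * of_real (l * x)) * of_real (fejer e l))" for x
    unfolding spectral_integrand_second_difference[symmetric]
    by (intro Bochner_Integration.integrable_diff Bochner_Integration.integrable_add integrable_mult_right
        spectral_integrand_integrable)
  have fabs: "integrable \<sigma> (\<lambda>l. \<bar>fejer e l\<bar>)"
    using integrable_norm[OF fi[of 0]] by simp
  have id: "T x * k x + conv T h x * k x = ?r x * k x" for x
  proof (cases "x \<in> {-R..R}")
    case True
    then have "\<bar>x\<bar> + e \<le> M" using e by auto
    from triangle_identity[OF e(1) this hi hH] show ?thesis
      by (simp add: T_def conv_def flip: distrib_right)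
  next
    case False then show ?thesis using ks by simp
  qed
  have i1: "integrable lborel (\<lambda>x. T x * k x)" by (rule L2_mult_integrable[OF TL kL])
  have i2: "integrable lborel (\<lambda>x. conv T h x * k x)"
  proof (rule Bochner_Integration.integrable_bound[OF integrable_mult_right[OF integrable_norm[OF ki], of "sqrt (nrm2 T * nrm2 h)"]])
    note [measurable] = h(1)[THEN L2_measurable]
    show "(\<lambda>x. conv T h x * k x) \<in> borel_measurable lborel" by measurable
    show "AE x in lborel. norm (conv T h x * k x) \<le> norm (sqrt (nrm2 T * nrm2 h) * norm (k x))"
    proof (rule AE_I2)
      fix x
      have "cmod (conv T h x) \<le> sqrt (nrm2 T * nrm2 h)" by (rule real_le_rsqrt) (rule conv_bound[OF TL h(1)])
      then show "norm (conv T h x * k x) \<le> norm (sqrt (nrm2 T * nrm2 h) * norm (k x))"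
        by (simp add: norm_mult mult_right_mono)
    qed
  qed
  have "e\<^sup>2 * (ka 0 + (LINT s|lborel. ka s * h s)) = (LINT x|lborel. T x * k x) + (LINT x|lborel. conv T h x * k x)"
    unfolding conv_swap[OF TL h(1) ki] ke using ke[of 0] by (simp add: distrib_left mult.assoc)
  also have "\<dots> = (LINT x|lborel. ?r x * k x)"
    using i1 i2 by (simp add: id flip: Bochner_Integration.integral_add)
  also have "\<dots> = (LINT x|lborel. LINT l|\<sigma>. k x * (exp (\<i> * of_real (l * x)) * of_real (fejer e l)))"
    by (simp add: mult.commute)
  also have "\<dots> = (LINT l|\<sigma>. LINT x|lborel. k x * (exp (\<i> * of_real (l * x)) * of_real (fejer e l)))"
  proof (rule p.Fubini_integral[symmetric])
    let ?K = "\<lambda>(x, l). k x * (exp (\<i> * of_real (l * x)) * of_real (fejer e l))"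
    show "integrable (lborel \<Otimes>\<^sub>M \<sigma>) ?K"
    proof (rule p.Fubini_integrable)
      have "?K \<in> borel_measurable (borel \<Otimes>\<^sub>M borel)" unfolding fejer_def by measurable
      moreover have "sets (lborel \<Otimes>\<^sub>M \<sigma>) = sets (borel \<Otimes>\<^sub>M borel)"
        by (rule sets_pair_measure_cong) (simp_all add: sets_\<sigma>)
      ultimately show "?K \<in> borel_measurable (lborel \<Otimes>\<^sub>M \<sigma>)"
        using measurable_cong_sets by blast
      show "AE x in lborel. integrable \<sigma> (\<lambda>l. ?K (x, l))"
        using fi by simp
      have "(\<lambda>x. LINT l|\<sigma>. norm (?K (x, l))) = (\<lambda>x. cmod (k x) * (LINT l|\<sigma>. \<bar>fejer e l\<bar>))"
        by (simp add: norm_mult)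
      then show "integrable lborel (\<lambda>x. LINT l|\<sigma>. norm (?K (x, l)))" using integrable_norm[OF ki] by simp
    qed
  qed
  also have "\<dots> = (LINT l|\<sigma>. of_real (fejer e l) * ft k (of_real l))"
  proof (rule Bochner_Integration.integral_cong[OF refl])
    fix l
    have "(\<lambda>x. k x * (exp (\<i> * of_real (l * x)) * of_real (fejer e l)))
      = (\<lambda>x. of_real (fejer e l) * (k x * exp (\<i> * of_real l * of_real x)))"
      by (simp add: mult_ac)
    then show "(LINT x|lborel. k x * (exp (\<i> * of_real (l * x)) * of_real (fejer e l))) = of_real (fejer e l) * ft k (of_real l)"
      by (simp add: ft_def)
  qed
  also have "\<dots> = (LINT l|\<sigma>. e\<^sup>2 * (of_real (fejer e l / e\<^sup>2) * ft k (of_real l)))"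
    using e by simp
  also have "\<dots> = e\<^sup>2 * (LINT l|\<sigma>. of_real (fejer e l / e\<^sup>2) * ft k (of_real l))"
    by (rule integral_mult_right_zero)
  finally have "(complex_of_real e)\<^sup>2 * (ka 0 + (LINT s|lborel. ka s * h s))
    = (complex_of_real e)\<^sup>2 * (LINT l|\<sigma>. of_real (fejer e l / e\<^sup>2) * ft k (of_real l))"
    by (simp only: of_real_power)
  moreover have "(complex_of_real e)\<^sup>2 \<noteq> 0" using e by simp
  ultimately show ?thesis unfolding mult_cancel_left by blast
qed

text \<open>Let the width of the triangle tend to zero. The normalized Fejer factor is at most 1 and
  tends to 1, so the assumed decay of \<open>ft k\<close> is the dominating function on the spectral
  side.\<close>

lemma spectral_pairing:
  assumes h: "L2 h" "\<And>x. x \<notin> {-M..M} \<Longrightarrow> h x = 0"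
    and hH: "AE s in lborel. s \<in> {-M..M} \<longrightarrow> h s = H s"
    and kc: "continuous_on UNIV k" and ks: "\<And>x. x \<notin> {-R..R} \<Longrightarrow> k x = 0" and RM: "R < M"
    and decay: "\<And>l. cmod (ft k (of_real l)) \<le> C * (1 / (1 + l\<^sup>2))"
  shows "k 0 + (LINT s|lborel. k s * h s) = (LINT l|\<sigma>. ft k (of_real l))"
proof -
  have km [measurable]: "k \<in> borel_measurable borel" using kc by (rule borel_measurable_continuous_onI)
  have hm [measurable]: "h \<in> borel_measurable borel" by (rule L2_measurable[OF h(1)])
  have "compact (k ` {-R..R})" using kc by (intro compact_continuous_image continuous_on_subset[OF kc]) auto
  then obtain b' where b': "\<And>x. x \<in> {-R..R} \<Longrightarrow> cmod (k x) \<le> b'"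
    by (metis bounded_iff compact_imp_bounded imageI)
  define b where "b = \<bar>b'\<bar>"
  have b: "cmod (k x) \<le> b" for x
    using b'[of x] ks[of x] by (cases "x \<in> {-R..R}") (auto simp: b_def simp del: atLeastAtMost_iff)
  have hi: "integrable lborel h" by (rule L2_supp_integrable[OF h(1)]) (rule h(2))
  \<comment> \<open>The widths start at \<open>M - R\<close>, so averaging never leaves the window
    on which \<open>h\<close> agrees with \<open>H\<close>.\<close>
  define x where "x n = (M - R) / real (Suc n)" for n
  have x: "x n > 0" "R + x n \<le> M" for n
  proof -
    show "x n > 0" using RM by (simp add: x_def)
    have "x n \<le> (M - R) / 1" unfolding x_def by (rule divide_left_mono) (use RM in auto)
    then show "R + x n \<le> M" by simp
  qed
  have x0: "x \<longlonglongrightarrow> 0"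
    unfolding x_def[abs_def] by (rule LIMSEQ_Suc[OF lim_const_over_n])
  define ka where "ka n t = (LINT u|lborel. of_real (tri 1 u) * k (t + x n * u))" for n t
  have kam [measurable]: "ka n \<in> borel_measurable borel" for n
    unfolding ka_def[abs_def] by measurable
  have ti: "integrable lborel (tri 1)" using not_integrable_integral_eq[of lborel "tri 1"] integral_tri by auto
  have kle: "cmod (of_real (tri 1 u) * k (t + x n * u)) \<le> b * tri 1 u" for n t u
    using mult_mono[OF b[of "t + x n * u"] order_refl[of "tri 1 u"]] order_trans[OF norm_ge_zero b]
    by (simp add: norm_mult tri_def mult.commute)
  have kai: "cmod (ka n t) \<le> b" for n t
  proof -
    have "cmod (ka n t) \<le> (LINT u|lborel. b * tri 1 u)"
      unfolding ka_def
      by (rule order_trans[OF integral_norm_bound], rule Bochner_Integration.integral_mono'[OF integrable_mult_right[OF ti]])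
        (use kle order_trans[OF norm_ge_zero b] in \<open>auto simp: tri_def\<close>)
    also have "\<dots> = b" using integral_tri ti by simp
    finally show ?thesis .
  qed
  have kal: "(\<lambda>n. ka n t) \<longlonglongrightarrow> k t" for t
  proof -
    have "(\<lambda>n. ka n t) \<longlonglongrightarrow> (LINT u|lborel. of_real (tri 1 u) * k t)"
      unfolding ka_def
    proof (rule integral_dominated_convergence)
      show "integrable lborel (\<lambda>u. b * tri 1 u)" using ti by simp
      show "AE u in lborel. norm (of_real (tri 1 u) * k (t + x n * u)) \<le> b * tri 1 u" for n
        using kle by (intro AE_I2)
      show "AE u in lborel. (\<lambda>n. of_real (tri 1 u) * k (t + x n * u)) \<longlonglongrightarrow> of_real (tri 1 u) * k t"
      proof (rule AE_I2)
        fix u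
        have "(\<lambda>n. t + x n * u) \<longlonglongrightarrow> t + 0 * u" by (intro tendsto_intros x0)
        then have "(\<lambda>n. k (t + x n * u)) \<longlonglongrightarrow> k t"
          using kc by (auto simp: continuous_on_eq_continuous_at intro: isCont_tendsto_compose)
        then show "(\<lambda>n. of_real (tri 1 u) * k (t + x n * u)) \<longlonglongrightarrow> of_real (tri 1 u) * k t"
          by (intro tendsto_intros)
      qed
    qed measurable
    moreover have "(LINT u|lborel. of_real (tri 1 u) * k t) = k t"
      using integral_tri by simp
    ultimately show ?thesis by (simp only:)
  qed
  have "(\<lambda>n. LINT s|lborel. ka n s * h s) \<longlonglongrightarrow> (LINT s|lborel. k s * h s)"
  proof (rule integral_dominated_convergence)
    show "integrable lborel (\<lambda>s. b * norm (h s))" using integrable_norm[OF hi] by simp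
    show "AE s in lborel. norm (ka n s * h s) \<le> b * norm (h s)" for n
      using kai by (intro AE_I2) (simp add: norm_mult mult_right_mono)
    show "AE s in lborel. (\<lambda>n. ka n s * h s) \<longlonglongrightarrow> k s * h s"
      by (intro AE_I2 tendsto_intros kal)
  qed measurable
  then have L: "(\<lambda>n. ka n 0 + (LINT s|lborel. ka n s * h s)) \<longlonglongrightarrow> k 0 + (LINT s|lborel. k s * h s)"
    by (intro tendsto_add kal)
  have ftm: "(\<lambda>l. ft k (of_real l)) \<in> borel_measurable borel"
    unfolding ft_def by measurable
  have "(\<lambda>n. LINT l|\<sigma>. of_real (fejer (x n) l / (x n)\<^sup>2) * ft k (of_real l)) \<longlonglongrightarrow> (LINT l|\<sigma>. ft k (of_real l))"
  proof (rule integral_dominated_convergence)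
    show "(\<lambda>l. ft k (of_real l)) \<in> borel_measurable \<sigma>" by (rule measurable_\<sigma>[OF ftm])
    show "(\<lambda>l. of_real (fejer (x n) l / (x n)\<^sup>2) * ft k (of_real l)) \<in> borel_measurable \<sigma>" for n
      using ftm unfolding fejer_def by (intro measurable_\<sigma>) measurable
    show "integrable \<sigma> (\<lambda>l. C * (1 / (1 + l\<^sup>2)))" by (rule integrable_mult_right[OF int_\<sigma>])
    show "AE l in \<sigma>. norm (of_real (fejer (x n) l / (x n)\<^sup>2) * ft k (of_real l)) \<le> C * (1 / (1 + l\<^sup>2))" for n
    proof (rule AE_I2)
      fix l
      have "norm (of_real (fejer (x n) l / (x n)\<^sup>2) * ft k (of_real l)) = \<bar>fejer (x n) l / (x n)\<^sup>2\<bar> * cmod (ft k (of_real l))"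
        unfolding norm_mult norm_of_real ..
      also have "\<dots> \<le> 1 * cmod (ft k (of_real l))" by (intro mult_right_mono fejer_bound x) auto
      also have "\<dots> \<le> C * (1 / (1 + l\<^sup>2))" using decay[of l] by simp
      finally show "norm (of_real (fejer (x n) l / (x n)\<^sup>2) * ft k (of_real l)) \<le> C * (1 / (1 + l\<^sup>2))" .
    qed
    show "AE l in \<sigma>. (\<lambda>n. of_real (fejer (x n) l / (x n)\<^sup>2) * ft k (of_real l)) \<longlonglongrightarrow> ft k (of_real l)"
    proof (rule AE_I2)
      fix l
      have "(\<lambda>n. complex_of_real (fejer (x n) l / (x n)\<^sup>2) * ft k (of_real l)) \<longlonglongrightarrow> of_real 1 * ft k (of_real l)"
        by (intro tendsto_intros fejer_limit x x0)
      then show "(\<lambda>n. of_real (fejer (x n) l / (x n)\<^sup>2) * ft k (of_real l)) \<longlonglongrightarrow> ft k (of_real l)" by simp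
    qed
  qed
  moreover have "(LINT l|\<sigma>. of_real (fejer (x n) l / (x n)\<^sup>2) * ft k (of_real l)) = ka n 0 + (LINT s|lborel. ka n s * h s)" for n
    unfolding ka_def by (rule spectral_pairing_mollified[OF h hH kc ks x, symmetric])
  ultimately show ?thesis using L LIMSEQ_unique by simp
qed

end

section \<open>Transforms of compactly supported functions\<close>

text \<open>The correlation, the integral of \<open>u (x + s) * cnj (v s)\<close> over
  \<open>s\<close>, written as a convolution so that continuity and \<open>conv_swap\<close> carry
  over. On the real line its transform is \<open>ft u * cnj (ft v)\<close>.\<close>

definition corr :: "(real \<Rightarrow> complex) \<Rightarrow> (real \<Rightarrow> complex) \<Rightarrow> real \<Rightarrow> complex" where
  "corr u v = conv u (\<lambda>t. cnj (v (- t)))"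

lemma L2_cnj_flip: "L2 v \<Longrightarrow> L2 (\<lambda>t. cnj (v (- t)))"
  using L2_cnj[OF L2_reflect[of v 0]] by simp

lemma corr_continuous:
  assumes "L2 u" "\<And>x. x \<notin> {0..R} \<Longrightarrow> u x = 0" "L2 v"
  shows "continuous_on UNIV (corr u v)"
  unfolding corr_def by (rule continuous_on_conv[OF assms(1) _ L2_cnj_flip[OF assms(3)]]) (rule assms(2))

lemma corr_supp:
  assumes "\<And>x. x \<notin> {0..R} \<Longrightarrow> u x = 0" "\<And>x. x \<notin> {0..R} \<Longrightarrow> v x = 0" "x \<notin> {-R..R}"
  shows "corr u v x = 0"
proof -
  have "u (x - t) * cnj (v (- t)) = 0" for t
  proof (cases "- t \<in> {0..R}")
    case True
    then have "x - t \<notin> {0..R}" using assms(3) by auto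
    then show ?thesis using assms(1) by simp
  next
    case False then show ?thesis using assms(2) by simp
  qed
  then have "(\<lambda>t. u (x - t) * cnj (v (- t))) = (\<lambda>t. 0)" by (rule ext)
  then show ?thesis by (simp only: corr_def conv_def) simp
qed

lemma corr_0: "corr u v 0 = ip u v"
  unfolding corr_def conv_def ip_def
  by (subst (2) lborel_integral_real_affine[of "-1" _ 0]) auto

lemma ft_corr:
  assumes u: "L2 u" "\<And>x. x \<notin> {0..R} \<Longrightarrow> u x = 0" and v: "L2 v" "\<And>x. x \<notin> {0..R} \<Longrightarrow> v x = 0"
  shows "ft (corr u v) (of_real l) = ft u (of_real l) * cnj (ft v (of_real l))"
proof -
  define E where "E x = exp (\<i> * of_real l * complex_of_real x)" for x
  have Ec: "continuous_on UNIV E" unfolding E_def by (intro continuous_intros)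
  have Em [measurable]: "E \<in> borel_measurable borel" by (rule borel_measurable_continuous_onI[OF Ec])
  have ei: "integrable lborel (cutoff (-R) R E)"
    by (rule L2_supp_integrable[OF L2_cutoff_continuous[OF Ec], of "-R" R]) (rule cutoff_eq_zero)
  \<comment> \<open>The exponential is not integrable over the line; the correlation vanishes off
    \<open>{-R..R}\<close>, so cutting the exponential off there changes nothing.\<close>
  have "ft (corr u v) (of_real l) = (LINT x|lborel. conv u (\<lambda>t. cnj (v (- t))) x * cutoff (-R) R E x)"
    unfolding ft_def
  proof (rule Bochner_Integration.integral_cong[OF refl])
    fix x
    show "corr u v x * exp (\<i> * of_real l * of_real x) = conv u (\<lambda>t. cnj (v (- t))) x * cutoff (-R) R E x"
    proof (cases "x \<in> {-R..R}")
      case True then show ?thesis by (simp add: corr_def cutoff_def E_def)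
    next
      case False
      then have "conv u (\<lambda>t. cnj (v (- t))) x = 0" using corr_supp[OF u(2) v(2) False] by (simp add: corr_def)
      then show ?thesis by (simp add: corr_def)
    qed
  qed
  also have "\<dots> = (LINT t|lborel. (LINT x|lborel. u (x - t) * cutoff (-R) R E x) * cnj (v (- t)))"
    by (rule conv_swap[OF u(1) L2_cnj_flip[OF v(1)] ei])
  also have "\<dots> = (LINT t|lborel. ft u (of_real l) * (E t * cnj (v (- t))))"
  proof (rule Bochner_Integration.integral_cong[OF refl])
    fix t
    show "(LINT x|lborel. u (x - t) * cutoff (-R) R E x) * cnj (v (- t)) = ft u (of_real l) * (E t * cnj (v (- t)))"
    proof (cases "- t \<in> {0..R}")
      case True
      have "(LINT x|lborel. u (x - t) * cutoff (-R) R E x) = (LINT y|lborel. u y * cutoff (-R) R E (t + y))"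
        by (subst lborel_integral_real_affine[of 1 _ t]) auto
      also have "\<dots> = (LINT y|lborel. E t * (u y * E y))"
      proof (rule Bochner_Integration.integral_cong[OF refl])
        fix y
        show "u y * cutoff (-R) R E (t + y) = E t * (u y * E y)"
        proof (cases "y \<in> {0..R}")
          case y: True
          then have "t + y \<in> {-R..R}" using True by auto
          then have "cutoff (-R) R E (t + y) = E (t + y)" unfolding cutoff_def by (rule if_P)
          also have "\<dots> = E t * E y" by (simp add: E_def exp_add[symmetric] algebra_simps)
          finally show ?thesis by simp
        next
          case False then show ?thesis using u(2) by simp
        qed
      qed
      also have "\<dots> = E t * ft u (of_real l)" unfolding ft_def E_def by (rule integral_mult_right_zero)
      finally show ?thesis by simp
    next
      case False then show ?thesis using v(2) by simp
    qed
  qed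
  also have "\<dots> = ft u (of_real l) * (LINT t|lborel. E t * cnj (v (- t)))" by (rule integral_mult_right_zero)
  also have "(LINT t|lborel. E t * cnj (v (- t))) = (LINT s|lborel. E (- s) * cnj (v s))"
    by (subst lborel_integral_real_affine[of "-1" _ 0]) auto
  also have "\<dots> = cnj (ft v (of_real l))"
    unfolding ft_def Bochner_Integration.integral_cnj[symmetric]
    by (simp add: E_def exp_cnj mult.commute)
  finally show ?thesis .
qed

text \<open>Fubini's theorem twice turns the pairing of a correlation with \<open>h\<close> into the
  form of \<open>conv h\<close>. The conjugate ends up inside the convolution, so positivity will be
  applied to a conjugated function.\<close>

lemma corr_pairing:
  assumes h: "L2 h" "\<And>x. x \<notin> {a..b} \<Longrightarrow> h x = 0"
    and u: "L2 u" "\<And>x. x \<notin> {0..R} \<Longrightarrow> u x = 0" and v: "L2 v"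
  shows "(LINT x|lborel. corr u v x * h x) = (LINT y|lborel. conv h (\<lambda>s. cnj (v s)) y * u y)"
proof -
  have hi: "integrable lborel h" by (rule L2_supp_integrable[OF h(1)]) (rule h(2))
  have ui: "integrable lborel u" by (rule L2_supp_integrable[OF u(1)]) (rule u(2))
  have "(LINT x|lborel. corr u v x * h x) = (LINT t|lborel. (LINT x|lborel. u (x - t) * h x) * cnj (v (- t)))"
    unfolding corr_def by (rule conv_swap[OF u(1) L2_cnj_flip[OF v] hi])
  also have "\<dots> = (LINT s|lborel. (LINT x|lborel. u (x + s) * h x) * cnj (v s))"
    by (subst lborel_integral_real_affine[of "-1" _ 0]) auto
  also have "\<dots> = (LINT s|lborel. (LINT y|lborel. h (y - s) * u y) * cnj (v s))"
  proof (rule Bochner_Integration.integral_cong[OF refl])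
    fix s
    have "(LINT x|lborel. u (x + s) * h x) = (LINT y|lborel. u (- s + y + s) * h (- s + y))"
      by (subst lborel_integral_real_affine[of 1 _ "- s"]) auto
    then show "(LINT x|lborel. u (x + s) * h x) * cnj (v s) = (LINT y|lborel. h (y - s) * u y) * cnj (v s)"
      by (simp add: mult.commute)
  qed
  also have "\<dots> = (LINT y|lborel. conv h (\<lambda>s. cnj (v s)) y * u y)"
    by (rule conv_swap[OF h(1) L2_cnj[OF v] ui, symmetric])
  finally show ?thesis .
qed

lemma ft_bounded:
  assumes "integrable lborel v" shows "cmod (ft v (of_real l)) \<le> (LINT x|lborel. cmod (v x))"
  unfolding ft_def
  by (rule order_trans[OF integral_norm_bound]) (simp add: norm_mult)

section \<open>Division of a transform by a zero\<close>

lemma continuous_on_tail_integral: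
  assumes G: "integrable lborel (G :: real \<Rightarrow> complex)"
  shows "continuous_on UNIV (\<lambda>s. LINT t|lborel. cutoff s R G t)"
  unfolding continuous_on_sequentially
proof (intro allI ballI impI, elim conjE)
  fix x :: "nat \<Rightarrow> real" and s assume x: "x \<longlonglongrightarrow> s"
  have [measurable]: "G \<in> borel_measurable borel" using borel_measurable_integrable[OF G] by simp
  have "(\<lambda>n. LINT t|lborel. cutoff (x n) R G t) \<longlonglongrightarrow> (LINT t|lborel. cutoff s R G t)"
  proof (rule integral_dominated_convergence)
    show "integrable lborel (\<lambda>t. norm (G t))" by (rule integrable_norm[OF G])
    show "AE t in lborel. norm (cutoff (x n) R G t) \<le> norm (G t)" for n by (simp add: cutoff_def)
    have "AE t in lborel. t \<noteq> s" by (rule AE_lborel_singleton)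
    then show "AE t in lborel. (\<lambda>n. cutoff (x n) R G t) \<longlonglongrightarrow> cutoff s R G t"
    proof eventually_elim
      case (elim t)
      have "eventually (\<lambda>n. cutoff (x n) R G t = cutoff s R G t) sequentially"
      proof (cases "t < s")
        case True
        from order_tendstoD(1)[OF x this] show ?thesis
          by eventually_elim (use True in \<open>auto simp: cutoff_def\<close>)
      next
        case False
        with elim have t: "s < t" by simp
        from order_tendstoD(2)[OF x this] show ?thesis
          by eventually_elim (use t in \<open>auto simp: cutoff_def\<close>)
      qed
      then show ?case by (rule tendsto_eventually)
    qed
  qed measurable
  then show "((\<lambda>s. LINT t|lborel. cutoff s R G t) \<circ> x) \<longlonglongrightarrow> (LINT t|lborel. cutoff s R G t)"
    by (simp add: o_def)
qed

text \<open>The Paley-Wiener form of division by a zero: if \<open>Q z = \<gamma> * exp (\<i> * z * R) - ft g z\<close> vanishes at \<open>w\<close>, then \<open>Q z / (z - w)\<close> is again the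
  transform of a function supported in \<open>{0..R}\<close>, namely of \<open>quot R \<gamma> g w\<close>.\<close>

definition quot :: "real \<Rightarrow> complex \<Rightarrow> (real \<Rightarrow> complex) \<Rightarrow> complex \<Rightarrow> real \<Rightarrow> complex" where
  "quot R \<gamma> g w s = \<i> * exp (- \<i> * w * of_real s) *
    (\<gamma> * exp (\<i> * w * of_real R) - (LINT t|lborel. cutoff s R (\<lambda>t. g t * exp (\<i> * w * of_real t)) t))"

context
  fixes R :: real and g :: "real \<Rightarrow> complex"
  assumes R: "0 < R" and g: "L2 g" "\<And>x. x \<notin> {0..R} \<Longrightarrow> g x = 0"
begin

lemma exp_integrable: "integrable lborel (\<lambda>t. g t * exp (z * of_real t))"
proof -
  have "continuous_on UNIV (\<lambda>t. exp (z * complex_of_real t))" by (intro continuous_intros)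
  from L2_mult_integrable[OF g(1) L2_cutoff_continuous[OF this, of 0 R]]
  show ?thesis
    by (rule Bochner_Integration.integrable_cong[OF refl, THEN iffD1, rotated])
      (use g(2) in \<open>force simp: cutoff_def\<close>)
qed

lemma quot_continuous: "continuous_on UNIV (quot R \<gamma> g w)"
  unfolding quot_def by (intro continuous_intros continuous_on_tail_integral exp_integrable)

text \<open>Left of 0 the tail integral is the full transform at \<open>w\<close>, so this is where
  the zero at \<open>w\<close> enters.\<close>

lemma quot_left:
  assumes "\<gamma> * exp (\<i> * w * of_real R) = ft g w" "s \<le> 0" shows "quot R \<gamma> g w s = 0"
proof -
  have "(LINT t|lborel. cutoff s R (\<lambda>t. g t * exp (\<i> * w * of_real t)) t) = ft g w"
    unfolding ft_def
    by (rule Bochner_Integration.integral_cong) (use g(2) assms(2) in \<open>auto simp: cutoff_def\<close>)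
  then show ?thesis by (simp add: quot_def assms(1))
qed

text \<open>At \<open>s = R\<close> the value is \<open>\<i> * \<gamma>\<close>: a jump for
  \<open>\<gamma> = 1\<close>, the first division, and a continuous vanishing for
  \<open>\<gamma> = 0\<close>, the second.\<close>

lemma quot_right: "R \<le> s \<Longrightarrow> quot R \<gamma> g w s = \<i> * exp (- \<i> * w * of_real s) * (\<gamma> * exp (\<i> * w * of_real R))"
proof -
  assume s: "R \<le> s"
  have "AE t in lborel. t \<noteq> R" by (rule AE_lborel_singleton)
  then have "AE t in lborel. cutoff s R (\<lambda>t. g t * exp (\<i> * w * of_real t)) t = 0"
    by eventually_elim (use s in \<open>auto simp: cutoff_def\<close>)
  then have "(LINT t|lborel. cutoff s R (\<lambda>t. g t * exp (\<i> * w * of_real t)) t) = 0"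
    by (rule integral_eq_zero_AE)
  then show ?thesis by (simp add: quot_def)
qed

text \<open>Integration by parts, done with Fubini's theorem on the triangle \<open>s <= t\<close>:
  the factor \<open>\<i> * (z - w)\<close> turns \<open>E\<close> into its derivative, so the inner
  integral is \<open>E t - 1\<close>. The terms free of \<open>z\<close> cancel because
  \<open>w\<close> is a zero.\<close>

lemma ft_quot:
  assumes "\<gamma> * exp (\<i> * w * of_real R) = ft g w"
  shows "(z - w) * ft (cutoff 0 R (quot R \<gamma> g w)) z = \<gamma> * exp (\<i> * z * of_real R) - ft g z"
proof -
  define G where "G t = g t * exp (\<i> * w * of_real t)" for t
  define \<zeta> where "\<zeta> = \<i> * (z - w)"
  define E where "E s = exp (\<zeta> * complex_of_real s)" for s
  define E' where "E' s = \<zeta> * E s" for s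
  have Gi: "integrable lborel G" unfolding G_def[abs_def] by (rule exp_integrable)
  have [measurable]: "G \<in> borel_measurable borel" using borel_measurable_integrable[OF Gi] by simp
  have Ec: "continuous_on S E" and Ec': "continuous_on S E'" for S
    unfolding E'_def[abs_def] E_def[abs_def] by (intro continuous_intros)+
  have [measurable]: "E' \<in> borel_measurable borel" by (rule borel_measurable_continuous_onI[OF Ec'])
  have E'i: "integrable lborel (cutoff 0 R E')"
    by (rule L2_supp_integrable[OF L2_cutoff_continuous[OF Ec'], of 0 R]) (rule cutoff_eq_zero)
  have FTC: "(LINT s|lborel. cutoff 0 t E' s) = E t - 1" if "0 \<le> t" for t
  proof -
    have "(LBINT s. indicator {0..t} s *\<^sub>R E' s) = E t - E 0"
    proof (rule integral_FTC_Icc[OF that])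
      show "(E has_vector_derivative E' s) (at s within {0..t})" for s
        unfolding E_def[abs_def] E'_def
        by (rule has_vector_derivative_real_field) (auto intro!: derivative_eq_intros)
    qed (rule Ec')
    moreover have "(\<lambda>s. indicator {0..t} s *\<^sub>R E' s) = cutoff 0 t E'" by (auto simp: cutoff_def indicator_def)
    ultimately show ?thesis by (simp add: E_def)
  qed
  have cG: "integrable lborel (cutoff s R G)" for s
  proof (rule Bochner_Integration.integrable_bound[OF Gi])
    show "cutoff s R G \<in> borel_measurable lborel" by measurable
  qed (auto simp: cutoff_def)
  let ?K = "\<lambda>(s, t). cutoff 0 R E' s * cutoff s R G t"
  have K: "integrable (lborel \<Otimes>\<^sub>M lborel) ?K"
  proof (rule lborel_pair.Fubini_integrable)
    show "?K \<in> borel_measurable (lborel \<Otimes>\<^sub>M lborel)" by measurable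
    show "AE s in lborel. integrable lborel (\<lambda>t. ?K (s, t))" using cG by simp
    show "integrable lborel (\<lambda>s. LINT t|lborel. norm (?K (s, t)))"
    proof (rule Bochner_Integration.integrable_bound)
      show "integrable lborel (\<lambda>s. cmod (cutoff 0 R E' s) * (LINT t|lborel. cmod (G t)))"
        using integrable_norm[OF E'i] by simp
      show "AE s in lborel. norm (LINT t|lborel. norm (?K (s, t))) \<le> norm (cmod (cutoff 0 R E' s) * (LINT t|lborel. cmod (G t)))"
      proof (rule AE_I2)
        fix s
        have "(LINT t|lborel. norm (?K (s, t))) = cmod (cutoff 0 R E' s) * (LINT t|lborel. cmod (cutoff s R G t))"
          by (simp add: norm_mult)
        moreover have "(LINT t|lborel. cmod (cutoff s R G t)) \<le> (LINT t|lborel. cmod (G t))"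
          by (rule Bochner_Integration.integral_mono[OF integrable_norm[OF cG] integrable_norm[OF Gi]])
            (simp add: cutoff_def)
        ultimately show "norm (LINT t|lborel. norm (?K (s, t))) \<le> norm (cmod (cutoff 0 R E' s) * (LINT t|lborel. cmod (G t)))"
          by (simp add: mult_left_mono)
      qed
    qed measurable
  qed
  define c where "c = \<gamma> * exp (\<i> * w * of_real R)"
  have "(z - w) * ft (cutoff 0 R (quot R \<gamma> g w)) z
    = (LINT s|lborel. (z - w) * (cutoff 0 R (quot R \<gamma> g w) s * exp (\<i> * z * of_real s)))"
    unfolding ft_def by (rule integral_mult_right_zero[symmetric])
  also have "\<dots> = (LINT s|lborel. c * cutoff 0 R E' s - (LINT t|lborel. ?K (s, t)))"
  proof (rule Bochner_Integration.integral_cong[OF refl])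
    fix s
    show "(z - w) * (cutoff 0 R (quot R \<gamma> g w) s * exp (\<i> * z * of_real s))
      = c * cutoff 0 R E' s - (LINT t|lborel. ?K (s, t))"
    proof (cases "s \<in> {0..R}")
      case True
      have "exp (- \<i> * w * of_real s) * exp (\<i> * z * of_real s) = E s"
        by (simp add: E_def \<zeta>_def exp_add[symmetric] algebra_simps)
      then have "(z - w) * (quot R \<gamma> g w s * exp (\<i> * z * of_real s))
        = E' s * (c - (LINT t|lborel. cutoff s R G t))"
        unfolding quot_def c_def[symmetric] G_def[symmetric] E'_def \<zeta>_def by (simp add: mult_ac)
      then show ?thesis using True by (simp add: cutoff_def[of 0 R] algebra_simps)
    next
      case False then show ?thesis by (simp add: cutoff_eq_zero del: atLeastAtMost_iff)
    qed
  qed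
  also have "\<dots> = (LINT s|lborel. c * cutoff 0 R E' s) - (LINT s|lborel. LINT t|lborel. ?K (s, t))"
    by (rule Bochner_Integration.integral_diff)
      (use E'i lborel_pair.integrable_fst[of "\<lambda>s t. ?K (s, t)"] K in simp_all)
  also have "(LINT s|lborel. LINT t|lborel. ?K (s, t)) = (LINT t|lborel. LINT s|lborel. ?K (s, t))"
    using lborel_pair.Fubini_integral[of "\<lambda>s t. ?K (s, t)"] K by simp
  also have "\<dots> = (LINT t|lborel. g t * exp (\<i> * z * of_real t) - g t * exp (\<i> * w * of_real t))"
  proof (rule Bochner_Integration.integral_cong[OF refl])
    fix t
    show "(LINT s|lborel. ?K (s, t)) = g t * exp (\<i> * z * of_real t) - g t * exp (\<i> * w * of_real t)"
    proof (cases "t \<in> {0..R}")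
      case True
      have "(LINT s|lborel. ?K (s, t)) = (LINT s|lborel. cutoff 0 t E' s * G t)"
        by (rule Bochner_Integration.integral_cong) (use True in \<open>auto simp: cutoff_def\<close>)
      also have "\<dots> = (E t - 1) * G t" using FTC[of t] True by simp
      also have "\<dots> = g t * exp (\<i> * z * of_real t) - g t * exp (\<i> * w * of_real t)"
      proof -
        have "E t * exp (\<i> * w * of_real t) = exp (\<i> * z * of_real t)"
          by (simp add: E_def \<zeta>_def exp_add[symmetric] algebra_simps)
        then show ?thesis by (simp add: G_def algebra_simps)
      qed
      finally show ?thesis .
    next
      case False
      then have z: "g t = 0" by (rule g(2))
      then have "(\<lambda>s. ?K (s, t)) = (\<lambda>s. 0)" by (auto simp: cutoff_def G_def)
      then show ?thesis using z by simp
    qed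
  qed
  also have "\<dots> = ft g z - ft g w"
    unfolding ft_def by (rule Bochner_Integration.integral_diff) (rule exp_integrable)+
  also have "(LINT s|lborel. c * cutoff 0 R E' s) = c * (E R - 1)" using FTC[of R] R by simp
  also have "c * (E R - 1) = \<gamma> * exp (\<i> * z * of_real R) - c"
  proof -
    have "exp (\<i> * w * of_real R) * E R = exp (\<i> * z * of_real R)"
      by (simp add: E_def \<zeta>_def exp_add[symmetric] algebra_simps)
    then show ?thesis by (simp add: c_def algebra_simps)
  qed
  finally show ?thesis using assms by (simp add: c_def)
qed

end

section \<open>Support, decay and the reflected resolvent equation\<close>

lemma AE_lborel_interval:
  assumes "AE x in lborel. Q x" "a < (b :: real)" obtains x where "a < x" "x < b" "Q x"
proof -
  have "\<exists>x. a < x \<and> x < b \<and> Q x"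
  proof (rule ccontr)
    assume c: "\<not> ?thesis"
    have "AE x in lborel. x \<notin> {a<..<b}" using assms(1) by eventually_elim (use c in auto)
    then have "{a<..<b} \<in> null_sets lborel" by (subst AE_iff_null_sets) auto
    then have "emeasure lborel {a<..<b} = 0" by auto
    then show False using assms(2) by (simp add: emeasure_lborel_Ioo)
  qed
  then show ?thesis using that by blast
qed

text \<open>The complement of the support is a union of open null sets, and by Lindelof's theorem
  countably many of them suffice.\<close>

lemma AE_measure_support:
  assumes "sets \<sigma> = sets borel" shows "AE l in \<sigma>. l \<in> measure_support \<sigma>"
proof -
  define F where "F = {U :: real set. open U \<and> emeasure \<sigma> U = 0}"
  obtain F' where F': "F' \<subseteq> F" "countable F'" "\<Union>F' = \<Union>F"
    using Lindelof[of F] by (auto simp: F_def)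
  have "(\<Union>U\<in>F'. U) \<in> null_sets \<sigma>"
    by (rule null_sets_UN'[OF F'(2)]) (use F'(1) assms in \<open>auto simp: F_def null_sets_def\<close>)
  then have "AE l in \<sigma>. l \<notin> (\<Union>U\<in>F'. U)" by (rule AE_not_in)
  then show ?thesis
  proof eventually_elim
    case (elim l)
    then have "l \<notin> \<Union>F" using F'(3) by auto
    then show ?case by (auto simp: measure_support_def F_def zero_less_iff_neq_zero)
  qed
qed

text \<open>The factor \<open>of_real l - w\<close> may vanish at a real \<open>l\<close>, so
  nothing is divided: \<open>l^2\<close> is bounded through
  \<open>2 * |l - v|^2 + 2 * |v|^2\<close>, the distance is absorbed by the product relations, and
  the rest by the uniform bounds.\<close>

lemma decay_of_quotients:
  fixes D U p :: "real \<Rightarrow> complex"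
  assumes D: "\<And>l. (of_real l - w) * D l = p l" and U: "\<And>l. (of_real l - z) * U l = D l"
    and b: "\<And>l. cmod (p l) \<le> bp" "\<And>l. cmod (D l) \<le> bd" "\<And>l. cmod (U l) \<le> bu"
  obtains C where "\<And>l. (cmod (D l))\<^sup>2 \<le> C * (1 / (1 + l\<^sup>2))" "\<And>l. cmod (U l) \<le> C * (1 / (1 + l\<^sup>2))"
proof -
  define C1 where "C1 = bd\<^sup>2 + 2 * bp\<^sup>2 + 2 * (cmod w)\<^sup>2 * bd\<^sup>2"
  define C2 where "C2 = bu + 2 * (bp + (cmod w + cmod z) * bd) + 2 * (cmod z)\<^sup>2 * bu"
  have q: "1 + l\<^sup>2 > 0" for l :: real by (simp add: add_pos_nonneg)
  have sq: "l\<^sup>2 \<le> 2 * (cmod (of_real l - v))\<^sup>2 + 2 * (cmod v)\<^sup>2" for l v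
    using cmod_add_sq_le[of "of_real l - v" v] by simp
  have 1: "(1 + l\<^sup>2) * (cmod (D l))\<^sup>2 \<le> C1" for l
  proof -
    have p2: "(cmod (of_real l - w))\<^sup>2 * (cmod (D l))\<^sup>2 \<le> bp\<^sup>2"
      using power_mono[OF b(1)[of l] norm_ge_zero, of 2] unfolding D[symmetric] by (simp add: norm_mult power_mult_distrib)
    have d2: "(cmod (D l))\<^sup>2 \<le> bd\<^sup>2" by (rule power_mono[OF b(2)]) simp
    have "l\<^sup>2 * (cmod (D l))\<^sup>2 \<le> (2 * (cmod (of_real l - w))\<^sup>2 + 2 * (cmod w)\<^sup>2) * (cmod (D l))\<^sup>2"
      by (rule mult_right_mono[OF sq]) simp
    moreover have "(cmod w)\<^sup>2 * (cmod (D l))\<^sup>2 \<le> (cmod w)\<^sup>2 * bd\<^sup>2" by (rule mult_left_mono[OF d2]) simp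
    ultimately show ?thesis using p2 d2 by (simp add: C1_def algebra_simps)
  qed
  have 2: "(1 + l\<^sup>2) * cmod (U l) \<le> C2" for l
  proof -
    define a where "a = cmod (of_real l - z)"
    have aU: "a * cmod (U l) = cmod (D l)" unfolding a_def U[symmetric] by (simp add: norm_mult)
    have "a \<le> cmod (of_real l - w) + (cmod w + cmod z)"
      unfolding a_def using norm_triangle_ineq[of "of_real l - w" "w - z"] norm_triangle_ineq4[of w z] by simp
    then have "a * cmod (D l) \<le> (cmod (of_real l - w) + (cmod w + cmod z)) * cmod (D l)"
      by (rule mult_right_mono) simp
    also have "\<dots> = cmod (p l) + (cmod w + cmod z) * cmod (D l)"
      unfolding D[symmetric] by (simp add: norm_mult distrib_right)
    also have "\<dots> \<le> bp + (cmod w + cmod z) * bd"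
      by (intro add_mono b mult_left_mono) auto
    finally have aD: "a * (a * cmod (U l)) \<le> bp + (cmod w + cmod z) * bd" unfolding aU .
    have "l\<^sup>2 * cmod (U l) \<le> (2 * a\<^sup>2 + 2 * (cmod z)\<^sup>2) * cmod (U l)"
      unfolding a_def by (rule mult_right_mono[OF sq]) simp
    moreover have "(cmod z)\<^sup>2 * cmod (U l) \<le> (cmod z)\<^sup>2 * bu" by (rule mult_left_mono[OF b(3)]) simp
    ultimately show ?thesis using aD b(3)[of l] by (simp add: C2_def algebra_simps power2_eq_square)
  qed
  show ?thesis
  proof (rule that[of "max C1 C2"])
    fix l
    have "(cmod (D l))\<^sup>2 \<le> C1 / (1 + l\<^sup>2)" using 1[of l] q[of l] by (simp add: pos_le_divide_eq mult.commute)
    also have "\<dots> \<le> max C1 C2 / (1 + l\<^sup>2)" by (rule divide_right_mono) (use q[of l] in auto)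
    finally show "(cmod (D l))\<^sup>2 \<le> max C1 C2 * (1 / (1 + l\<^sup>2))" by simp
    have "cmod (U l) \<le> C2 / (1 + l\<^sup>2)" using 2[of l] q[of l] by (simp add: pos_le_divide_eq mult.commute)
    also have "\<dots> \<le> max C1 C2 / (1 + l\<^sup>2)" by (rule divide_right_mono) (use q[of l] in auto)
    finally show "cmod (U l) \<le> max C1 C2 * (1 / (1 + l\<^sup>2))" by simp
  qed
qed

text \<open>With the point mass at \<open>R\<close> that belongs to
  \<open>exp (\<i> * z * of_real R)\<close>, this says formally that the identity plus
  \<open>conv h\<close> maps that mass minus \<open>cnj w\<close> to the mass alone on
  \<open>{0..R}\<close>. Pairing with a function vanishing at \<open>R\<close> therefore gives
  zero.\<close>

lemma (in krein_kernel) reflected_resolvent: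
  defines "w \<equiv> \<lambda>s. f R (R - s)"
  shows "AE t in lborel. t \<in> {0..R} \<longrightarrow> cnj (w t) + conv h (\<lambda>s. cnj (w s)) t = h (t - R)"
proof -
  have RR: "R \<in> {0..R}" using R by simp
  have cw: "conv h (\<lambda>s. cnj (w s)) t = cnj (conv h (f R) (R - t))" for t
  proof -
    have "conv h (\<lambda>s. cnj (w s)) t = (LINT s|lborel. h (t - (R - s)) * cnj (f R s))"
      unfolding conv_def w_def by (subst lborel_integral_real_affine[of "-1" _ R]) auto
    also have "\<dots> = (LINT s|lborel. cnj (h ((R - t) - s) * f R s))"
      by (simp add: herm[symmetric] algebra_simps)
    finally show ?thesis unfolding conv_def Bochner_Integration.integral_cnj .
  qed
  show ?thesis
    using AE_lborel_reflect[OF f_eq[OF RR], of R]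
  proof eventually_elim
    case (elim t)
    show ?case
    proof
      assume "t \<in> {0..R}"
      then have "f R (R - t) + conv h (f R) (R - t) = h (R - t)" using elim by simp
      from arg_cong[OF this, of cnj] show "cnj (w t) + conv h (\<lambda>s. cnj (w s)) t = h (t - R)"
        unfolding cw by (simp add: w_def herm[symmetric])
    qed
  qed
qed

lemma (in krein_kernel) exp_p_eq_ft:
  "exp (\<i> * z * of_real R) * p z R = exp (\<i> * z * of_real R) - ft (\<lambda>s. f R (R - s)) z"
proof -
  have "ft (\<lambda>s. f R (R - s)) z = (LINT s|lborel. f R s * exp (\<i> * z * of_real (R - s)))"
    unfolding ft_def by (subst lborel_integral_real_affine[of "-1" _ R]) auto
  also have "\<dots> = (LINT s|lborel. exp (\<i> * z * of_real R) * (f R s * exp (- \<i> * z * of_real s)))"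
    by (rule Bochner_Integration.integral_cong) (simp_all add: exp_add[symmetric] algebra_simps flip: exp_minus)
  also have "\<dots> = exp (\<i> * z * of_real R) * (LINT s|lborel. f R s * exp (- \<i> * z * of_real s))"
    by (rule integral_mult_right_zero)
  finally show ?thesis by (simp add: p_def right_diff_distrib)
qed

section \<open>Two distinct zeros and the contradiction between them\<close>

theorem theorem10p2:
  fixes A :: "real \<Rightarrow> complex" and P Ps :: "real \<Rightarrow> complex \<Rightarrow> complex"
    and \<sigma> :: "real measure" and r :: real and z1 :: complex
  assumes "L2_loc_halfline A"
    and "krein_solution A P Ps"
    and "spectral_measure A \<sigma>"
    and "r > 0"
    and "P r z1 = 0"
  shows "\<forall>z \<in> Omega1 \<sigma> z1. P r z = 0 \<longrightarrow> z = z1"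
proof (intro ballI impI, rule ccontr)
  fix z2 assume z2: "z2 \<in> Omega1 \<sigma> z1" "P r z2 = 0" "z2 \<noteq> z1"
  obtain H \<beta> where acc: "accelerant_of A H" and sd: "spectral_data H \<sigma> \<beta>"
    using assms(3) unfolding spectral_measure_def spectral_data_def by blast
  interpret spectral_data H \<sigma> \<beta> by (rule sd)
  obtain c h f where kk: "krein_kernel r c h f" and hH: "AE x in lborel. x \<in> {-r..r} \<longrightarrow> h x = H x"
    and A: "AE \<rho> in lborel. \<rho> \<in> {0..r} \<longrightarrow> cnj (A \<rho>) = h \<rho> - conv h (f \<rho>) \<rho>"
    and pos: "\<And>g. L2 g \<Longrightarrow> (\<And>x. x \<notin> {0..r} \<Longrightarrow> g x = 0) \<Longrightarrow> \<not> (AE x in lborel. g x = 0) \<Longrightarrow> 0 < qform h g"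
    using accelerant_of_imp_krein_kernel[OF acc assms(4)] by blast
  interpret krein_kernel r c h f by (rule kk)
  have r: "r \<in> {0..r}" using assms(4) by simp
  have "accelerant H" using acc by (simp add: accelerant_of_def)
  then have "\<forall>R>0. L2_on {-R..R} H" unfolding accelerant_def L2_loc_line_def by blast
  moreover have "r + 1 > 0" using assms(4) by simp
  ultimately have "L2_on {-(r + 1)..r + 1} H" by blast
  \<comment> \<open>\<open>h\<close> ends at the edge of \<open>{-r..r}\<close>, whereas
    mollification needs room beyond the support of \<open>k\<close>. A version of \<open>H\<close>
    on a larger window supplies it and agrees with \<open>h\<close> where \<open>k\<close>
    lives.\<close>
  from L2_on_borel_version[OF this] obtain h1 where h1: "L2 h1" "\<And>x. x \<notin> {-(r + 1)..r + 1} \<Longrightarrow> h1 x = 0"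
    "AE x in lborel. x \<in> {-(r + 1)..r + 1} \<longrightarrow> h1 x = H x" by metis
  have pairing: "k 0 + (LINT s|lborel. k s * h s) = (LINT l|\<sigma>. ft k (of_real l))"
    if k: "continuous_on UNIV k" "\<And>x. x \<notin> {-r..r} \<Longrightarrow> k x = 0"
      "\<And>l. cmod (ft k (of_real l)) \<le> C * (1 / (1 + l\<^sup>2))" for k C
  proof -
    note [measurable] = borel_measurable_continuous_onI[OF k(1)] L2_measurable[OF h1(1)]
    have "(LINT s|lborel. k s * h s) = (LINT s|lborel. k s * h1 s)"
    proof (rule integral_cong_AE)
      show "AE s in lborel. k s * h s = k s * h1 s"
        using hH h1(3)
      proof eventually_elim
        case (elim s)
        show ?case
        proof (cases "s \<in> {-r..r}")
          case True
          then have "s \<in> {-(r + 1)..r + 1}" by auto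
          then show ?thesis using elim True by simp
        next
          case False then show ?thesis using k(2) by simp
        qed
      qed
    qed measurable
    then show ?thesis using spectral_pairing[OF h1 k(1,2) _ k(3)] by simp
  qed
  define w where "w = (\<lambda>s. f r (r - s))"
  have w: "L2 w" unfolding w_def by (rule L2_reflect[OF f[OF r]])
  have ws: "w x = 0" if "x \<notin> {0..r}" for x
    unfolding w_def by (rule f_supp[OF r]) (use that in auto)
  define Q where "Q z = exp (\<i> * z * of_real r) - ft w z" for z
  have PQ: "P r z = Q z" for z
    using krein_solution_eq[OF assms(2) A, of z] by (simp add: exp_p_eq_ft Q_def w_def)
  have Q1: "1 * exp (\<i> * z1 * of_real r) = ft w z1" using assms(5) unfolding PQ by (simp add: Q_def)
  \<comment> \<open>The inverse transform of \<open>D\<close>; its jump at \<open>r\<close> limits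
    the decay of \<open>ft d\<close>, but \<open>|ft d|^2\<close> is integrable against
    \<open>\<sigma>\<close>.\<close>
  define d where "d = cutoff 0 r (quot r 1 w z1)"
  have dL: "L2 d" unfolding d_def by (rule L2_cutoff_continuous[OF quot_continuous[OF assms(4) w ws]])
  have ds: "d x = 0" if "x \<notin> {0..r}" for x using that unfolding d_def by (rule cutoff_eq_zero)
  have dQ: "(z - z1) * ft d z = Q z" for z
    unfolding d_def Q_def using ft_quot[OF assms(4) w ws Q1, of z] by simp
  have d2: "ft d z2 = 0" using dQ[of z2] z2(2,3) unfolding PQ by simp
  \<comment> \<open>\<open>ft_quot\<close> divides
    \<open>\<gamma> * exp (\<i> * z * of_real R) - ft g z\<close>; with \<open>\<gamma> = 0\<close>
    the sign must be reversed to divide \<open>ft d\<close> itself.\<close>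
  define d' where "d' s = - d s" for s
  have d'L: "L2 d'" unfolding d'_def[abs_def] by (rule L2_minus[OF dL])
  have d's: "d' x = 0" if "x \<notin> {0..r}" for x using ds[OF that] by (simp add: d'_def)
  have ftd': "ft d' z = - ft d z" for z by (simp add: ft_def d'_def)
  have Q2: "0 * exp (\<i> * z2 * of_real r) = ft d' z2" using d2 by (simp add: ftd')
  define u where "u = quot r 0 d' z2"
  have uc: "continuous_on UNIV u" unfolding u_def by (rule quot_continuous[OF assms(4) d'L d's])
  have u0: "u s = 0" if "s \<le> 0" for s unfolding u_def by (rule quot_left[OF assms(4) d'L d's Q2 that])
  have ur: "u s = 0" if "r \<le> s" for s unfolding u_def using quot_right[OF assms(4) d'L d's that, of 0] by simp
  have us: "u x = 0" if "x \<notin> {0..r}" for x using that u0 ur by force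
  have cu: "cutoff 0 r u = u" using us by (force simp: cutoff_def)
  have uL: "L2 u" using L2_cutoff_continuous[OF uc, of 0 r] unfolding cu .
  have uQ: "(z - z2) * ft u z = ft d z" for z
    using ft_quot[OF assms(4) d'L d's Q2, of z] cu unfolding u_def by (simp add: ftd')
  have ui: "integrable lborel u" by (rule L2_supp_integrable[OF uL]) (rule us)
  have di: "integrable lborel d" by (rule L2_supp_integrable[OF dL]) (rule ds)
  have wi: "integrable lborel w" by (rule L2_supp_integrable[OF w]) (rule ws)
  define bp where "bp = 1 + (LINT x|lborel. cmod (w x))"
  have bp: "cmod (Q (of_real l)) \<le> bp" for l
    using norm_triangle_ineq4[of "exp (\<i> * of_real l * of_real r)" "ft w (of_real l)"] ft_bounded[OF wi, of l]
    unfolding Q_def bp_def by (simp flip: of_real_mult)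
  obtain C where C: "\<And>l. (cmod (ft d (of_real l)))\<^sup>2 \<le> C * (1 / (1 + l\<^sup>2))"
    "\<And>l. cmod (ft u (of_real l)) \<le> C * (1 / (1 + l\<^sup>2))"
    using decay_of_quotients[of z1 "\<lambda>l. ft d (of_real l)" "\<lambda>l. Q (of_real l)" z2 "\<lambda>l. ft u (of_real l)",
        OF dQ uQ bp ft_bounded[OF di] ft_bounded[OF ui]] by blast
  have norm_form: "ip d d + (LINT y|lborel. conv h (\<lambda>s. cnj (d s)) y * d y)
      = (LINT l|\<sigma>. of_real ((cmod (ft d (of_real l)))\<^sup>2))"
  proof -
    have ftc: "ft (corr d d) (of_real l) = of_real ((cmod (ft d (of_real l)))\<^sup>2)" for l
    proof -
      have "ft (corr d d) (of_real l) = ft d (of_real l) * cnj (ft d (of_real l))"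
        by (rule ft_corr[OF dL _ dL]) (rule ds, assumption)+
      then show ?thesis by (simp only: complex_norm_square)
    qed
    have "corr d d 0 + (LINT s|lborel. corr d d s * h s) = (LINT l|\<sigma>. ft (corr d d) (of_real l))"
    proof (rule pairing)
      show "continuous_on UNIV (corr d d)" by (rule corr_continuous[OF dL ds dL])
      show "corr d d x = 0" if "x \<notin> {-r..r}" for x by (rule corr_supp[OF ds ds that])
      show "cmod (ft (corr d d) (of_real l)) \<le> C * (1 / (1 + l\<^sup>2))" for l
        unfolding ftc norm_of_real using C(1)[of l] by simp
    qed
    moreover have "(LINT s|lborel. corr d d s * h s) = (LINT y|lborel. conv h (\<lambda>s. cnj (d s)) y * d y)"
      by (rule corr_pairing[OF h h_supp dL ds dL])
    ultimately show ?thesis by (simp only: corr_0 ftc)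
  qed
  have int_pos: "0 < (LINT l|\<sigma>. (cmod (ft d (of_real l)))\<^sup>2)"
  proof -
    \<comment> \<open>By \<open>corr_pairing\<close> the left side of \<open>norm_form\<close> is
      the quadratic form at the conjugate of \<open>d\<close>, so positivity is invoked
      there.\<close>
    define d0 where "d0 s = cnj (d s)" for s
    have "\<not> (AE x in lborel. d0 x = 0)"
    proof
      assume ae: "AE x in lborel. d0 x = 0"
      have "isCont (quot r 1 w z1) r"
        using quot_continuous[OF assms(4) w ws] by (simp add: continuous_on_eq_continuous_at)
      \<comment> \<open>The value at \<open>r\<close> is \<open>\<i>\<close>, so by continuity the
        quotient is nonzero on an interval left of \<open>r\<close> and \<open>d\<close> is not
        negligible.\<close>
      moreover have "quot r 1 w z1 r \<noteq> 0" using quot_right[OF assms(4) w ws order_refl, of 1] by simp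
      ultimately obtain e where e: "e > 0" "\<And>x. dist r x < e \<Longrightarrow> quot r 1 w z1 x \<noteq> 0"
        using continuous_at_avoid[of r "quot r 1 w z1" 0] by blast
      have "max 0 (r - e) < r" using e assms(4) by auto
      from AE_lborel_interval[OF ae this] obtain x where x: "max 0 (r - e) < x" "x < r" "d0 x = 0" by blast
      then have "quot r 1 w z1 x = 0" by (simp add: d0_def d_def cutoff_def)
      moreover have "dist r x < e" using x by (simp add: dist_real_def)
      ultimately show False using e(2) by blast
    qed
    then have "0 < qform h d0"
      by (intro pos) (auto simp: d0_def[abs_def] ds intro: L2_cnj dL simp del: atLeastAtMost_iff)
    also have "qform h d0 = Re (ip d d + (LINT y|lborel. conv h (\<lambda>s. cnj (d s)) y * d y))"
      by (simp add: qform_def ip_self) (simp add: ip_def nrm2_def d0_def[abs_def])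
    also have "\<dots> = (LINT l|\<sigma>. (cmod (ft d (of_real l)))\<^sup>2)"
      unfolding norm_form integral_complex_of_real by simp
    finally show ?thesis .
  qed
  have cc: "continuous_on UNIV (corr u w)" by (rule corr_continuous[OF uL us w])
  have cs: "corr u w x = 0" if "x \<notin> {-r..r}" for x by (rule corr_supp[OF us ws that])
  have cL: "L2 (corr u w)"
  proof -
    have "cutoff (-r) r (corr u w) = corr u w" using cs by (force simp: cutoff_def)
    then show ?thesis using L2_cutoff_continuous[OF cc, of "-r" r] by simp
  qed
  \<comment> \<open>The inverse transform of \<open>ft u * cnj Q\<close>: the conjugated exponential
    translates \<open>u\<close> by \<open>r\<close>, and \<open>ft w\<close> contributes a
    correlation. Continuity of \<open>k\<close> uses that \<open>u\<close> is continuous across both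
    ends.\<close>
  define k where "k x = u (x + r) - corr u w x" for x
  have uri: "integrable lborel (\<lambda>x. u (x + r))"
    using lborel_integrable_real_affine[OF ui, of 1 r] by (simp add: add.commute)
  have kc: "continuous_on UNIV k" unfolding k_def
    by (intro continuous_intros cc continuous_on_compose2[OF uc]) auto
  have ks: "k x = 0" if "x \<notin> {-r..r}" for x
  proof -
    have "x + r \<notin> {0..r}" using that by auto
    then show ?thesis using cs[OF that] us by (simp add: k_def)
  qed
  have ftk: "ft k (of_real l) = ft u (of_real l) * cnj (Q (of_real l))" for l
  proof -
    have ci: "integrable lborel (corr u w)" by (rule L2_supp_integrable[OF cL]) (rule cs)
    have e: "integrable lborel (\<lambda>x. v x * exp (\<i> * of_real l * of_real x))" if "integrable lborel v" for v
    proof (rule Bochner_Integration.integrable_bound[OF that])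
      have [measurable]: "v \<in> borel_measurable borel" using borel_measurable_integrable[OF that] by simp
      show "(\<lambda>x. v x * exp (\<i> * of_real l * of_real x)) \<in> borel_measurable lborel" by measurable
    qed (simp add: norm_mult)
    have "ft k (of_real l) = (LINT x|lborel. u (x + r) * exp (\<i> * of_real l * of_real x)) - ft (corr u w) (of_real l)"
      unfolding ft_def k_def left_diff_distrib
      by (rule Bochner_Integration.integral_diff) (intro e uri ci)+
    also have "(LINT x|lborel. u (x + r) * exp (\<i> * of_real l * of_real x))
      = (LINT y|lborel. exp (- \<i> * of_real l * of_real r) * (u y * exp (\<i> * of_real l * of_real y)))"
      by (subst lborel_integral_real_affine[of 1 _ "-r"])
        (auto simp: exp_add[symmetric] algebra_simps simp flip: exp_minus)
    also have "\<dots> = exp (- \<i> * of_real l * of_real r) * ft u (of_real l)"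
      unfolding ft_def by (rule integral_mult_right_zero)
    also have "ft (corr u w) (of_real l) = ft u (of_real l) * cnj (ft w (of_real l))"
      by (rule ft_corr[OF uL us w ws])
    finally show ?thesis by (simp add: Q_def exp_cnj algebra_simps)
  qed
  have orth: "(LINT l|\<sigma>. ft u (of_real l) * cnj (Q (of_real l))) = 0"
  proof -
    have "k 0 + (LINT s|lborel. k s * h s) = (LINT l|\<sigma>. ft k (of_real l))"
    proof (rule pairing[OF kc ks])
      show "cmod (ft k (of_real l)) \<le> (C * bp) * (1 / (1 + l\<^sup>2))" for l
      proof -
        have "cmod (ft k (of_real l)) = cmod (ft u (of_real l)) * cmod (Q (of_real l))" by (simp add: ftk norm_mult)
        also have "\<dots> \<le> (C * (1 / (1 + l\<^sup>2))) * bp"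
          using order_trans[OF norm_ge_zero C(2)[of l]] by (intro mult_mono C(2) bp) auto
        finally show ?thesis by (simp add: mult_ac)
      qed
    qed
    moreover have "k 0 + (LINT s|lborel. k s * h s) = 0"
    proof -
      have i1: "integrable lborel (\<lambda>s. u (s + r) * h s)"
        by (rule L2_mult_integrable[OF L2_translate[OF uL] h])
      have hb: "cmod (conv h (\<lambda>s. cnj (w s)) y) \<le> sqrt (nrm2 h * nrm2 w)" for y
        using conv_bound[OF h L2_cnj[OF w], of y] by (intro real_le_rsqrt) (simp add: nrm2_cnj)
      note [measurable] = L2_measurable[OF uL] L2_measurable[OF w] L2_measurable[OF h]
      have i2: "integrable lborel (\<lambda>y. conv h (\<lambda>s. cnj (w s)) y * u y)"
      proof (rule Bochner_Integration.integrable_bound[OF integrable_mult_right[OF integrable_norm[OF ui], of "sqrt (nrm2 h * nrm2 w)"]])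
        show "AE y in lborel. norm (conv h (\<lambda>s. cnj (w s)) y * u y) \<le> norm (sqrt (nrm2 h * nrm2 w) * norm (u y))"
          using hb by (intro AE_I2) (simp add: norm_mult mult_right_mono)
      qed measurable
      have i3: "integrable lborel (\<lambda>s. corr u w s * h s)"
        by (rule L2_mult_integrable[OF cL h])
      have i4: "integrable lborel (\<lambda>y. u y * h (y - r))"
        using L2_mult_integrable[OF uL L2_translate[OF h, of "-r"]] by simp
      have "(LINT s|lborel. k s * h s) = (LINT s|lborel. u (s + r) * h s) - (LINT s|lborel. corr u w s * h s)"
        unfolding k_def left_diff_distrib by (rule Bochner_Integration.integral_diff[OF i1 i3])
      also have "(LINT s|lborel. u (s + r) * h s) = (LINT y|lborel. u y * h (y - r))"
        by (subst lborel_integral_real_affine[of 1 _ "-r"]) (auto simp: algebra_simps)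
      also have "(LINT s|lborel. corr u w s * h s) = (LINT y|lborel. conv h (\<lambda>s. cnj (w s)) y * u y)"
        by (rule corr_pairing[OF h h_supp uL us w])
      \<comment> \<open>Since \<open>u r = 0\<close>, the point mass contributes nothing to
        \<open>k 0\<close>. The integrand left over is \<open>u\<close> times the defect of the
        reflected resolvent equation.\<close>
      finally have "k 0 + (LINT s|lborel. k s * h s)
        = (LINT y|lborel. u y * h (y - r)) - (LINT y|lborel. conv h (\<lambda>s. cnj (w s)) y * u y)
          - (LINT y|lborel. u y * cnj (w y))"
        using ur[of r] by (simp add: k_def corr_0 ip_def)
      also have "\<dots> = (LINT y|lborel. u y * h (y - r) - conv h (\<lambda>s. cnj (w s)) y * u y - u y * cnj (w y))"
        using i2 i4 ip_integrable[OF uL w] by simp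
      also have "\<dots> = 0"
      proof (rule integral_eq_zero_AE)
        show "AE y in lborel. u y * h (y - r) - conv h (\<lambda>s. cnj (w s)) y * u y - u y * cnj (w y) = 0"
          using reflected_resolvent
        proof eventually_elim
          case (elim y)
          show ?case
          proof (cases "y \<in> {0..r}")
            case True
            then have "h (y - r) = cnj (w y) + conv h (\<lambda>s. cnj (w s)) y"
              using elim by (simp add: w_def)
            then show ?thesis by (simp add: algebra_simps)
          next
            case False then show ?thesis using us by simp
          qed
        qed
      qed
      finally show ?thesis .
    qed
    ultimately show ?thesis by (simp add: ftk)
  qed
  define D where "D = infdist z2 (complex_of_real ` measure_support \<sigma>)"
  define q where "q = cmod (z2 - cnj z1)"
  \<comment> \<open>As \<open>q\<close> is nonnegative, membership in \<open>Omega1\<close> forces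
    the distance \<open>D\<close> to be positive.\<close>
  have Im: "Im z2 > 0" and qD: "q < D" using z2(1) by (auto simp: Omega1_def D_def q_def)
  have "0 \<le> q" by (simp add: q_def)
  then have D0: "D > 0" using qD by linarith
  have ineq: "(1 - q / D) * (cmod (ft d (of_real l)))\<^sup>2 \<le> Re (ft u (of_real l) * cnj (Q (of_real l)))"
    if l: "l \<in> measure_support \<sigma>" for l
  proof -
    \<comment> \<open>A point of the open upper half-plane differs from every real
      \<open>l\<close>.\<close>
    have ne: "of_real l - z2 \<noteq> 0" using Im by (auto simp: complex_eq_iff)
    have "D \<le> dist z2 (of_real l)" unfolding D_def by (rule infdist_le) (use l in simp)
    then have Dl: "D \<le> cmod (of_real l - z2)" by (simp add: dist_norm norm_minus_commute)
    have "ft u (of_real l) = ft d (of_real l) / (of_real l - z2)"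
      using uQ[of "of_real l"] ne by (simp add: field_simps)
    moreover have "cnj (Q (of_real l)) = (of_real l - cnj z1) * cnj (ft d (of_real l))"
      unfolding dQ[symmetric] by simp
    ultimately have "ft u (of_real l) * cnj (Q (of_real l))
      = ((of_real l - cnj z1) / (of_real l - z2)) * (ft d (of_real l) * cnj (ft d (of_real l)))"
      by simp
    also have "\<dots> = ((of_real l - cnj z1) / (of_real l - z2)) * of_real ((cmod (ft d (of_real l)))\<^sup>2)"
      by (simp only: complex_norm_square)
    also have "(of_real l - cnj z1) / (of_real l - z2) = 1 + (z2 - cnj z1) / (of_real l - z2)"
      using ne by (simp add: field_simps)
    finally have "Re (ft u (of_real l) * cnj (Q (of_real l)))
      = (1 + Re ((z2 - cnj z1) / (of_real l - z2))) * (cmod (ft d (of_real l)))\<^sup>2"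
      by simp
    moreover have "1 - q / D \<le> 1 + Re ((z2 - cnj z1) / (of_real l - z2))"
    proof -
      have "- Re ((z2 - cnj z1) / (of_real l - z2)) \<le> cmod ((z2 - cnj z1) / (of_real l - z2))"
        using abs_Re_le_cmod[of "(z2 - cnj z1) / (of_real l - z2)"] by linarith
      also have "\<dots> = q / cmod (of_real l - z2)" by (simp add: q_def norm_divide)
      also have "\<dots> \<le> q / D" using Dl D0 \<open>0 \<le> q\<close> by (intro divide_left_mono mult_pos_pos) auto
      finally show ?thesis by simp
    qed
    ultimately show ?thesis by (simp add: mult_right_mono)
  qed
  have ftm: "(\<lambda>l. ft v (of_real l)) \<in> borel_measurable borel" if "v \<in> borel_measurable borel" for v
    using that unfolding ft_def by measurable
  note [measurable] = ftm[OF L2_measurable[OF uL]] ftm[OF L2_measurable[OF dL]] ftm[OF L2_measurable[OF w]]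
  have iu: "integrable \<sigma> (\<lambda>l. ft u (of_real l) * cnj (Q (of_real l)))"
  proof (rule integrable_decay[of _ "C * bp"])
    show "(\<lambda>l. ft u (of_real l) * cnj (Q (of_real l))) \<in> borel_measurable borel"
      unfolding Q_def by measurable
    show "cmod (ft u (of_real l) * cnj (Q (of_real l))) \<le> C * bp * (1 / (1 + l\<^sup>2))" for l
    proof -
      have "cmod (ft u (of_real l)) * cmod (Q (of_real l)) \<le> (C * (1 / (1 + l\<^sup>2))) * bp"
        using order_trans[OF norm_ge_zero C(2)[of l]] by (intro mult_mono C(2) bp) auto
      then show ?thesis by (simp add: norm_mult mult_ac)
    qed
  qed
  have id': "integrable \<sigma> (\<lambda>l. complex_of_real ((cmod (ft d (of_real l)))\<^sup>2))"
  proof (rule integrable_decay[of _ C])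
    show "(\<lambda>l. complex_of_real ((cmod (ft d (of_real l)))\<^sup>2)) \<in> borel_measurable borel" by measurable
    show "cmod (complex_of_real ((cmod (ft d (of_real l)))\<^sup>2)) \<le> C * (1 / (1 + l\<^sup>2))" for l
      unfolding norm_of_real using C(1)[of l] by simp
  qed
  from integrable_Re[OF id'] have id: "integrable \<sigma> (\<lambda>l. (cmod (ft d (of_real l)))\<^sup>2)" by simp
  have "(LINT l|\<sigma>. (1 - q / D) * (cmod (ft d (of_real l)))\<^sup>2)
    \<le> (LINT l|\<sigma>. Re (ft u (of_real l) * cnj (Q (of_real l))))"
  proof (rule integral_mono_AE)
    \<comment> \<open>The distance bound is available only on the support, which carries the whole
      measure.\<close>
    show "AE l in \<sigma>. (1 - q / D) * (cmod (ft d (of_real l)))\<^sup>2 \<le> Re (ft u (of_real l) * cnj (Q (of_real l)))"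
      using AE_measure_support[OF sets_\<sigma>] by eventually_elim (rule ineq)
  qed (intro integrable_mult_right id integrable_Re iu)+
  also have "\<dots> = Re (LINT l|\<sigma>. ft u (of_real l) * cnj (Q (of_real l)))" by (rule integral_Re[OF iu])
  also have "\<dots> = 0" unfolding orth by simp
  finally have "(1 - q / D) * (LINT l|\<sigma>. (cmod (ft d (of_real l)))\<^sup>2) \<le> 0" by simp
  moreover have "1 - q / D > 0" using qD D0 by simp
  ultimately show False using mult_pos_pos[OF _ int_pos, of "1 - q / D"] by linarith
qed

end
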